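(* Let $T$ be an NIP theory expanding a group, $\mathcal{G}$ a monster model of $T$ and $G\prec\mathcal{G}$ a small model. Then the map $\rho: (\mathfrak{M}_{x}(\mathcal{G},G),* ) \to E(\mathfrak{M}_{x}(\mathcal{G},G),\mathrm{conv}(G))$, $\rho(\nu)=\rho_\nu := \nu * -$, is a homeomorphism which respects the semigroup operation, and therefore an isomorphism.
   Context: Setting: $T$ is in a language $\mathcal{L}$; $x$ (and $y$ in convolutions) is a singleton variable of the sort on which the group is defined. Keisler measures: for $A\subseteq\mathcal{G}$, $\mathcal{L}_x(A)$ is the Boolean algebra of formulas in $x$ with parameters from $A$ (up to equivalence), $S_x(A)$ is the space of types over $A$, and $\mathfrak{M}_x(A)$ is the set of Keisler measures over $A$, i.e. finitely additive probability measures on $\mathcal{L}_x(A)$, with the topology induced from $[0,1]^{\mathcal{L}_x(A)}$; each is identified with the corresponding regular Borel probability measure on $S_x(A)$. $\mu|_A$ denotes restriction. The support of $\mu\in\mathfrak{M}_x(A)$ is $S(\mu)=\{p\in S_x(A):\mu(\varphi(x))>0 \text{ for all }\varphi(x)\in p\}$. $\mathfrak{M}_x(\mathcal{G},G)$ is the closed set of $\mu\in\mathfrak{M}_x(\mathcal{G})$ finitely satisfiable in $G$: whenever $\mu(\varphi(x))>0$ for $\varphi(x)\in\mathcal{L}_x(\mathcal{G})$, there is $a\in G$ with $\mathcal{G}\models\varphi(a)$. Convolution: for $\mu,\nu\in\mathfrak{M}_x(\mathcal{G})$ let $\nu_y$ be $\nu$ viewed as a measure in the variable $y$. The pair $(\mu,\nu)$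 is $*$-Borel if for every $\varphi(x,\bar c)\in\mathcal{L}_x(\mathcal{G})$ there is a small $N\prec\mathcal{G}$ containing $\bar c$ such that for every $q\in S(\nu_y|_N)$ the value $F(q):=\mu(\varphi(x\cdot d,\bar c))$ is the same for all $d\models q$ in $\mathcal{G}$, and $F:S(\nu_y|_N)\to[0,1]$ is Borel. Then $(\mu*\nu)(\varphi(x,\bar c)):=\int_{S(\nu_y|_N)}F\,d\nu_N$, where $\nu_N$ is the Borel measure $\nu_y|_N$ restricted to its support (this does not depend on $N$). Under NIP, $*$ is defined on all pairs from $\mathfrak{M}_x(\mathcal{G},G)$, and $(\mathfrak{M}_x(\mathcal{G},G),* )$ is a semigroup. Action: identify $g\in G$ with the Dirac measure $\delta_g\in\mathfrak{M}_x(\mathcal{G},G)$ and let $\mathrm{conv}(G)$ be the convex hull of $\{\delta_g:g\in G\}$ in $\mathfrak{M}_x(\mathcal{G},G)$ (with convolution as semigroup operation). For $k=\sum_{i=1}^n r_i\delta_{g_i}\in\mathrm{conv}(G)$ and $\mu\in\mathfrak{M}_x(\mathcal{G},G)$, set $\pi_k(\mu)(\varphi(x)):=\sum_{i=1}^n r_i\,\mu(\varphi(g_i\cdot x))$. Each $\pi_k$ is a continuous self-map of $\mathfrak{M}_x(\mathcal{G},G)$. Ellis semigroup: $E(\mathfrak{M}_x(\mathcal{G},G),\mathrm{conv}(G))$ is the closure of $\{\pi_k:k\in\mathrm{conv}(G)\}$ in $\mathfrak{M}_x(\mathcal{G},G)^{\mathfrak{M}_x(\mathcal{G},G)}$ with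 the product topology, equipped with the operation of composition. *)

theory Defs
  imports "HOL-Probability.Probability_Measure" "HOL-Algebra.Group"
begin

unbundle cardinal_syntax

section \<open>Many-sorted first-order logic\<close>

text \<open>
  Sorts are the elements of the type \<open>'s\<close>.  A symbol whose arity is \<open>None\<close> is not in the language.
\<close>

record ('s, 'f, 'r) language =
  fun_arity :: "'f \<Rightarrow> ('s list \<times> 's) option"
  rel_arity :: "'r \<Rightarrow> 's list option"

text \<open>\<open>Var s n\<close> is the \<open>n\<close>-th variable of sort \<open>s\<close>.\<close>

datatype ('s, 'f) tm = Var 's nat | Fun 'f "('s, 'f) tm list"

datatype ('s, 'f, 'r) fm =
    Eq "('s, 'f) tm" "('s, 'f) tm"
  | Rel 'r "('s, 'f) tm list"
  | Neg "('s, 'f, 'r) fm"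
  | Conj "('s, 'f, 'r) fm" "('s, 'f, 'r) fm"
  | Ex 's nat "('s, 'f, 'r) fm"

inductive has_sort :: "('s, 'f, 'r) language \<Rightarrow> ('s, 'f) tm \<Rightarrow> 's \<Rightarrow> bool"
  for L :: "('s, 'f, 'r) language" where
  "has_sort L (Var s n) s"
| "fun_arity L f = Some (ss, s) \<Longrightarrow> list_all2 (has_sort L) ts ss \<Longrightarrow> has_sort L (Fun f ts) s"

primrec wf_fm :: "('s, 'f, 'r) language \<Rightarrow> ('s, 'f, 'r) fm \<Rightarrow> bool" where
  "wf_fm L (Eq t u) \<longleftrightarrow> (\<exists>s. has_sort L t s \<and> has_sort L u s)"
| "wf_fm L (Rel R ts) \<longleftrightarrow> (\<exists>ss. rel_arity L R = Some ss \<and> list_all2 (has_sort L) ts ss)"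
| "wf_fm L (Neg \<phi>) \<longleftrightarrow> wf_fm L \<phi>"
| "wf_fm L (Conj \<phi> \<psi>) \<longleftrightarrow> wf_fm L \<phi> \<and> wf_fm L \<psi>"
| "wf_fm L (Ex s n \<phi>) \<longleftrightarrow> wf_fm L \<phi>"

primrec fv_tm :: "('s, 'f) tm \<Rightarrow> ('s \<times> nat) set" where
  "fv_tm (Var s n) = {(s, n)}"
| "fv_tm (Fun f ts) = \<Union> (set (map fv_tm ts))"

primrec fv :: "('s, 'f, 'r) fm \<Rightarrow> ('s \<times> nat) set" where
  "fv (Eq t u) = fv_tm t \<union> fv_tm u"
| "fv (Rel R ts) = \<Union> (set (map fv_tm ts))"
| "fv (Neg \<phi>) = fv \<phi>"
| "fv (Conj \<phi> \<psi>) = fv \<phi> \<union> fv \<psi>"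
| "fv (Ex s n \<phi>) = fv \<phi> - {(s, n)}"

record ('s, 'f, 'r, 'm) struct =
  univ :: "'s \<Rightarrow> 'm set"
  fun_int :: "'f \<Rightarrow> 'm list \<Rightarrow> 'm"
  rel_int :: "'r \<Rightarrow> 'm list \<Rightarrow> bool"

definition is_struct :: "('s, 'f, 'r) language \<Rightarrow> ('s, 'f, 'r, 'm) struct \<Rightarrow> bool" where
  "is_struct L M \<longleftrightarrow>
     (\<forall>s. univ M s \<noteq> {}) \<and>
     (\<forall>f ss s as. fun_arity L f = Some (ss, s) \<and> list_all2 (\<lambda>a s'. a \<in> univ M s') as ss
        \<longrightarrow> fun_int M f as \<in> univ M s)"

definition valid_env :: "('s, 'f, 'r, 'm) struct \<Rightarrow> ('s \<Rightarrow> nat \<Rightarrow> 'm) \<Rightarrow> bool" where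
  "valid_env M e \<longleftrightarrow> (\<forall>s n. e s n \<in> univ M s)"

definition env_upd :: "('s \<Rightarrow> nat \<Rightarrow> 'm) \<Rightarrow> 's \<Rightarrow> nat \<Rightarrow> 'm \<Rightarrow> 's \<Rightarrow> nat \<Rightarrow> 'm" where
  "env_upd e s n a = e(s := (e s)(n := a))"

primrec eval_tm :: "('s, 'f, 'r, 'm) struct \<Rightarrow> ('s \<Rightarrow> nat \<Rightarrow> 'm) \<Rightarrow> ('s, 'f) tm \<Rightarrow> 'm" where
  "eval_tm M e (Var s n) = e s n"
| "eval_tm M e (Fun f ts) = fun_int M f (map (eval_tm M e) ts)"

primrec sat :: "('s, 'f, 'r, 'm) struct \<Rightarrow> ('s \<Rightarrow> nat \<Rightarrow> 'm) \<Rightarrow> ('s, 'f, 'r) fm \<Rightarrow> bool" where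
  "sat M e (Eq t u) \<longleftrightarrow> eval_tm M e t = eval_tm M e u"
| "sat M e (Rel R ts) \<longleftrightarrow> rel_int M R (map (eval_tm M e) ts)"
| "sat M e (Neg \<phi>) \<longleftrightarrow> \<not> sat M e \<phi>"
| "sat M e (Conj \<phi> \<psi>) \<longleftrightarrow> sat M e \<phi> \<and> sat M e \<psi>"
| "sat M e (Ex s n \<phi>) \<longleftrightarrow> (\<exists>a\<in>univ M s. sat M (env_upd e s n a) \<phi>)"

definition is_theory :: "('s, 'f, 'r) language \<Rightarrow> ('s, 'f, 'r) fm set \<Rightarrow> bool" where
  "is_theory L T \<longleftrightarrow> (\<forall>\<sigma>\<in>T. wf_fm L \<sigma> \<and> fv \<sigma> = {})"

definition models ::
    "('s, 'f, 'r) language \<Rightarrow> ('s, 'f, 'r) fm set \<Rightarrow> ('s, 'f, 'r, 'm) struct \<Rightarrow> bool" where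
  "models L T M \<longleftrightarrow> is_struct L M \<and> (\<forall>\<sigma>\<in>T. \<forall>e. valid_env M e \<longrightarrow> sat M e \<sigma>)"

text \<open>\<open>elem_sub L N M\<close> is \<open>N \<prec> M\<close>.\<close>

definition elem_sub ::
    "('s, 'f, 'r) language \<Rightarrow> ('s, 'f, 'r, 'm) struct \<Rightarrow> ('s, 'f, 'r, 'm) struct \<Rightarrow> bool" where
  "elem_sub L N M \<longleftrightarrow>
     is_struct L N \<and> is_struct L M \<and> (\<forall>s. univ N s \<subseteq> univ M s) \<and>
     (\<forall>\<phi> e. wf_fm L \<phi> \<and> valid_env N e \<longrightarrow> (sat N e \<phi> \<longleftrightarrow> sat M e \<phi>))"


section \<open>NIP theories expanding a group\<close>

text \<open>
  The free variables of \<open>\<phi>\<close> lying in \<open>X\<close> form the tuple \<open>x\<close> of the partitioned formula \<open>\<phi>(x; y)\<close>,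
  and the remaining ones form \<open>y\<close>.
\<close>

definition has_IP ::
    "('s, 'f, 'r, 'm) struct \<Rightarrow> ('s, 'f, 'r) fm \<Rightarrow> ('s \<times> nat) set \<Rightarrow> bool" where
  "has_IP M \<phi> X \<longleftrightarrow>
     (\<forall>n::nat. \<exists>a b.
        (\<forall>i<n. valid_env M (a i)) \<and> (\<forall>I\<subseteq>{..<n}. valid_env M (b I)) \<and>
        (\<forall>i<n. \<forall>I\<subseteq>{..<n}.
           sat M (\<lambda>s k. if (s, k) \<in> X then a i s k else b I s k) \<phi> \<longleftrightarrow> i \<in> I))"

text \<open>
  HOL cannot quantify over the models of \<open>T\<close> in all types, so the next two notions refer to the models
  whose elements are taken from one given type.
\<close>

definition NIP_theory ::
    "('s, 'f, 'r) language \<Rightarrow> ('s, 'f, 'r) fm set \<Rightarrow> 'm itself \<Rightarrow> bool" where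
  "NIP_theory L T (_ :: 'm itself) \<longleftrightarrow>
     (\<forall>M :: ('s, 'f, 'r, 'm) struct. models L T M \<longrightarrow> (\<forall>\<phi> X. wf_fm L \<phi> \<longrightarrow> \<not> has_IP M \<phi> X))"

definition mul :: "('s, 'f, 'r, 'm) struct \<Rightarrow> 'f \<Rightarrow> 'm \<Rightarrow> 'm \<Rightarrow> 'm" where
  "mul M m a b = fun_int M m [a, b]"

definition expands_group ::
    "('s, 'f, 'r) language \<Rightarrow> ('s, 'f, 'r) fm set \<Rightarrow> 's \<Rightarrow> 'f \<Rightarrow> 'm itself \<Rightarrow> bool" where
  "expands_group L T s m (_ :: 'm itself) \<longleftrightarrow>
     fun_arity L m = Some ([s, s], s) \<and>
     (\<forall>M :: ('s, 'f, 'r, 'm) struct. models L T M \<longrightarrow>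
        (\<exists>e. group \<lparr>carrier = univ M s, monoid.mult = mul M m, one = e\<rparr>))"


section \<open>Formulas with parameters, types, monster models\<close>

text \<open>
  The algebra \<open>L\<^sub>x(A)\<close> for a variable \<open>x\<close> of sort \<open>s\<close>, computed in \<open>M\<close>.  Two formulas in \<open>x\<close> with
  parameters from \<open>M\<close> are equivalent iff they define the same subset of \<open>M\<close>, so a formula up to
  equivalence is represented by the set it defines.  The variable \<open>x\<close> is \<open>Var s 0\<close>, and the
  environment supplies the parameters through the other free variables.
\<close>

definition defsets ::
    "('s, 'f, 'r) language \<Rightarrow> ('s, 'f, 'r, 'm) struct \<Rightarrow> 's \<Rightarrow> ('s \<Rightarrow> 'm set) \<Rightarrow> 'm set set" where
  "defsets L M s A =
     {D. \<exists>\<phi> e. wf_fm L \<phi> \<and> valid_env M e \<and> (\<forall>(t, n) \<in> fv \<phi> - {(s, 0)}. e t n \<in> A t) \<and>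
           D = {a \<in> univ M s. sat M (env_upd e s 0 a) \<phi>}}"

text \<open>Complete types over \<open>A\<close>, as ultrafilters of the Boolean algebra \<open>L\<^sub>x(A)\<close>.\<close>

definition types ::
    "('s, 'f, 'r) language \<Rightarrow> ('s, 'f, 'r, 'm) struct \<Rightarrow> 's \<Rightarrow> ('s \<Rightarrow> 'm set) \<Rightarrow> 'm set set set" where
  "types L M s A =
     {p. p \<subseteq> defsets L M s A \<and> {} \<notin> p \<and> (\<forall>D\<in>p. \<forall>E\<in>p. D \<inter> E \<in> p) \<and>
         (\<forall>D\<in>defsets L M s A. D \<in> p \<or> univ M s - D \<in> p)}"

definition type_topology ::
    "('s, 'f, 'r) language \<Rightarrow> ('s, 'f, 'r, 'm) struct \<Rightarrow> 's \<Rightarrow> ('s \<Rightarrow> 'm set) \<Rightarrow> 'm set set topology" where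
  "type_topology L M s A =
     topology_generated_by {{p \<in> types L M s A. D \<in> p} |D. D \<in> defsets L M s A}"

definition realizes :: "('s, 'f, 'r, 'm) struct \<Rightarrow> 's \<Rightarrow> 'm \<Rightarrow> 'm set set \<Rightarrow> bool" where
  "realizes M s d p \<longleftrightarrow> d \<in> univ M s \<and> (\<forall>D\<in>p. d \<in> D)"

definition small :: "'k rel \<Rightarrow> ('s \<Rightarrow> 'm set) \<Rightarrow> bool" where
  "small \<kappa> A \<longleftrightarrow> |Sigma UNIV A| <o \<kappa>"

definition saturated ::
    "('s, 'f, 'r) language \<Rightarrow> 'k rel \<Rightarrow> ('s, 'f, 'r, 'm) struct \<Rightarrow> bool" where
  "saturated L \<kappa> M \<longleftrightarrow>
     (\<forall>A s. (\<forall>t. A t \<subseteq> univ M t) \<and> small \<kappa> A \<longrightarrow> (\<forall>p\<in>types L M s A. \<exists>d. realizes M s d p))"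

definition partial_elementary ::
    "('s, 'f, 'r) language \<Rightarrow> ('s, 'f, 'r, 'm) struct \<Rightarrow> ('s \<Rightarrow> 'm set) \<Rightarrow> ('s \<Rightarrow> 'm \<Rightarrow> 'm) \<Rightarrow> bool" where
  "partial_elementary L M A h \<longleftrightarrow>
     (\<forall>s. h s ` A s \<subseteq> univ M s) \<and>
     (\<forall>\<phi> e. wf_fm L \<phi> \<and> (\<forall>(s, n) \<in> fv \<phi>. e s n \<in> A s) \<longrightarrow>
        (sat M e \<phi> \<longleftrightarrow> sat M (\<lambda>s n. h s (e s n)) \<phi>))"

definition automorphism ::
    "('s, 'f, 'r) language \<Rightarrow> ('s, 'f, 'r, 'm) struct \<Rightarrow> ('s \<Rightarrow> 'm \<Rightarrow> 'm) \<Rightarrow> bool" where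
  "automorphism L M h \<longleftrightarrow>
     (\<forall>s. bij_betw (h s) (univ M s) (univ M s)) \<and>
     (\<forall>f ss s as. fun_arity L f = Some (ss, s) \<and> list_all2 (\<lambda>a t. a \<in> univ M t) as ss \<longrightarrow>
        h s (fun_int M f as) = fun_int M f (map2 h ss as)) \<and>
     (\<forall>R ss as. rel_arity L R = Some ss \<and> list_all2 (\<lambda>a t. a \<in> univ M t) as ss \<longrightarrow>
        (rel_int M R as \<longleftrightarrow> rel_int M R (map2 h ss as)))"

definition strongly_homogeneous ::
    "('s, 'f, 'r) language \<Rightarrow> 'k rel \<Rightarrow> ('s, 'f, 'r, 'm) struct \<Rightarrow> bool" where
  "strongly_homogeneous L \<kappa> M \<longleftrightarrow>
     (\<forall>A h. (\<forall>s. A s \<subseteq> univ M s) \<and> small \<kappa> A \<and> partial_elementary L M A h \<longrightarrow>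
        (\<exists>h'. automorphism L M h' \<and> (\<forall>s. \<forall>a\<in>A s. h' s a = h s a)))"

text \<open>
  \<open>\<kappa>\<close> is the cardinal that bounds smallness.  There are \<open>|L| + \<aleph>\<^sub>0\<close> formulas, so the second
  condition also makes \<open>\<kappa>\<close> uncountable.
\<close>

definition monster ::
    "('s, 'f, 'r) language \<Rightarrow> 'k rel \<Rightarrow> ('s, 'f, 'r, 'm) struct \<Rightarrow> bool" where
  "monster L \<kappa> M \<longleftrightarrow>
     Card_order \<kappa> \<and> |{\<phi> :: ('s, 'f, 'r) fm. wf_fm L \<phi>}| <o \<kappa> \<and>
     is_struct L M \<and> saturated L \<kappa> M \<and> strongly_homogeneous L \<kappa> M"


section \<open>Keisler measures\<close>

definition keisler ::
    "('s, 'f, 'r) language \<Rightarrow> ('s, 'f, 'r, 'm) struct \<Rightarrow> 's \<Rightarrow> ('s \<Rightarrow> 'm set) \<Rightarrow> ('m set \<Rightarrow> real) set" where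
  "keisler L M s A =
     {\<mu> \<in> extensional (defsets L M s A).
        (\<forall>D\<in>defsets L M s A. 0 \<le> \<mu> D) \<and> \<mu> (univ M s) = 1 \<and>
        (\<forall>D\<in>defsets L M s A. \<forall>E\<in>defsets L M s A. D \<inter> E = {} \<longrightarrow> \<mu> (D \<union> E) = \<mu> D + \<mu> E)}"

text \<open>The measures over \<open>M\<close> that are finitely satisfiable in \<open>G\<close>, and their topology.\<close>

definition keisler_fs ::
    "('s, 'f, 'r) language \<Rightarrow> ('s, 'f, 'r, 'm) struct \<Rightarrow> ('s, 'f, 'r, 'm) struct \<Rightarrow> 's
      \<Rightarrow> ('m set \<Rightarrow> real) set" where
  "keisler_fs L M G s =
     {\<mu> \<in> keisler L M s (univ M). \<forall>D\<in>defsets L M s (univ M). \<mu> D > 0 \<longrightarrow> (\<exists>a\<in>univ G s. a \<in> D)}"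

definition keisler_fs_topology ::
    "('s, 'f, 'r) language \<Rightarrow> ('s, 'f, 'r, 'm) struct \<Rightarrow> ('s, 'f, 'r, 'm) struct \<Rightarrow> 's
      \<Rightarrow> ('m set \<Rightarrow> real) topology" where
  "keisler_fs_topology L M G s =
     subtopology (product_topology (\<lambda>_. top_of_set {0..1}) (defsets L M s (univ M))) (keisler_fs L M G s)"

definition support ::
    "('s, 'f, 'r) language \<Rightarrow> ('s, 'f, 'r, 'm) struct \<Rightarrow> 's \<Rightarrow> ('s \<Rightarrow> 'm set) \<Rightarrow> ('m set \<Rightarrow> real)
      \<Rightarrow> 'm set set set" where
  "support L M s A \<mu> = {p \<in> types L M s A. \<forall>D\<in>p. \<mu> D > 0}"

definition regular_Borel_prob :: "'a topology \<Rightarrow> 'a measure \<Rightarrow> bool" where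
  "regular_Borel_prob X P \<longleftrightarrow>
     prob_space P \<and> sets P = sets (sigma (topspace X) {U. openin X U}) \<and>
     (\<forall>B\<in>sets P.
        emeasure P B = (SUP K\<in>{K. compactin X K \<and> K \<subseteq> B}. emeasure P K) \<and>
        emeasure P B = (INF U\<in>{U. openin X U \<and> B \<subseteq> U}. emeasure P U))"

text \<open>The regular Borel probability measure on the type space with which a Keisler measure is identified.\<close>

definition type_measure ::
    "('s, 'f, 'r) language \<Rightarrow> ('s, 'f, 'r, 'm) struct \<Rightarrow> 's \<Rightarrow> ('s \<Rightarrow> 'm set) \<Rightarrow> ('m set \<Rightarrow> real)
      \<Rightarrow> 'm set set measure" where
  "type_measure L M s A \<mu> =
     (THE P. regular_Borel_prob (type_topology L M s A) P \<and>
        (\<forall>D\<in>defsets L M s A. measure P {p \<in> types L M s A. D \<in> p} = \<mu> D))"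


section \<open>Convolution\<close>

text \<open>If \<open>D\<close> is defined by \<open>\<phi>(x)\<close>, these are defined by \<open>\<phi>(x \<cdot> d)\<close> and \<open>\<phi>(d \<cdot> x)\<close>.\<close>

definition rshift :: "('s, 'f, 'r, 'm) struct \<Rightarrow> 's \<Rightarrow> 'f \<Rightarrow> 'm \<Rightarrow> 'm set \<Rightarrow> 'm set" where
  "rshift M s m d D = {a \<in> univ M s. mul M m a d \<in> D}"

definition lshift :: "('s, 'f, 'r, 'm) struct \<Rightarrow> 's \<Rightarrow> 'f \<Rightarrow> 'm \<Rightarrow> 'm set \<Rightarrow> 'm set" where
  "lshift M s m d D = {a \<in> univ M s. mul M m d a \<in> D}"

text \<open>\<open>\<nu>|\<^sub>N\<close> as a Borel measure restricted to its support.\<close>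

definition supp_measure ::
    "('s, 'f, 'r) language \<Rightarrow> ('s, 'f, 'r, 'm) struct \<Rightarrow> 's \<Rightarrow> ('m set \<Rightarrow> real)
      \<Rightarrow> ('s, 'f, 'r, 'm) struct \<Rightarrow> 'm set set measure" where
  "supp_measure L M s \<nu> N =
     (let \<nu>N = restrict \<nu> (defsets L M s (univ N))
      in restrict_space (type_measure L M s (univ N) \<nu>N) (support L M s (univ N) \<nu>N))"

definition fiber_value ::
    "('s, 'f, 'r, 'm) struct \<Rightarrow> 's \<Rightarrow> 'f \<Rightarrow> ('m set \<Rightarrow> real) \<Rightarrow> 'm set \<Rightarrow> 'm set set \<Rightarrow> real" where
  "fiber_value M s m \<mu> D q = \<mu> (rshift M s m (SOME d. realizes M s d q) D)"

text \<open>The models \<open>N\<close> that can be used to compute \<open>(\<mu> * \<nu>)(D)\<close>.\<close>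

definition conv_base ::
    "('s, 'f, 'r) language \<Rightarrow> 'k rel \<Rightarrow> ('s, 'f, 'r, 'm) struct \<Rightarrow> 's \<Rightarrow> 'f
      \<Rightarrow> ('m set \<Rightarrow> real) \<Rightarrow> ('m set \<Rightarrow> real) \<Rightarrow> 'm set \<Rightarrow> ('s, 'f, 'r, 'm) struct \<Rightarrow> bool" where
  "conv_base L \<kappa> M s m \<mu> \<nu> D N \<longleftrightarrow>
     elem_sub L N M \<and> small \<kappa> (univ N) \<and> D \<in> defsets L M s (univ N) \<and>
     (\<forall>q \<in> support L M s (univ N) (restrict \<nu> (defsets L M s (univ N))).
        \<forall>d d'. realizes M s d q \<and> realizes M s d' q \<longrightarrow>
          \<mu> (rshift M s m d D) = \<mu> (rshift M s m d' D)) \<and>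
     fiber_value M s m \<mu> D \<in> borel_measurable (supp_measure L M s \<nu> N)"

definition star_Borel ::
    "('s, 'f, 'r) language \<Rightarrow> 'k rel \<Rightarrow> ('s, 'f, 'r, 'm) struct \<Rightarrow> 's \<Rightarrow> 'f
      \<Rightarrow> ('m set \<Rightarrow> real) \<Rightarrow> ('m set \<Rightarrow> real) \<Rightarrow> bool" where
  "star_Borel L \<kappa> M s m \<mu> \<nu> \<longleftrightarrow>
     (\<forall>D\<in>defsets L M s (univ M). \<exists>N. conv_base L \<kappa> M s m \<mu> \<nu> D N)"

text \<open>
  The choice of \<open>N\<close> does not affect the value.  For pairs that are not \<open>*\<close>-Borel the convolution
  is left unspecified.
\<close>

definition convolution ::
    "('s, 'f, 'r) language \<Rightarrow> 'k rel \<Rightarrow> ('s, 'f, 'r, 'm) struct \<Rightarrow> 's \<Rightarrow> 'f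
      \<Rightarrow> ('m set \<Rightarrow> real) \<Rightarrow> ('m set \<Rightarrow> real) \<Rightarrow> ('m set \<Rightarrow> real)" where
  "convolution L \<kappa> M s m \<mu> \<nu> =
     (if star_Borel L \<kappa> M s m \<mu> \<nu>
      then (\<lambda>D\<in>defsets L M s (univ M).
              let N = (SOME N. conv_base L \<kappa> M s m \<mu> \<nu> D N)
              in integral\<^sup>L (supp_measure L M s \<nu> N) (fiber_value M s m \<mu> D))
      else undefined)"


section \<open>The Ellis semigroup\<close>

definition dirac ::
    "('s, 'f, 'r) language \<Rightarrow> ('s, 'f, 'r, 'm) struct \<Rightarrow> 's \<Rightarrow> 'm \<Rightarrow> 'm set \<Rightarrow> real" where
  "dirac L M s a = (\<lambda>D\<in>defsets L M s (univ M). indicator D a)"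

text \<open>\<open>conv_rep L M G s k n r g\<close>: the measure \<open>k\<close> is the convex combination of the Dirac measures
  at \<open>g 0, \<dots>, g (n - 1)\<close> in \<open>G\<close> with weights \<open>r 0, \<dots>, r (n - 1)\<close>.\<close>

definition conv_rep ::
    "('s, 'f, 'r) language \<Rightarrow> ('s, 'f, 'r, 'm) struct \<Rightarrow> ('s, 'f, 'r, 'm) struct \<Rightarrow> 's
      \<Rightarrow> ('m set \<Rightarrow> real) \<Rightarrow> nat \<Rightarrow> (nat \<Rightarrow> real) \<Rightarrow> (nat \<Rightarrow> 'm) \<Rightarrow> bool" where
  "conv_rep L M G s k n r g \<longleftrightarrow>
     (\<forall>i<n. 0 \<le> r i \<and> g i \<in> univ G s) \<and> (\<Sum>i<n. r i) = 1 \<and>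
     k = (\<lambda>D\<in>defsets L M s (univ M). \<Sum>i<n. r i * dirac L M s (g i) D)"

definition conv_hull ::
    "('s, 'f, 'r) language \<Rightarrow> ('s, 'f, 'r, 'm) struct \<Rightarrow> ('s, 'f, 'r, 'm) struct \<Rightarrow> 's
      \<Rightarrow> ('m set \<Rightarrow> real) set" where
  "conv_hull L M G s = {k. \<exists>n r g. conv_rep L M G s k n r g}"

text \<open>The map \<open>\<pi>\<^sub>k\<close>.  It does not depend on how \<open>k\<close> is written as a convex combination.\<close>

definition action_map ::
    "('s, 'f, 'r) language \<Rightarrow> ('s, 'f, 'r, 'm) struct \<Rightarrow> ('s, 'f, 'r, 'm) struct \<Rightarrow> 's \<Rightarrow> 'f
      \<Rightarrow> ('m set \<Rightarrow> real) \<Rightarrow> ('m set \<Rightarrow> real) \<Rightarrow> ('m set \<Rightarrow> real)" where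
  "action_map L M G s m k =
     (THE \<pi>. \<exists>n r g. conv_rep L M G s k n r g \<and>
        \<pi> = (\<lambda>\<mu>\<in>keisler_fs L M G s. \<lambda>D\<in>defsets L M s (univ M).
               \<Sum>i<n. r i * \<mu> (lshift M s m (g i) D)))"

definition selfmap_topology ::
    "('s, 'f, 'r) language \<Rightarrow> ('s, 'f, 'r, 'm) struct \<Rightarrow> ('s, 'f, 'r, 'm) struct \<Rightarrow> 's
      \<Rightarrow> (('m set \<Rightarrow> real) \<Rightarrow> ('m set \<Rightarrow> real)) topology" where
  "selfmap_topology L M G s =
     product_topology (\<lambda>_. keisler_fs_topology L M G s) (keisler_fs L M G s)"

definition ellis ::
    "('s, 'f, 'r) language \<Rightarrow> ('s, 'f, 'r, 'm) struct \<Rightarrow> ('s, 'f, 'r, 'm) struct \<Rightarrow> 's \<Rightarrow> 'f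
      \<Rightarrow> (('m set \<Rightarrow> real) \<Rightarrow> ('m set \<Rightarrow> real)) set" where
  "ellis L M G s m = selfmap_topology L M G s closure_of (action_map L M G s m ` conv_hull L M G s)"

definition ellis_topology ::
    "('s, 'f, 'r) language \<Rightarrow> ('s, 'f, 'r, 'm) struct \<Rightarrow> ('s, 'f, 'r, 'm) struct \<Rightarrow> 's \<Rightarrow> 'f
      \<Rightarrow> (('m set \<Rightarrow> real) \<Rightarrow> ('m set \<Rightarrow> real)) topology" where
  "ellis_topology L M G s m = subtopology (selfmap_topology L M G s) (ellis L M G s m)"

definition rho ::
    "('s, 'f, 'r) language \<Rightarrow> 'k rel \<Rightarrow> ('s, 'f, 'r, 'm) struct \<Rightarrow> ('s, 'f, 'r, 'm) struct \<Rightarrow> 's \<Rightarrow> 'f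
      \<Rightarrow> ('m set \<Rightarrow> real) \<Rightarrow> ('m set \<Rightarrow> real) \<Rightarrow> ('m set \<Rightarrow> real)" where
  "rho L \<kappa> M G s m \<nu> = (\<lambda>\<mu>\<in>keisler_fs L M G s. convolution L \<kappa> M s m \<nu> \<mu>)"

definition semigroup_on :: "'a set \<Rightarrow> ('a \<Rightarrow> 'a \<Rightarrow> 'a) \<Rightarrow> bool" where
  "semigroup_on S f \<longleftrightarrow>
     (\<forall>x\<in>S. \<forall>y\<in>S. f x y \<in> S) \<and> (\<forall>x\<in>S. \<forall>y\<in>S. \<forall>z\<in>S. f (f x y) z = f x (f y z))"

definition semigroup_iso ::
    "'a set \<Rightarrow> ('a \<Rightarrow> 'a \<Rightarrow> 'a) \<Rightarrow> 'b set \<Rightarrow> ('b \<Rightarrow> 'b \<Rightarrow> 'b) \<Rightarrow> ('a \<Rightarrow> 'b) \<Rightarrow> bool" where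
  "semigroup_iso S f S' f' h \<longleftrightarrow>
     semigroup_on S f \<and> semigroup_on S' f' \<and> bij_betw h S S' \<and>
     (\<forall>x\<in>S. \<forall>y\<in>S. h (f x y) = f' (h x) (h y))"

end

theory Submission
  imports Defs "HOL-Real_Asymp.Real_Asymp"
begin

text \<open>
  Everything rests on one continuity statement: for a fixed measure \<open>\<nu>\<close> and a definable set \<open>D\<close>, the
  number \<open>(\<mu> * \<nu>)(D)\<close> depends continuously on \<open>\<mu>\<close>.  Granting it, the theorem is soft.  The convex hull
  \<open>conv(G)\<close> is dense in the compact Hausdorff space of measures finitely satisfiable in \<open>G\<close>, because
  finitely many values of such a measure can be interpolated exactly (\<open>conv_interpolate\<close>), and on
  \<open>conv(G)\<close> the convolution is the action: \<open>\<rho>\<^sub>k = \<pi>\<^sub>k\<close> (\<open>cv_conv\<close>, \<open>action_map_eq\<close>).  Hence \<open>\<rho>\<close> is continuous,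
  its image is compact, therefore closed, and it contains the maps \<open>\<pi>\<^sub>k\<close> as a dense subset; so the image is
  the Ellis semigroup (\<open>ellis_eq\<close>).  It is injective because \<open>\<nu> * \<delta>\<^sub>g\<close> is the right translate of \<open>\<nu>\<close> by
  \<open>g\<close> (\<open>cv_dirac\<close>).  Associativity, which says that \<open>\<rho>\<close> respects the operations, is checked on finite
  combinations of point masses and extends by density, first in the second factor and then in the
  first (\<open>cv_assoc\<close>).

  To prove continuity, let measures \<open>k\<close> in \<open>conv(G)\<close> converge to \<open>\<mu>\<close>.  Over a small model \<open>N\<close> containing \<open>G\<close>
  and the parameters of \<open>D\<close>, the functions \<open>F\<^sub>k(q) = k(D \<cdot> d\<^sup>-\<^sup>1)\<close>, for \<open>d\<close> realizing \<open>q\<close>, are continuous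
  on the space of types over \<open>N\<close> and converge pointwise to \<open>F\<^sub>\<mu>\<close>.  Pointwise convergence along a
  filter does not in general allow passing to the limit under an integral, nor does it make the limit
  Borel; NIP provides both.  First, the 0-1 functions given by the elements of \<open>G\<close> have finite VC
  dimension, and this survives in a scale-sensitive form for their convex combinations
  (\<open>convex_combinations_not_shattered\<close>, through the Sauer-Shelah lemma and Massart's bound on
  Rademacher averages).  Secondly, for reals \<open>a < b\<close> there is then a bound on how often the values of
  generic members of the family can alternate between \<open>> b\<close> and \<open>< a\<close> in every neighbourhood of a
  point (\<open>alternates_bounded\<close>); this is the topological form of the alternation number of Morley sequences.
  Stratifying the space by this number, with closed conditions, separates \<open>F\<^sub>\<mu> > b\<close> from
  \<open>F\<^sub>\<mu> < a\<close> by Borel sets, and on compact subsets of a stratum the inequality \<open>F\<^sub>k \<ge> a\<close> holds uniformly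
  for all \<open>k\<close> close to \<open>\<mu>\<close> (\<open>stratum_eventually\<close>).  Inner regularity turns this into convergence of
  the integrals (\<open>limit_integral\<close>).

  The remaining ingredients are classical: the unique regular Borel extension of a finitely additive
  measure on the clopen sets of a Boolean space, compactness of type spaces, and the downward
  Loewenheim-Skolem theorem.  The latter supplies the models \<open>N\<close> and also shows that the value of the
  convolution does not depend on them, since any two lie in a common larger one.
\<close>

section \<open>Finite VC dimension and convex combinations\<close>

definition shattered :: "'a set set \<Rightarrow> 'a set \<Rightarrow> bool" where
  "shattered \<F> A \<longleftrightarrow> (\<forall>B\<subseteq>A. \<exists>C\<in>\<F>. C \<inter> A = B)"

text \<open>
  Pajor's form of the Sauer-Shelah lemma, by induction on the ground set.  Deleting a point \<open>x\<close> splits the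
  family into the sets \<open>Fa\<close> without \<open>x\<close> and the traces \<open>Fb\<close> of the sets with \<open>x\<close>.  A set shattered by
  \<open>Fa \<union> Fb\<close> is shattered by \<open>\<F>\<close>, and a set \<open>A\<close> shattered by \<open>Fa \<inter> Fb\<close> yields the further shattered set
  \<open>insert x A\<close>.
\<close>
lemma sauer_shelah:
  assumes "finite S" "\<F> \<subseteq> Pow S"
  shows "card \<F> \<le> card {A. A \<subseteq> S \<and> shattered \<F> A}"
  using assms
proof (induction S arbitrary: \<F> rule: finite_induct)
  case empty
  have fin: "finite {A. A \<subseteq> {} \<and> shattered \<F> A}" by simp
  show ?case
  proof (cases "\<F> = {}")
    case False
    with empty have "\<F> = {{}}" by auto
    then have "{A. A \<subseteq> {} \<and> shattered \<F> A} = {{}}" by (auto simp: shattered_def)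
    with \<open>\<F> = {{}}\<close> show ?thesis by simp
  qed simp
next
  case (insert x S)
  define Fa where "Fa = {C\<in>\<F>. x \<notin> C}"
  define Fb where "Fb = (\<lambda>C. C - {x}) ` {C\<in>\<F>. x \<in> C}"
  have fin: "finite \<F>" using insert by (meson finite_Pow_iff finite_insert finite_subset)
  have cb: "card Fb = card {C\<in>\<F>. x \<in> C}"
    unfolding Fb_def by (intro card_image inj_onI) auto
  have "card \<F> = card Fa + card {C\<in>\<F>. x \<in> C}"
    unfolding Fa_def using fin by (subst card_Un_disjoint [symmetric]) (auto intro: arg_cong [where f=card])
  also have "\<dots> = card (Fa \<union> Fb) + card (Fa \<inter> Fb)"
    unfolding cb [symmetric] by (rule card_Un_Int) (auto simp: Fa_def Fb_def fin)
  also have "card (Fa \<union> Fb) \<le> card {A. A \<subseteq> S \<and> shattered (Fa \<union> Fb) A}"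
    using insert.prems by (intro insert.IH) (auto simp: Fa_def Fb_def)
  also have "card (Fa \<inter> Fb) \<le> card {A. A \<subseteq> S \<and> shattered (Fa \<inter> Fb) A}"
    using insert.prems by (intro insert.IH) (auto simp: Fa_def Fb_def)
  also have "card {A. A \<subseteq> S \<and> shattered (Fa \<inter> Fb) A}
      = card (insert x ` {A. A \<subseteq> S \<and> shattered (Fa \<inter> Fb) A})"
    using insert.hyps by (intro card_image [symmetric] inj_onI) (auto simp: insert_eq_iff insert_ident dest: subsetD)
  also have "card {A. A \<subseteq> S \<and> shattered (Fa \<union> Fb) A} + \<dots>
      = card ({A. A \<subseteq> S \<and> shattered (Fa \<union> Fb) A} \<union> insert x ` {A. A \<subseteq> S \<and> shattered (Fa \<inter> Fb) A})"
    using insert.hyps by (subst card_Un_disjoint) auto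
  also have "\<dots> \<le> card {A. A \<subseteq> insert x S \<and> shattered \<F> A}"
  proof (rule card_mono)
    show "finite {A. A \<subseteq> insert x S \<and> shattered \<F> A}" using insert.hyps by simp
    have 1: "shattered \<F> A" if "A \<subseteq> S" "shattered (Fa \<union> Fb) A" for A
      unfolding shattered_def
    proof (intro allI impI)
      fix B assume "B \<subseteq> A"
      with that obtain C where C: "C \<in> Fa \<union> Fb" "C \<inter> A = B" unfolding shattered_def by blast
      have "x \<notin> A" using that insert.hyps by auto
      with C show "\<exists>C\<in>\<F>. C \<inter> A = B" unfolding Fa_def Fb_def by auto
    qed
    have 2: "shattered \<F> (insert x A)" if A: "A \<subseteq> S" "shattered (Fa \<inter> Fb) A" for A
      unfolding shattered_def
    proof (intro allI impI)
      fix B assume B: "B \<subseteq> insert x A"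
      then have "B - {x} \<subseteq> A" by auto
      with A obtain C where C: "C \<in> Fa" "C \<in> Fb" "C \<inter> A = B - {x}" unfolding shattered_def by blast
      have xA: "x \<notin> A" using A insert.hyps by auto
      obtain C' where C': "C' \<in> \<F>" "x \<in> C'" "C = C' - {x}" using C unfolding Fb_def by auto
      have CF: "C \<in> \<F>" "x \<notin> C" using C unfolding Fa_def by auto
      show "\<exists>C\<in>\<F>. C \<inter> insert x A = B"
      proof (cases "x \<in> B")
        case True
        then have "C' \<inter> insert x A = B" using C C' xA B by blast
        with C' show ?thesis by blast
      next
        case False
        then have "C \<inter> insert x A = B" using C CF by blast
        with CF show ?thesis by blast
      qed
    qed
    show "{A. A \<subseteq> S \<and> shattered (Fa \<union> Fb) A} \<union> insert x ` {A. A \<subseteq> S \<and> shattered (Fa \<inter> Fb) A}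
      \<subseteq> {A. A \<subseteq> insert x S \<and> shattered \<F> A}"
      using 1 2 by blast
  qed
  finally show ?case by simp
qed

text \<open>
  Only the polynomial growth in \<open>n\<close> matters; the summand \<open>d\<close> covers the case \<open>n = 0\<close>.
\<close>
lemma card_no_shattered_le:
  assumes "\<F> \<subseteq> Pow {..<n}" and "\<And>A. A \<subseteq> {..<n} \<Longrightarrow> card A = d \<Longrightarrow> \<not> shattered \<F> A"
  shows "card \<F> \<le> d * n ^ d + d"
proof -
  have sub: "shattered \<F> B" if "shattered \<F> A" "B \<subseteq> A" for A B :: "nat set"
    unfolding shattered_def
  proof (intro allI impI)
    fix C assume "C \<subseteq> B"
    with that obtain D where "D \<in> \<F>" "D \<inter> A = C" unfolding shattered_def by (meson subset_trans)
    with \<open>C \<subseteq> B\<close> \<open>B \<subseteq> A\<close> show "\<exists>D\<in>\<F>. D \<inter> B = C" by blast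
  qed
  have "{A. A \<subseteq> {..<n} \<and> shattered \<F> A} \<subseteq> (\<Union>i<d. {A. A \<subseteq> {..<n} \<and> card A = i})"
  proof
    fix A assume A: "A \<in> {A. A \<subseteq> {..<n} \<and> shattered \<F> A}"
    have "card A < d"
    proof (rule ccontr)
      assume "\<not> card A < d"
      then obtain B where B: "B \<subseteq> A" "card B = d" by (meson obtain_subset_with_card_n not_less)
      with A sub assms(2)[of B] show False by blast
    qed
    with A show "A \<in> (\<Union>i<d. {A. A \<subseteq> {..<n} \<and> card A = i})" by auto
  qed
  then have "card {A. A \<subseteq> {..<n} \<and> shattered \<F> A} \<le> card (\<Union>i<d. {A. A \<subseteq> {..<n} \<and> card A = i})"
    by (intro card_mono) auto
  also have "\<dots> \<le> (\<Sum>i<d. card {A. A \<subseteq> {..<n} \<and> card A = i})" by (rule card_UN_le) simp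
  also have "\<dots> = (\<Sum>i<d. n choose i)" by (simp add: n_subsets)
  also have "\<dots> \<le> (\<Sum>i<d. n ^ d + 1)"
  proof (rule sum_mono)
    fix i assume i: "i \<in> {..<d}"
    show "n choose i \<le> n ^ d + 1"
    proof (cases "i \<le> n \<and> n > 0")
      case True
      then have "n choose i \<le> n ^ i" by (intro binomial_le_pow) simp
      also have "\<dots> \<le> n ^ d" using i True by (intro power_increasing) auto
      finally show ?thesis by simp
    qed (cases i; auto simp: binomial_eq_0)
  qed
  also have "\<dots> = d * n ^ d + d" by (simp add: algebra_simps)
  finally show ?thesis using sauer_shelah[of "{..<n}" \<F>] assms(1) by simp
qed

definition rademacher :: "nat set \<Rightarrow> nat \<Rightarrow> real" where
  "rademacher I i = (if i \<in> I then 1 else - 1)"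

lemma sum_rademacher: 
  assumes "i < n" shows "(\<Sum>I\<in>Pow {..<n}. rademacher I i) = 0"
proof -
  have bij: "bij_betw (\<lambda>I. if i \<in> I then I - {i} else insert i I) (Pow {..<n}) (Pow {..<n})"
    by (rule bij_betwI[where g = "\<lambda>I. if i \<in> I then I - {i} else insert i I"]) (use assms in \<open>auto split: if_splits\<close>)
  have "(\<Sum>I\<in>Pow {..<n}. rademacher I i) = (\<Sum>I\<in>Pow {..<n}. rademacher (if i \<in> I then I - {i} else insert i I) i)"
    using sum.reindex_bij_betw[OF bij, of "\<lambda>I. rademacher I i"] by simp
  also have "\<dots> = (\<Sum>I\<in>Pow {..<n}. - rademacher I i)" by (rule sum.cong) (auto simp: rademacher_def)
  finally show ?thesis by (simp add: sum_negf)
qed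

lemma exp_plus_exp_minus_le:
  fixes x :: real
  assumes "0 \<le> x" "x \<le> 1"
  shows "exp x + exp (- x) \<le> 2 * exp (x\<^sup>2)"
proof -
  have "exp x \<le> 1 + x + x\<^sup>2" using assms exp_bound by auto
  moreover have "exp (- x) \<le> 1 - x + x\<^sup>2"
  proof -
    have "exp (- x) \<le> 1 / (1 + x)"
      using assms exp_ge_add_one_self[of x] by (simp add: exp_minus field_simps)
    also have "\<dots> \<le> 1 - x + x\<^sup>2"
      using assms by (simp add: field_simps power2_eq_square)
    finally show ?thesis .
  qed
  ultimately show ?thesis using exp_ge_add_one_self[of "x\<^sup>2"] by linarith
qed

lemma exp_sum_signs_le:
  fixes v :: "nat \<Rightarrow> real"
  assumes v: "\<And>i. i < n \<Longrightarrow> v i \<in> {0, 1}" and t: "0 \<le> t" "t \<le> 1"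
  shows "(\<Sum>I\<in>Pow {..<n}. exp (t * (\<Sum>i<n. rademacher I i * v i))) \<le> 2 ^ n * exp (n * t\<^sup>2)"
proof -
  have "(\<Sum>I\<in>Pow {..<n}. exp (t * (\<Sum>i<n. rademacher I i * v i)))
      = (\<Sum>I\<in>Pow {..<n}. (\<Prod>i\<in>I. exp (t * v i)) * (\<Prod>i\<in>{..<n} - I. exp (- (t * v i))))"
  proof (rule sum.cong)
    fix I assume I: "I \<in> Pow {..<n}"
    have "exp (t * (\<Sum>i<n. rademacher I i * v i)) = (\<Prod>i<n. exp (t * (rademacher I i * v i)))"
      by (simp add: sum_distrib_left exp_sum)
    also have "\<dots> = (\<Prod>i\<in>I. exp (t * (rademacher I i * v i))) * (\<Prod>i\<in>{..<n} - I. exp (t * (rademacher I i * v i)))"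
      using I by (subst prod.subset_diff[of I]) (auto simp: mult.commute)
    also have "\<dots> = (\<Prod>i\<in>I. exp (t * v i)) * (\<Prod>i\<in>{..<n} - I. exp (- (t * v i)))"
      by (intro arg_cong2[where f="(*)"] prod.cong) (auto simp: rademacher_def)
    finally show "exp (t * (\<Sum>i<n. rademacher I i * v i)) = (\<Prod>i\<in>I. exp (t * v i)) * (\<Prod>i\<in>{..<n} - I. exp (- (t * v i)))" .
  qed simp
  also have "\<dots> = (\<Prod>i<n. exp (t * v i) + exp (- (t * v i)))" by (simp add: prod_add)
  also have "\<dots> \<le> (\<Prod>i<n. 2 * exp (t\<^sup>2))"
  proof (rule prod_mono)
    fix i assume "i \<in> {..<n}"
    then have "v i = 0 \<or> v i = 1" using v by auto
    then show "0 \<le> exp (t * v i) + exp (- (t * v i)) \<and> exp (t * v i) + exp (- (t * v i)) \<le> 2 * exp (t\<^sup>2)"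
      using exp_plus_exp_minus_le[OF t] by (auto intro: add_nonneg_nonneg)
  qed
  also have "\<dots> = 2 ^ n * exp (n * t\<^sup>2)" by (simp add: power_mult_distrib exp_of_nat_mult[symmetric])
  finally show ?thesis .
qed

text \<open>
  Massart's bound for a finite class, with \<open>n c\<close> a lower bound for the average over all sign patterns of
  the correlation with a vector of \<open>V\<close> chosen after the signs.  The inequality \<open>x \<le> exp x\<close> is applied to
  \<open>x = t \<langle>\<sigma>, v\<^sub>\<sigma>\<rangle> - A\<close> with \<open>A = n t\<^sup>2 + ln |V|\<close>; the exponentials of all vectors in \<open>V\<close> together then average
  to at most 1.  The choice \<open>t = c / 2\<close> is optimal.
\<close>
lemma rademacher_le:
  fixes v :: "nat set \<Rightarrow> nat \<Rightarrow> real"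
  assumes V: "finite V" "\<And>I. I \<subseteq> {..<n} \<Longrightarrow> v I \<in> V"
    and v: "\<And>w i. w \<in> V \<Longrightarrow> i < n \<Longrightarrow> w i \<in> {0, 1}"
    and c: "0 \<le> c" "c \<le> 2" and ge: "2 ^ n * (n * c) \<le> (\<Sum>I\<in>Pow {..<n}. \<Sum>i<n. rademacher I i * v I i)"
  shows "n * c\<^sup>2 / 4 \<le> 1 + ln (card V)"
proof -
  define t where "t = c / 2"
  have t: "0 \<le> t" "t \<le> 1" using c by (auto simp: t_def)
  define A where "A = n * t\<^sup>2 + ln (card V)"
  have "v {} \<in> V" using V by auto
  then have card: "card V > 0" using V by (auto simp: card_gt_0_iff)
  have "2 ^ n * (t * (n * c) - A) \<le> t * (\<Sum>I\<in>Pow {..<n}. \<Sum>i<n. rademacher I i * v I i) - 2 ^ n * A"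
    using mult_left_mono[OF ge t(1)] by (simp add: algebra_simps)
  also have "\<dots> = (\<Sum>I\<in>Pow {..<n}. t * (\<Sum>i<n. rademacher I i * v I i) - A)"
    by (simp add: sum_subtractf sum_distrib_left card_Pow)
  also have "\<dots> \<le> (\<Sum>I\<in>Pow {..<n}. exp (t * (\<Sum>i<n. rademacher I i * v I i) - A))"
  proof (rule sum_mono)
    fix I
    show "t * (\<Sum>i<n. rademacher I i * v I i) - A \<le> exp (t * (\<Sum>i<n. rademacher I i * v I i) - A)"
      using exp_ge_add_one_self[of "t * (\<Sum>i<n. rademacher I i * v I i) - A"] by linarith
  qed
  also have "\<dots> \<le> (\<Sum>I\<in>Pow {..<n}. \<Sum>w\<in>V. exp (t * (\<Sum>i<n. rademacher I i * w i) - A))"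
    by (intro sum_mono member_le_sum[where f = "\<lambda>w. exp (t * (\<Sum>i<n. rademacher _ i * w i) - A)"]) (use V in auto)
  also have "\<dots> = (\<Sum>w\<in>V. (\<Sum>I\<in>Pow {..<n}. exp (t * (\<Sum>i<n. rademacher I i * w i))) * exp (- A))"
    by (subst sum.swap) (simp add: sum_distrib_right exp_diff exp_minus divide_inverse)
  also have "\<dots> \<le> (\<Sum>w\<in>V. (2 ^ n * exp (n * t\<^sup>2)) * exp (- A))"
    using v t by (intro sum_mono mult_right_mono exp_sum_signs_le) auto
  also have "\<dots> = 2 ^ n"
    using card by (simp add: A_def exp_minus exp_add exp_diff)
  finally have "t * (n * c) - A \<le> 1" by simp
  then show ?thesis using card by (simp add: A_def t_def power2_eq_square field_simps)
qed

text \<open>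
  Suppose \<open>f 0, \<dots>, f (n - 1)\<close> were shattered at the levels \<open>a < b\<close>, by points \<open>y I\<close>.  The sum over all
  sign patterns \<open>I\<close> of the signed sums of the values \<open>f i (y I)\<close> is at least \<open>2 ^ n * n * (b - a) / 2\<close>, since
  the signs sum to 0.  As the points depend on the pattern only, this sum splits over \<open>i\<close> and each part is
  affine in \<open>f i\<close>; so \<open>f i\<close> may be replaced by one of the 0-1 functions \<open>E g\<close> that it averages without
  decreasing the sum.  The 0-1 vectors that arise are polynomially many in \<open>n\<close> by the Sauer-Shelah
  lemma, which contradicts Massart's bound for large \<open>n\<close>.
\<close>
lemma convex_combinations_not_shattered:
  fixes E :: "'g \<Rightarrow> 'y \<Rightarrow> bool" and d :: nat
  assumes no: "\<not> (\<exists>g. (\<forall>i<d. g i \<in> A) \<and> (\<forall>I\<subseteq>{..<d}. \<exists>y\<in>Y. \<forall>i<d. E (g i) y \<longleftrightarrow> i \<in> I))"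
    and ab: "a < b" "b \<le> a + 1"
  shows "\<exists>n. \<forall>f :: nat \<Rightarrow> 'y \<Rightarrow> real.
     (\<forall>i<n. \<exists>N r g. (\<forall>j<N. 0 \<le> r j \<and> g j \<in> A) \<and> (\<Sum>j<N. r j) = 1 \<and>
        (\<forall>y\<in>Y. f i y = (\<Sum>j<(N::nat). r j * of_bool (E (g j) y)))) \<longrightarrow>
     \<not> (\<forall>I\<subseteq>{..<n}. \<exists>y\<in>Y. \<forall>i<n. if i \<in> I then f i y > b else f i y < a)"
proof -
  \<comment> \<open>The distance of the two levels from their midpoint.\<close>
  define c where "c = (b - a) / 2"
  have c: "0 < c" "c \<le> 2" using ab by (auto simp: c_def)
  have "eventually (\<lambda>n. real n * c\<^sup>2 / 4 > 1 + ln (d * real n ^ d + d)) sequentially"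
  proof (cases "d = 0")
    case True
    show ?thesis using c unfolding True by simp real_asymp
  next
    case False
    then have d: "real d > 0" by simp
    have "eventually (\<lambda>n. real n * c\<^sup>2 / 4 > 1 + ln (d * (2 * real n ^ d))) sequentially"
      using c d by real_asymp
    moreover have "eventually (\<lambda>n::nat. n > 0) sequentially" by (rule eventually_gt_at_top)
    ultimately show ?thesis
    proof eventually_elim
      case (elim n)
      have "1 \<le> real n ^ d" using elim by (intro one_le_power) simp
      then have "ln (d * real n ^ d + d) \<le> ln (d * (2 * real n ^ d))"
        using d by (intro ln_mono add_nonneg_pos) (auto simp: algebra_simps)
      with elim show ?case by linarith
    qed
  qed
  then obtain n where n: "real n * c\<^sup>2 / 4 > 1 + ln (d * real n ^ d + d)"
    by (meson eventually_sequentially order_refl)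
  have "\<not> (\<forall>I\<subseteq>{..<n}. \<exists>y\<in>Y. \<forall>i<n. if i \<in> I then f i y > b else f i y < a)"
    if f: "\<forall>i<n. \<exists>N r g. (\<forall>j<N. 0 \<le> r j \<and> g j \<in> A) \<and> (\<Sum>j<N. r j) = 1 \<and>
        (\<forall>y\<in>Y. f i y = (\<Sum>j<(N::nat). r j * of_bool (E (g j) y)))" for f
  proof
    assume "\<forall>I\<subseteq>{..<n}. \<exists>y\<in>Y. \<forall>i<n. if i \<in> I then f i y > b else f i y < a"
    then have "\<forall>I\<in>Pow {..<n}. \<exists>y. y \<in> Y \<and> (\<forall>i<n. if i \<in> I then f i y > b else f i y < a)"
      by (simp add: Bex_def)
    from bchoice[OF this] obtain y
      where "\<forall>I\<in>Pow {..<n}. y I \<in> Y \<and> (\<forall>i<n. if i \<in> I then f i (y I) > b else f i (y I) < a)" ..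
    then have y: "\<And>I. I \<subseteq> {..<n} \<Longrightarrow> y I \<in> Y"
      and fy: "\<And>I i. I \<subseteq> {..<n} \<Longrightarrow> i < n \<Longrightarrow> if i \<in> I then f i (y I) > b else f i (y I) < a"
      by simp_all
    have "\<exists>g\<in>A. (\<Sum>I\<in>Pow {..<n}. rademacher I i * f i (y I)) \<le> (\<Sum>I\<in>Pow {..<n}. rademacher I i * of_bool (E g (y I)))"
      if i: "i < n" for i
    proof -
      obtain N r g where r: "\<And>j. j < (N::nat) \<Longrightarrow> 0 \<le> r j" and g: "\<And>j. j < N \<Longrightarrow> g j \<in> A" and r1: "(\<Sum>j<N. r j) = 1"
        and fi: "\<And>y. y \<in> Y \<Longrightarrow> f i y = (\<Sum>j<N. r j * of_bool (E (g j) y))"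
        using f[rule_format, OF i] by blast
      define s where "s = (\<Sum>I\<in>Pow {..<n}. rademacher I i * f i (y I))"
      have "s = (\<Sum>I\<in>Pow {..<n}. \<Sum>j<N. r j * (rademacher I i * of_bool (E (g j) (y I))))"
        unfolding s_def
      proof (rule sum.cong)
        fix I assume "I \<in> Pow {..<n}"
        then have "f i (y I) = (\<Sum>j<N. r j * of_bool (E (g j) (y I)))" using fi y by blast
        then show "rademacher I i * f i (y I) = (\<Sum>j<N. r j * (rademacher I i * of_bool (E (g j) (y I))))"
          by (simp only: sum_distrib_left mult.left_commute)
      qed simp
      also have "\<dots> = (\<Sum>j<N. r j * (\<Sum>I\<in>Pow {..<n}. rademacher I i * of_bool (E (g j) (y I))))"
        by (subst sum.swap) (simp only: sum_distrib_left)
      finally have s: "s = \<dots>" .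
      have "\<exists>j<N. s \<le> (\<Sum>I\<in>Pow {..<n}. rademacher I i * of_bool (E (g j) (y I)))"
      proof (rule ccontr)
        assume "\<not> ?thesis"
        then have lt: "(\<Sum>I\<in>Pow {..<n}. rademacher I i * of_bool (E (g j) (y I))) < s" if "j < N" for j
          using that by (meson not_less)
        obtain j where j: "j < N" "r j \<noteq> 0" using r1 by (metis (no_types, lifting) lessThan_iff sum.neutral zero_neq_one)
        have "(\<Sum>j<N. r j * (\<Sum>I\<in>Pow {..<n}. rademacher I i * of_bool (E (g j) (y I)))) < (\<Sum>j<N. r j * s)"
          using r lt j r[OF j(1)] by (intro sum_strict_mono_ex1) (auto intro!: mult_left_mono simp: less_imp_le, force)
        also have "\<dots> = s" using r1 by (simp add: sum_distrib_right[symmetric])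
        finally show False using s by simp
      qed
      then show ?thesis using g by (auto simp: s_def)
    qed
    then have "\<forall>i\<in>{..<n}. \<exists>g. g \<in> A \<and> (\<Sum>I\<in>Pow {..<n}. rademacher I i * f i (y I)) \<le> (\<Sum>I\<in>Pow {..<n}. rademacher I i * of_bool (E g (y I)))"
      by (simp add: Bex_def)
    from bchoice[OF this] obtain g where "\<forall>i\<in>{..<n}. g i \<in> A \<and>
      (\<Sum>I\<in>Pow {..<n}. rademacher I i * f i (y I)) \<le> (\<Sum>I\<in>Pow {..<n}. rademacher I i * of_bool (E (g i) (y I)))" ..
    then have gA: "\<And>i. i < n \<Longrightarrow> g i \<in> A"
      and g: "\<And>i. i < n \<Longrightarrow> (\<Sum>I\<in>Pow {..<n}. rademacher I i * f i (y I)) \<le> (\<Sum>I\<in>Pow {..<n}. rademacher I i * of_bool (E (g i) (y I)))"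
      by simp_all
    define P where "P I = {i. i < n \<and> E (g i) (y I)}" for I
    define F where "F = P ` Pow {..<n}"
    define v :: "nat set \<Rightarrow> nat \<Rightarrow> real" where "v J i = of_bool (i \<in> J)" for J i
    have "card F \<le> d * n ^ d + d"
    proof (rule card_no_shattered_le)
      show "F \<subseteq> Pow {..<n}" by (auto simp: F_def P_def)
      fix B assume B: "B \<subseteq> {..<n}" "card B = d"
      show "\<not> shattered F B"
      proof
        assume sh: "shattered F B"
        have "finite B" using B finite_subset by blast
        then obtain h where h: "bij_betw h {..<d} B" using B by (metis bij_betw_from_nat_into_finite)
        then have hB: "h i \<in> B" if "i < d" for i using that by (auto simp: bij_betw_def)
        have "\<forall>i<d. g (h i) \<in> A" using hB B gA by blast
        moreover have "\<exists>z\<in>Y. \<forall>i<d. E (g (h i)) z \<longleftrightarrow> i \<in> I" if I: "I \<subseteq> {..<d}" for I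
        proof -
          have "h ` I \<subseteq> B" using hB I by auto
          then obtain J where J: "J \<subseteq> {..<n}" "P J \<inter> B = h ` I" 
            using sh[unfolded shattered_def, rule_format, of "h ` I"] by (auto simp: F_def)
          have "E (g (h i)) (y J) \<longleftrightarrow> i \<in> I" if i: "i < d" for i
          proof -
            have "h i < n" using hB[OF i] B by auto
            then have "E (g (h i)) (y J) \<longleftrightarrow> h i \<in> P J \<inter> B" using hB[OF i] by (simp add: P_def)
            also have "\<dots> \<longleftrightarrow> i \<in> I" unfolding J(2) using h i I by (auto simp: bij_betw_def inj_on_def)
            finally show ?thesis .
          qed
          with y[OF J(1)] show ?thesis by blast
        qed
        ultimately have "\<exists>g. (\<forall>i<d. g i \<in> A) \<and> (\<forall>I\<subseteq>{..<d}. \<exists>y\<in>Y. \<forall>i<d. E (g i) y \<longleftrightarrow> i \<in> I)"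
          by (intro exI[of _ "\<lambda>i. g (h i)"] conjI allI impI) simp_all
        with no show False by contradiction
      qed
    qed
    have "2 ^ n * (n * c) = (\<Sum>I\<in>Pow {..<n}. \<Sum>i<n. c)" by (simp add: card_Pow)
    also have "\<dots> \<le> (\<Sum>I\<in>Pow {..<n}. \<Sum>i<n. rademacher I i * (f i (y I) - (a + b) / 2))"
    proof (intro sum_mono)
      fix I i assume "I \<in> Pow {..<n}" "i \<in> {..<n}"
      then show "c \<le> rademacher I i * (f i (y I) - (a + b) / 2)"
        using fy[of I i] by (auto simp: rademacher_def c_def field_simps split: if_splits)
    qed
    also have "\<dots> = (\<Sum>i<n. (\<Sum>I\<in>Pow {..<n}. rademacher I i * f i (y I)) - (\<Sum>I\<in>Pow {..<n}. rademacher I i) * ((a + b) / 2))"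
      by (subst sum.swap) (simp only: right_diff_distrib sum_subtractf sum_distrib_right)
    also have "\<dots> = (\<Sum>i<n. (\<Sum>I\<in>Pow {..<n}. rademacher I i * f i (y I)))"
      by (intro sum.cong) (auto simp: sum_rademacher)
    also have "\<dots> \<le> (\<Sum>i<n. (\<Sum>I\<in>Pow {..<n}. rademacher I i * of_bool (E (g i) (y I))))"
      by (rule sum_mono) (rule g, simp)
    also have "\<dots> = (\<Sum>I\<in>Pow {..<n}. \<Sum>i<n. rademacher I i * v (P I) i)"
      by (subst sum.swap) (auto simp: v_def P_def intro!: sum.cong)
    finally have "n * c\<^sup>2 / 4 \<le> 1 + ln (card (v ` F))"
      using c by (intro rademacher_le[where v = "\<lambda>I. v (P I)"]) (auto simp: F_def v_def)
    also have "ln (card (v ` F)) \<le> ln (d * real n ^ d + d)"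
    proof -
      have "card (v ` F) > 0" by (auto simp: F_def card_gt_0_iff)
      moreover have "card (v ` F) \<le> card F" by (intro card_image_le) (simp add: F_def)
      moreover have "real (card F) \<le> d * real n ^ d + d" using \<open>card F \<le> _\<close> by (metis of_nat_add of_nat_le_iff of_nat_mult of_nat_power)
      ultimately show ?thesis by (intro ln_mono) linarith+
    qed
    finally show False using n by simp
  qed
  then show ?thesis by blast
qed

section \<open>Pointwise limits along an ultrafilter and alternation\<close>

definition ultra :: "'a filter \<Rightarrow> bool" where
  "ultra U \<longleftrightarrow> U \<noteq> bot \<and> (\<forall>P. eventually P U \<or> eventually (\<lambda>x. \<not> P x) U)"

text \<open>
  Zorn's lemma: an infimum of a chain of proper filters is proper, and a minimal proper filter decides
  every predicate.
\<close>
lemma ultra_exists: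
  assumes "F \<noteq> bot"
  shows "\<exists>U. ultra U \<and> U \<le> F"
proof -
  define A where "A = {U. U \<noteq> bot \<and> U \<le> F}"
  have po: "partial_order_on A (relation_of (\<lambda>a b. b \<le> a) A)"
    by (rule partial_order_on_relation_ofI) auto
  have "\<exists>u\<in>A. \<forall>a\<in>A. a \<le> u \<longrightarrow> a = u"
  proof (rule predicate_Zorn[OF po])
    fix C assume C: "C \<in> Chains (relation_of (\<lambda>a b. b \<le> a) A)"
    then have CA: "C \<subseteq> A" and chain: "\<And>x y. x \<in> C \<Longrightarrow> y \<in> C \<Longrightarrow> x \<le> y \<or> y \<le> x"
      by (auto simp: Chains_def relation_of_def)
    show "\<exists>u\<in>A. \<forall>a\<in>C. u \<le> a"
    proof (cases "C = {}")
      case True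
      with assms show ?thesis by (auto simp: A_def)
    next
      case False
      have "eventually P (Inf C) \<longleftrightarrow> (\<exists>b\<in>C. eventually P b)" for P
        using False chain by (intro eventually_Inf_base) (metis inf.absorb1 inf.absorb2 order_refl)+
      then have "Inf C \<noteq> bot" using CA by (auto simp: trivial_limit_def A_def)
      moreover have "Inf C \<le> F" using False CA by (auto simp: A_def intro: Inf_lower2)
      ultimately have "Inf C \<in> A" by (simp add: A_def)
      then show ?thesis by (meson Inf_lower)
    qed
  qed
  then obtain U where U: "U \<noteq> bot" "U \<le> F" and max: "\<And>V. V \<noteq> bot \<Longrightarrow> V \<le> F \<Longrightarrow> V \<le> U \<Longrightarrow> V = U"
    by (auto simp: A_def)
  have "eventually P U \<or> eventually (\<lambda>x. \<not> P x) U" for P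
  proof (cases "inf U (principal {x. P x}) = bot")
    case True
    then show ?thesis by (simp add: trivial_limit_def eventually_inf_principal)
  next
    case False
    then have "inf U (principal {x. P x}) = U" by (intro max) (auto intro: le_infI1 U)
    moreover have "eventually P (inf U (principal {x. P x}))" by (simp add: eventually_inf_principal)
    ultimately show ?thesis by simp
  qed
  with U show ?thesis unfolding ultra_def by blast
qed

abbreviation borel_of_top :: "'a topology \<Rightarrow> 'a measure" where
  "borel_of_top X \<equiv> sigma (topspace X) {U. openin X U}"

lemma openin_borel: "openin X U \<Longrightarrow> U \<in> sets (borel_of_top X)"
  by (auto intro: sigma_sets.Basic dest: openin_subset)

lemma space_borel_of_top: "space (borel_of_top X) = topspace X"
  by (auto dest: openin_subset simp: space_measure_of_conv)

lemma closedin_borel: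
  assumes "closedin X C"
  shows "C \<in> sets (borel_of_top X)"
proof -
  have "space (borel_of_top X) - (topspace X - C) \<in> sets (borel_of_top X)"
    using assms by (intro sets.compl_sets openin_borel) (auto simp: closedin_def)
  also have "space (borel_of_top X) - (topspace X - C) = C"
    using closedin_subset[OF assms] by (auto simp: space_borel_of_top)
  finally show ?thesis .
qed

lemma regular_Borel_probD:
  assumes "regular_Borel_prob X P"
  shows "prob_space P" "sets P = sets (borel_of_top X)" "space P = topspace X"
  using assms sets_eq_imp_space_eq[of P "borel_of_top X"]
  by (auto simp: regular_Borel_prob_def space_borel_of_top)

lemma inner_approx:
  assumes P: "regular_Borel_prob X P" and X: "Hausdorff_space X" and B: "B \<in> sets P" and e: "0 < e"
  obtains K where "compactin X K" "K \<subseteq> B" "measure P (B - K) < e"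
proof -
  interpret prob_space P using P by (rule regular_Borel_probD)
  have eq: "emeasure P B = (SUP K\<in>{K. compactin X K \<and> K \<subseteq> B}. emeasure P K)"
    using P B by (simp add: regular_Borel_prob_def)
  have "{} \<in> {K. compactin X K \<and> K \<subseteq> B}" by simp
  then have ne: "{K. compactin X K \<and> K \<subseteq> B} \<noteq> {}" by blast
  have fin: "emeasure P B \<noteq> \<infinity>" by simp
  have "\<exists>K\<in>{K. compactin X K \<and> K \<subseteq> B}. emeasure P B < emeasure P K + ennreal e"
    using SUP_approx_ennreal[OF e ne eq fin] .
  then obtain K where K0: "K \<in> {K. compactin X K \<and> K \<subseteq> B}" "emeasure P B < emeasure P K + ennreal e" ..
  then have K: "compactin X K" "K \<subseteq> B" "emeasure P B < emeasure P K + ennreal e" by simp_all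
  have KP: "K \<in> sets P"
    using closedin_borel[OF compactin_imp_closedin[OF X K(1)]] regular_Borel_probD(2)[OF P] by simp
  have "ennreal (measure P B) < ennreal (measure P K + e)"
    using K(3) e by (simp add: emeasure_eq_measure)
  then have "measure P B < measure P K + e" by (simp add: ennreal_less_iff)
  moreover have "measure P (B - K) = measure P B - measure P K"
    by (rule finite_measure_Diff[OF B KP K(2)])
  ultimately have "measure P (B - K) < e" by linarith
  then show ?thesis by (rule that[OF K(1,2)])
qed

text \<open>
  A family of functions with the ultrafilter \<open>U\<close> plays the role of a global type, and a member that is generic
  for \<open>U\<close> that of a realization.  The last assumption bounds the size of patterns of values above \<open>b\<close> and below \<open>a\<close>.
\<close>
locale alternation =
  fixes X :: "'x topology" and K :: "'k set" and U :: "'k filter" and f :: "'k \<Rightarrow> 'x \<Rightarrow> real" and a b :: real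
  assumes ultra: "ultra U" and UK: "\<forall>\<^sub>F k in U. k \<in> K"
    and open_gt: "\<And>k. k \<in> K \<Longrightarrow> openin X {x\<in>topspace X. b < f k x}"
    and open_lt: "\<And>k. k \<in> K \<Longrightarrow> openin X {x\<in>topspace X. f k x < a}"
    and not_shattered: "\<exists>n. \<forall>e :: nat \<Rightarrow> 'k. (\<forall>i<n. e i \<in> K) \<longrightarrow>
      \<not> (\<forall>I\<subseteq>{..<n}. \<exists>x\<in>topspace X. \<forall>i<n. if i \<in> I then f (e i) x > b else f (e i) x < a)"
begin

definition side :: "bool \<Rightarrow> 'k \<Rightarrow> 'x set" where
  "side h k = {x\<in>topspace X. if h then b < f k x else f k x < a}"

text \<open>
  \<open>alternates j h V\<close> says that a generic sequence of \<open>j\<close> members of the family takes, at some common point of \<open>V\<close>,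
  values alternately above \<open>b\<close> and below \<open>a\<close>.  The outermost quantifier belongs to the last member of the
  sequence, whose value lies on the side \<open>h\<close>: this is the order in which a Morley sequence is continued.
\<close>
fun alternates :: "nat \<Rightarrow> bool \<Rightarrow> 'x set \<Rightarrow> bool" where
  "alternates 0 h V \<longleftrightarrow> V \<noteq> {}"
| "alternates (Suc j) h V \<longleftrightarrow> (\<forall>\<^sub>F k in U. alternates j (\<not> h) (V \<inter> side h k))"

text \<open>
  All patterns of values above \<open>b\<close> and below \<open>a\<close> for the listed members are attained in \<open>V\<close>.
\<close>
fun splits :: "'k list \<Rightarrow> 'x set \<Rightarrow> bool" where
  "splits [] V \<longleftrightarrow> V \<noteq> {}"
| "splits (k # ks) V \<longleftrightarrow> splits ks (V \<inter> side True k) \<and> splits ks (V \<inter> side False k)"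

lemma alternates_mono: "alternates j h V \<Longrightarrow> V \<subseteq> W \<Longrightarrow> alternates j h W"
proof (induction j arbitrary: h V W)
  case (Suc j)
  from Suc.prems have "\<forall>\<^sub>F k in U. alternates j (\<not> h) (V \<inter> side h k)" by simp
  then have "\<forall>\<^sub>F k in U. alternates j (\<not> h) (W \<inter> side h k)"
    by (rule eventually_mono) (rule Suc.IH, assumption, use Suc.prems(2) in blast)
  then show ?case by simp
qed auto

lemma splits_mono: "splits ks V \<Longrightarrow> V \<subseteq> W \<Longrightarrow> splits ks W"
proof (induction ks arbitrary: V W)
  case (Cons k ks)
  then show ?case
    using Cons.IH[of "V \<inter> side True k" "W \<inter> side True k"] Cons.IH[of "V \<inter> side False k" "W \<inter> side False k"]
    by auto
qed auto

lemma U_ne: "U \<noteq> bot"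
  using ultra by (simp add: ultra_def)

lemma alternates_drop_inner: "alternates (Suc j) h V \<Longrightarrow> alternates j h V"
proof (induction j arbitrary: h V)
  case 0
  then show ?case using eventually_happens'[OF U_ne, of "\<lambda>k. V \<inter> side h k \<noteq> {}"] by auto
next
  case (Suc j)
  from alternates.simps(2)[THEN iffD1, OF Suc.prems] have "\<forall>\<^sub>F k in U. alternates j (\<not> h) (V \<inter> side h k)"
    by (rule eventually_mono) (rule Suc.IH)
  then show ?case by simp
qed

lemma alternates_drop_outer: "alternates (Suc j) h V \<Longrightarrow> alternates j (\<not> h) V"
  using eventually_happens'[OF U_ne, of "\<lambda>k. alternates j (\<not> h) (V \<inter> side h k)"] by (auto intro: alternates_mono)

lemma splits_pattern: "splits ks V \<Longrightarrow> \<exists>x\<in>V. \<forall>i<length ks. x \<in> side (i \<in> I) (ks ! i)"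
proof (induction ks arbitrary: V I)
  case Nil
  then show ?case by auto
next
  case (Cons k ks)
  from Cons.prems have "splits ks (V \<inter> side (0 \<in> I) k)" by (cases "0 \<in> I") auto
  from Cons.IH[OF this, of "{i. Suc i \<in> I}"] obtain x
    where x: "x \<in> V" "x \<in> side (0 \<in> I) k" "\<And>i. i < length ks \<Longrightarrow> x \<in> side (Suc i \<in> I) (ks ! i)" by auto
  have "x \<in> side (i \<in> I) ((k # ks) ! i)" if "i < length (k # ks)" for i
    using that x by (cases i) auto
  with x show ?case by blast
qed

text \<open>
  Two alternations produce one member \<open>e\<close> on both sides: \<open>e\<close> is put into the first place followed by a
  low value, and into the second place preceded by a high one.  Both requirements hold for generic \<open>e\<close>, even
  simultaneously for finitely many sets \<open>V\<close>, so the construction can be repeated on the sets just obtained.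
\<close>
lemma alternates_imp_splits:
  assumes "finite \<V>" "\<forall>V\<in>\<V>. alternates (2 * n) True V"
  shows "\<exists>es. length es = n \<and> set es \<subseteq> K \<and> (\<forall>V\<in>\<V>. splits es V)"
  using assms
proof (induction n arbitrary: \<V>)
  case 0
  then show ?case by auto
next
  case (Suc n)
  let ?m = "2 * n"
  have 1: "\<forall>\<^sub>F k in U. \<forall>V\<in>\<V>. alternates (Suc ?m) False (V \<inter> side True k)"
    using Suc.prems by (auto simp: eventually_ball_finite_distrib)
  then obtain h1 where h1: "\<forall>V\<in>\<V>. alternates (Suc ?m) False (V \<inter> side True h1)"
    using U_ne eventually_happens' by blast
  then have "\<forall>\<^sub>F k in U. \<forall>V\<in>\<V>. alternates ?m True (V \<inter> side True h1 \<inter> side False k)"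
    using Suc.prems by (auto simp: eventually_ball_finite_distrib)
  with 1 UK have "\<forall>\<^sub>F k in U. k \<in> K \<and> (\<forall>V\<in>\<V>. alternates (Suc ?m) False (V \<inter> side True k)) \<and>
      (\<forall>V\<in>\<V>. alternates ?m True (V \<inter> side True h1 \<inter> side False k))" by eventually_elim auto
  then obtain e where e: "e \<in> K" "\<forall>V\<in>\<V>. alternates (Suc ?m) False (V \<inter> side True e)"
      "\<forall>V\<in>\<V>. alternates ?m True (V \<inter> side True h1 \<inter> side False e)"
    using U_ne eventually_happens' by blast
  have "\<forall>\<^sub>F k in U. \<forall>V\<in>\<V>. alternates ?m True (V \<inter> side True e \<inter> side False k)"
    using Suc.prems e by (auto simp: eventually_ball_finite_distrib)
  then obtain h2 where h2: "\<forall>V\<in>\<V>. alternates ?m True (V \<inter> side True e \<inter> side False h2)"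
    using U_ne eventually_happens' by blast
  let ?\<W> = "(\<lambda>V. V \<inter> side True h1 \<inter> side False e) ` \<V> \<union> (\<lambda>V. V \<inter> side True e \<inter> side False h2) ` \<V>"
  have "\<forall>V\<in>?\<W>. alternates ?m True V" using e h2 by blast
  from Suc.IH[OF _ this] Suc.prems(1) obtain es
    where es: "length es = n" "set es \<subseteq> K" "\<forall>V\<in>?\<W>. splits es V" by blast
  have "splits (e # es) V" if V: "V \<in> \<V>" for V
  proof -
    have "splits es (V \<inter> side True e \<inter> side False h2)" "splits es (V \<inter> side True h1 \<inter> side False e)"
      using es(3) V by auto
    then have "splits es (V \<inter> side True e) \<and> splits es (V \<inter> side False e)"
      by (intro conjI; elim splits_mono; blast)
    then show ?thesis by simp
  qed
  with es e show ?case by (intro exI[of _ "e # es"]) auto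
qed

lemma alternates_bounded: "\<exists>N. \<forall>h. \<not> alternates N h (topspace X)"
proof -
  obtain n where n: "\<forall>e :: nat \<Rightarrow> 'k. (\<forall>i<n. e i \<in> K) \<longrightarrow>
      \<not> (\<forall>I\<subseteq>{..<n}. \<exists>x\<in>topspace X. \<forall>i<n. if i \<in> I then f (e i) x > b else f (e i) x < a)"
    using not_shattered ..
  have T: "\<not> alternates (2 * n) True (topspace X)"
  proof
    assume "alternates (2 * n) True (topspace X)"
    then obtain es where es: "length es = n" "set es \<subseteq> K" "splits es (topspace X)"
      using alternates_imp_splits[of "{topspace X}" n] by auto
    have "\<exists>x\<in>topspace X. \<forall>i<n. if i \<in> I then f (es ! i) x > b else f (es ! i) x < a" for I
      using splits_pattern[OF es(3), of I] es(1) by (force simp: side_def)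
    moreover have "\<forall>i<n. es ! i \<in> K" using es by auto
    ultimately show False using n by blast
  qed
  have "\<not> alternates (Suc (2 * n)) h (topspace X)" for h
  proof
    assume A: "alternates (Suc (2 * n)) h (topspace X)"
    have "alternates (2 * n) True (topspace X)"
    proof (cases h)
      case True
      then show ?thesis using alternates_drop_inner[OF A] by simp
    next
      case False
      then show ?thesis using alternates_drop_outer[OF A] by simp
    qed
    with T show False by contradiction
  qed
  then show ?thesis by blast
qed

text \<open>
  The points at which a generic sequence alternates \<open>j\<close> times in every neighbourhood.
\<close>
definition alternating :: "nat \<Rightarrow> bool \<Rightarrow> 'x set" where
  "alternating j h = {x\<in>topspace X. \<forall>V. openin X V \<and> x \<in> V \<longrightarrow> alternates j h V}"

lemma closedin_alternating: "closedin X (alternating j h)"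
proof -
  have "topspace X - alternating j h = \<Union> {V. openin X V \<and> \<not> alternates j h V}"
    by (auto simp: alternating_def dest: openin_subset)
  then have "openin X (topspace X - alternating j h)" by auto
  then show ?thesis by (auto simp: closedin_def alternating_def)
qed

lemma alternating_0: "alternating 0 h = topspace X"
  by (auto simp: alternating_def)

text \<open>
  If generic members of the family have values on the side \<open>h\<close> at \<open>x\<close> itself, then a pattern near \<open>x\<close> that ends on the
  other side can be prolonged: the condition on the new member cuts out a smaller neighbourhood of \<open>x\<close>.
\<close>
lemma alternating_extend:
  assumes "x \<in> alternating j (\<not> h)" "\<forall>\<^sub>F k in U. x \<in> side h k"
  shows "x \<in> alternating (Suc j) h"
proof -
  have "alternates (Suc j) h V" if V: "openin X V" "x \<in> V" for V
  proof -
    have "\<forall>\<^sub>F k in U. alternates j (\<not> h) (V \<inter> side h k)"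
      using assms(2) UK
    proof eventually_elim
      case (elim k)
      have "openin X (side h k)" using open_gt open_lt elim by (cases h) (auto simp: side_def)
      then have "openin X (V \<inter> side h k)" using V by auto
      with assms(1) elim V show ?case by (auto simp: alternating_def)
    qed
    then show ?thesis by simp
  qed
  with assms show ?thesis by (auto simp: alternating_def)
qed

text \<open>
  The points where the maximal alternation has length \<open>j\<close> and may end with a high value.
\<close>
definition stratum :: "nat \<Rightarrow> 'x set" where
  "stratum j = alternating j True - (alternating (Suc j) True \<union> alternating (Suc j) False)"

lemma stratum_borel: "stratum j \<in> sets (borel_of_top X)"
  unfolding stratum_def by (intro sets.Diff sets.Un closedin_borel closedin_alternating)

lemma stratum_ge:
  assumes "x \<in> stratum j" "((\<lambda>k. f k x) \<longlongrightarrow> F) U"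
  shows "a \<le> F"
proof (rule ccontr)
  assume "\<not> a \<le> F"
  then have "\<forall>\<^sub>F k in U. x \<in> side False k"
    using order_tendstoD(2)[OF assms(2), of a] assms(1) by (auto simp: side_def stratum_def alternating_def elim!: eventually_mono)
  with assms(1) alternating_extend[of x j False] show False by (auto simp: stratum_def)
qed

lemma in_stratum:
  assumes x: "x \<in> topspace X" and lim: "((\<lambda>k. f k x) \<longlongrightarrow> F) U" and F: "b < F"
    and N: "\<And>h. \<not> alternates N h (topspace X)"
  shows "\<exists>j<N. x \<in> stratum j"
proof (rule ccontr)
  assume no: "\<not> ?thesis"
  have ev: "\<forall>\<^sub>F k in U. x \<in> side True k"
    using order_tendstoD(1)[OF lim F] x by (auto simp: side_def elim!: eventually_mono)
  have "x \<in> alternating j True \<or> x \<in> alternating j False" if "j \<le> N" for j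
    using that
  proof (induction j)
    case 0
    then show ?case using x by (simp add: alternating_0)
  next
    case (Suc j)
    then have "x \<notin> stratum j" using no by auto
    with Suc alternating_extend[of x j True] ev show ?case by (auto simp: stratum_def)
  qed
  then show False using N[of True] N[of False] openin_topspace[of X] unfolding alternating_def by blast
qed

text \<open>
  Around a point of the stratum there is an open \<open>V\<close> on which the alternation cannot be prolonged by a low
  value.  For generic \<open>k\<close> this means that the open set of points of \<open>V\<close> with \<open>f k < a\<close> misses all points of
  \<open>alternating j True\<close>.  Compactness makes the choice of \<open>k\<close> uniform.
\<close>
lemma stratum_eventually:
  assumes C: "compactin X C" "C \<subseteq> stratum j"
  shows "\<forall>\<^sub>F k in U. \<forall>x\<in>C. a \<le> f k x"
proof -
  have "\<exists>V. openin X V \<and> x \<in> V \<and> (\<forall>\<^sub>F k in U. \<forall>y\<in>V \<inter> alternating j True. a \<le> f k y)" if x: "x \<in> C" for x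
  proof -
    have "x \<in> alternating j True" "x \<notin> alternating (Suc j) False" using x C unfolding stratum_def by auto
    then obtain V where V: "openin X V" "x \<in> V" "\<not> alternates (Suc j) False V"
      unfolding alternating_def by blast
    then have "\<forall>\<^sub>F k in U. \<not> alternates j True (V \<inter> side False k)"
      using ultra by (auto simp: ultra_def)
    then have "\<forall>\<^sub>F k in U. \<forall>y\<in>V \<inter> alternating j True. a \<le> f k y"
      using UK
    proof eventually_elim
      case (elim k)
      have "openin X (V \<inter> side False k)" using V open_lt elim by (auto simp: side_def)
      with elim have "y \<notin> V \<inter> side False k" if "y \<in> alternating j True" for y
        using that unfolding alternating_def by blast
      then show ?case by (force simp: side_def alternating_def)
    qed
    with V show ?thesis by blast
  qed
  then have "\<forall>x\<in>C. \<exists>V. openin X V \<and> x \<in> V \<and> (\<forall>\<^sub>F k in U. \<forall>y\<in>V \<inter> alternating j True. a \<le> f k y)" by blast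
  from bchoice[OF this] obtain W where W: "\<And>x. x \<in> C \<Longrightarrow> openin X (W x)" "\<And>x. x \<in> C \<Longrightarrow> x \<in> W x"
    "\<And>x. x \<in> C \<Longrightarrow> \<forall>\<^sub>F k in U. \<forall>y\<in>W x \<inter> alternating j True. a \<le> f k y" by blast
  have "C \<subseteq> \<Union> (W ` C)" using W(2) by blast
  then obtain \<F> where \<F>: "finite \<F>" "\<F> \<subseteq> W ` C" "C \<subseteq> \<Union> \<F>"
    using C(1)[unfolded compactin_def, THEN conjunct2, rule_format, of "W ` C"] W(1) by blast
  then obtain D where D: "finite D" "D \<subseteq> C" "\<F> = W ` D" by (meson finite_subset_image)
  then have "\<forall>\<^sub>F k in U. \<forall>x\<in>D. \<forall>y\<in>W x \<inter> alternating j True. a \<le> f k y"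
    using W by (auto simp: eventually_ball_finite_distrib)
  then show ?thesis
  proof eventually_elim
    case (elim k)
    show ?case
    proof
      fix y assume "y \<in> C"
      with \<F> D C elim show "a \<le> f k y" unfolding stratum_def by blast
    qed
  qed
qed

text \<open>
  The set where the limit exceeds \<open>b\<close> is covered by finitely many strata, and each of these is compact up to a
  set of small measure.
\<close>
lemma eventually_small:
  assumes P: "regular_Borel_prob X P" and X: "Hausdorff_space X"
    and lim: "\<And>x. x \<in> topspace X \<Longrightarrow> ((\<lambda>k. f k x) \<longlongrightarrow> F x) U" and e: "0 < e"
  shows "\<forall>\<^sub>F k in U. measure P {x\<in>topspace X. b < F x \<and> f k x < a} < e"
proof -
  interpret prob_space P using P by (rule regular_Borel_probD)
  obtain N where N: "\<And>h. \<not> alternates N h (topspace X)" using alternates_bounded by auto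
  have sP: "stratum j \<in> sets P" for j using stratum_borel P by (simp add: regular_Borel_probD(2))
  have e': "0 < e / (N + 1)" using e by simp
  have "\<exists>C. compactin X C \<and> C \<subseteq> stratum j \<and> measure P (stratum j - C) < e / (N + 1)" for j
    by (rule inner_approx[OF P X sP[of j] e']) blast
  then have "\<forall>j. \<exists>C. compactin X C \<and> C \<subseteq> stratum j \<and> measure P (stratum j - C) < e / (N + 1)" ..
  from choice[OF this] obtain C where C: "\<And>j. compactin X (C j)" "\<And>j. C j \<subseteq> stratum j"
    "\<And>j. measure P (stratum j - C j) < e / (N + 1)" by blast
  have CP: "C j \<in> sets P" for j
    using closedin_borel[OF compactin_imp_closedin[OF X C(1)]] regular_Borel_probD(2)[OF P] by simp
  have "\<forall>\<^sub>F k in U. \<forall>j\<in>{..<N}. \<forall>x\<in>C j. a \<le> f k x"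
    using stratum_eventually[OF C(1,2)] by (auto simp: eventually_ball_finite_distrib)
  then show ?thesis
  proof eventually_elim
    case (elim k)
    have "{x\<in>topspace X. b < F x \<and> f k x < a} \<subseteq> (\<Union>j<N. stratum j - C j)"
    proof
      fix x assume x: "x \<in> {x\<in>topspace X. b < F x \<and> f k x < a}"
      then obtain j where "j < N" "x \<in> stratum j" using in_stratum[OF _ lim _ N, of x] by auto
      with x elim show "x \<in> (\<Union>j<N. stratum j - C j)" by force
    qed
    then have "measure P {x\<in>topspace X. b < F x \<and> f k x < a} \<le> measure P (\<Union>j<N. stratum j - C j)"
      using sP CP by (intro finite_measure_mono) auto
    also have "\<dots> \<le> (\<Sum>j<N. measure P (stratum j - C j))"
      using sP CP by (intro finite_measure_subadditive_finite) auto
    also have "\<dots> \<le> (\<Sum>j<N. e / (N + 1))" using C(3) by (intro sum_mono less_imp_le)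
    also have "\<dots> = e * (N / (N + 1))" by simp
    also have "\<dots> < e * 1" using e by (intro mult_strict_left_mono) auto
    finally show ?case by simp
  qed
qed

end

text \<open>
  The index set \<open>K\<close> stands for \<open>conv(G)\<close>, and \<open>f k\<close> for the fibre function of the measure \<open>k\<close>.
\<close>
locale nip_family =
  fixes X :: "'x topology" and K :: "'k set" and f :: "'k \<Rightarrow> 'x \<Rightarrow> real"
  assumes cont: "\<And>k. k \<in> K \<Longrightarrow> continuous_map X euclideanreal (f k)"
    and range: "\<And>k x. k \<in> K \<Longrightarrow> x \<in> topspace X \<Longrightarrow> 0 \<le> f k x \<and> f k x \<le> 1"
    and nip: "\<And>a b :: real. a < b \<Longrightarrow> b \<le> a + 1 \<Longrightarrow> \<exists>n. \<forall>e :: nat \<Rightarrow> 'k. (\<forall>i<n. e i \<in> K) \<longrightarrow>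
      \<not> (\<forall>I\<subseteq>{..<n}. \<exists>x\<in>topspace X. \<forall>i<n. if i \<in> I then f (e i) x > b else f (e i) x < a)"
begin

lemma open_gt: "k \<in> K \<Longrightarrow> openin X {x\<in>topspace X. b < f k x}"
  using openin_continuous_map_preimage[OF cont, of k "{b<..}"] by simp

lemma open_lt: "k \<in> K \<Longrightarrow> openin X {x\<in>topspace X. f k x < a}"
  using openin_continuous_map_preimage[OF cont, of k "{..<a}"] by simp

lemma alternation:
  assumes "ultra U" "\<forall>\<^sub>F k in U. k \<in> K" "a < b" "b \<le> a + 1"
  shows "alternation X K U f a b"
  using assms open_gt open_lt nip by unfold_locales

lemma flip: "nip_family X K (\<lambda>k x. 1 - f k x)"
proof
  show "continuous_map X euclideanreal (\<lambda>x. 1 - f k x)" if "k \<in> K" for k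
    by (intro continuous_intros cont that)
  show "0 \<le> 1 - f k x \<and> 1 - f k x \<le> 1" if "k \<in> K" "x \<in> topspace X" for k x
    using range[OF that] by auto
  fix a b :: real
  assume ab: "a < b" "b \<le> a + 1"
  then have "1 - b < 1 - a" "1 - a \<le> (1 - b) + 1" by auto
  from nip[OF this] obtain n where n: "\<forall>e :: nat \<Rightarrow> 'k. (\<forall>i<n. e i \<in> K) \<longrightarrow>
      \<not> (\<forall>I\<subseteq>{..<n}. \<exists>x\<in>topspace X. \<forall>i<n. if i \<in> I then f (e i) x > 1 - a else f (e i) x < 1 - b)" ..
  have "\<not> (\<forall>I\<subseteq>{..<n}. \<exists>x\<in>topspace X. \<forall>i<n. if i \<in> I then 1 - f (e i) x > b else 1 - f (e i) x < a)"
    if e: "\<forall>i<n. e i \<in> K" for e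
  proof
    assume *: "\<forall>I\<subseteq>{..<n}. \<exists>x\<in>topspace X. \<forall>i<n. if i \<in> I then 1 - f (e i) x > b else 1 - f (e i) x < a"
    have "\<exists>x\<in>topspace X. \<forall>i<n. if i \<in> I then f (e i) x > 1 - a else f (e i) x < 1 - b"
      if I: "I \<subseteq> {..<n}" for I
    proof -
      have "{..<n} - I \<subseteq> {..<n}" by blast
      from *[rule_format, OF this] obtain x where x: "x \<in> topspace X"
        "\<forall>i<n. if i \<in> {..<n} - I then 1 - f (e i) x > b else 1 - f (e i) x < a" by blast
      have "if i \<in> I then f (e i) x > 1 - a else f (e i) x < 1 - b" if "i < n" for i
        using x(2)[rule_format, OF that] that by (auto split: if_splits)
      with x(1) show ?thesis by blast
    qed
    with n e show False by blast
  qed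
  then show "\<exists>n. \<forall>e :: nat \<Rightarrow> 'k. (\<forall>i<n. e i \<in> K) \<longrightarrow>
      \<not> (\<forall>I\<subseteq>{..<n}. \<exists>x\<in>topspace X. \<forall>i<n. if i \<in> I then 1 - f (e i) x > b else 1 - f (e i) x < a)" by blast
qed

text \<open>
  For rationals \<open>a < b\<close> the union of the strata is a Borel set on which the limit is at least \<open>a\<close> and off which it is
  at most \<open>b\<close>.  A set \<open>F > c\<close> is the union of those with \<open>c < a\<close>.
\<close>
lemma limit_borel:
  assumes \<Phi>: "\<Phi> \<noteq> bot" "\<forall>\<^sub>F k in \<Phi>. k \<in> K"
    and lim: "\<And>x. x \<in> topspace X \<Longrightarrow> ((\<lambda>k. f k x) \<longlongrightarrow> F x) \<Phi>"
  shows "F \<in> borel_measurable (borel_of_top X)"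
proof -
  obtain U where U: "ultra U" "U \<le> \<Phi>" using ultra_exists[OF \<Phi>(1)] by blast
  have UK: "\<forall>\<^sub>F k in U. k \<in> K" using U(2) \<Phi>(2) by (rule filter_leD)
  have limU: "((\<lambda>k. f k x) \<longlongrightarrow> F x) U" if "x \<in> topspace X" for x
    using lim[OF that] U(2) by (meson tendsto_mono)
  have sep: "\<exists>B\<in>sets (borel_of_top X). (\<forall>x\<in>B. a \<le> F x) \<and> (\<forall>x\<in>topspace X. b < F x \<longrightarrow> x \<in> B)"
    if ab: "a < b" "b \<le> a + 1" for a b
  proof -
    interpret alternation X K U f a b by (rule alternation[OF U(1) UK ab])
    obtain N where N: "\<And>h. \<not> alternates N h (topspace X)" using alternates_bounded by blast
    show ?thesis
    proof (intro bexI conjI ballI impI)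
      show "(\<Union>j<N. stratum j) \<in> sets (borel_of_top X)"
        by (rule sets.finite_UN[OF finite_lessThan]) (rule stratum_borel)
      fix x
      show "a \<le> F x" if "x \<in> (\<Union>j<N. stratum j)"
      proof -
        from that obtain j where j: "x \<in> stratum j" by blast
        then have "x \<in> topspace X" unfolding stratum_def alternating_def by blast
        then show ?thesis using stratum_ge[OF j limU] by blast
      qed
      assume "x \<in> topspace X" "b < F x"
      then show "x \<in> (\<Union>j<N. stratum j)" using in_stratum[OF _ limU _ N] by blast
    qed
  qed
  have "{x \<in> topspace X. c < F x} \<in> sets (borel_of_top X)" for c
  proof -
    define Q where "Q = {(a, b). a \<in> \<rat> \<and> b \<in> \<rat> \<and> c < a \<and> a < b \<and> b \<le> a + 1}"
    have "Q \<subseteq> \<rat> \<times> \<rat>" by (auto simp: Q_def)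
    then have Q: "countable Q" by (rule countable_subset) (intro countable_SIGMA countable_rat)
    have "\<forall>q\<in>Q. \<exists>B. B \<in> sets (borel_of_top X) \<and> (\<forall>x\<in>B. fst q \<le> F x) \<and> (\<forall>x\<in>topspace X. snd q < F x \<longrightarrow> x \<in> B)"
    proof
      fix q assume "q \<in> Q"
      then have "fst q < snd q" "snd q \<le> fst q + 1" by (auto simp: Q_def)
      from sep[OF this] show "\<exists>B. B \<in> sets (borel_of_top X) \<and> (\<forall>x\<in>B. fst q \<le> F x) \<and> (\<forall>x\<in>topspace X. snd q < F x \<longrightarrow> x \<in> B)"
        by blast
    qed
    from bchoice[OF this] obtain B where B: "\<And>q. q \<in> Q \<Longrightarrow> B q \<in> sets (borel_of_top X)"
      "\<And>q x. q \<in> Q \<Longrightarrow> x \<in> B q \<Longrightarrow> fst q \<le> F x"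
      "\<And>q x. q \<in> Q \<Longrightarrow> x \<in> topspace X \<Longrightarrow> snd q < F x \<Longrightarrow> x \<in> B q" by blast
    have "{x \<in> topspace X. c < F x} = (\<Union>q\<in>Q. B q)"
    proof (intro equalityI subsetI)
      fix x assume x: "x \<in> {x \<in> topspace X. c < F x}"
      then obtain a where a: "a \<in> \<rat>" "c < a" "a < F x" using Rats_dense_in_real[of c "F x"] by blast
      obtain b where b: "b \<in> \<rat>" "a < b" "b < min (F x) (a + 1)"
        using Rats_dense_in_real[of a "min (F x) (a + 1)"] a by auto
      have "(a, b) \<in> Q" using a b by (auto simp: Q_def)
      then show "x \<in> (\<Union>q\<in>Q. B q)" using B(3)[of "(a, b)" x] x b by auto
    next
      fix x assume "x \<in> (\<Union>q\<in>Q. B q)"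
      then obtain q where q: "q \<in> Q" "x \<in> B q" by blast
      then have "x \<in> topspace X" using sets.sets_into_space[OF B(1)[OF q(1)]] by (auto simp: space_borel_of_top)
      moreover have "c < F x" using B(2)[OF q] q(1) by (auto simp: Q_def)
      ultimately show "x \<in> {x \<in> topspace X. c < F x}" by simp
    qed
    also have "\<dots> \<in> sets (borel_of_top X)" using Q B(1) by (intro sets.countable_UN') auto
    finally show ?thesis .
  qed
  then show ?thesis by (simp add: borel_measurable_iff_greater space_borel_of_top)
qed

lemma measurable_members:
  assumes "regular_Borel_prob X P" "k \<in> K"
  shows "f k \<in> borel_measurable P"
  using open_gt[OF assms(2)] regular_Borel_probD(2,3)[OF assms(1)]
  by (auto simp: borel_measurable_iff_greater intro: openin_borel)

lemma measurable_limit: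
  assumes "regular_Borel_prob X P" "\<Phi> \<noteq> bot" "\<forall>\<^sub>F k in \<Phi>. k \<in> K"
    and "\<And>x. x \<in> topspace X \<Longrightarrow> ((\<lambda>k. f k x) \<longlongrightarrow> F x) \<Phi>"
  shows "F \<in> borel_measurable P"
  using limit_borel[OF assms(2-4)] by (simp add: measurable_cong_sets[OF regular_Borel_probD(2)[OF assms(1)] refl])

lemma limit_range:
  assumes "\<Phi> \<noteq> bot" "\<forall>\<^sub>F k in \<Phi>. k \<in> K" and x: "x \<in> topspace X"
    and lim: "((\<lambda>k. f k x) \<longlongrightarrow> l) \<Phi>"
  shows "0 \<le> l \<and> l \<le> 1"
proof -
  have "\<forall>\<^sub>F k in \<Phi>. f k x \<in> {0..1}" using assms(2) by (rule eventually_mono) (use range x in auto)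
  then have "l \<in> {0..1}" by (intro Lim_in_closed_set[OF _ _ assms(1) lim]) auto
  then show ?thesis by simp
qed

text \<open>
  A layer argument at the levels \<open>i / m\<close>: where \<open>F\<close> exceeds \<open>f k\<close> by more than \<open>2 / m\<close>, some level set
  \<open>F > (i + 1) / m\<close>, \<open>f k < i / m\<close> contains the point, and these sets are eventually small.
\<close>
lemma integral_lower:
  assumes U: "ultra U" "\<forall>\<^sub>F k in U. k \<in> K"
    and lim: "\<And>x. x \<in> topspace X \<Longrightarrow> ((\<lambda>k. f k x) \<longlongrightarrow> F x) U"
    and P: "regular_Borel_prob X P" and X: "Hausdorff_space X" and \<epsilon>: "0 < \<epsilon>"
  shows "\<forall>\<^sub>F k in U. integral\<^sup>L P F \<le> integral\<^sup>L P (f k) + \<epsilon>"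
proof -
  interpret prob_space P using P by (rule regular_Borel_probD)
  have sp: "space P = topspace X" by (rule regular_Borel_probD(3)[OF P])
  have Une: "U \<noteq> bot" using U by (simp add: ultra_def)
  have Fm: "F \<in> borel_measurable P" by (rule measurable_limit[OF P Une U(2) lim])
  note fm = measurable_members[OF P]
  have F01: "0 \<le> F x \<and> F x \<le> 1" if "x \<in> topspace X" for x by (rule limit_range[OF Une U(2) that lim[OF that]])
  obtain m :: nat where m: "m > 0" "4 / \<epsilon> < m"
    by (metis gr_zeroI less_eq_real_def linorder_not_le of_nat_0 of_nat_0_less_iff reals_Archimedean2 zero_less_divide_iff zero_less_numeral \<epsilon>)
  define S where "S i k = {x\<in>topspace X. (i + 1) / m < F x \<and> f k x < i / m}" for i :: nat and k
  have "\<forall>\<^sub>F k in U. measure P (S i k) < 1 / m / m" for i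
  proof -
    interpret alternation X K U f "i / m" "(i + 1) / m"
      by (rule alternation[OF U]) (use m in \<open>auto simp: field_simps\<close>)
    show ?thesis unfolding S_def using eventually_small[OF P X lim, of "1 / m / m"] m by (simp add: add.commute)
  qed
  then have "\<forall>\<^sub>F k in U. \<forall>i\<in>{..m}. measure P (S i k) < 1 / m / m"
    by (simp add: eventually_ball_finite_distrib)
  then show ?thesis
    using U(2)
  proof eventually_elim
    case (elim k)
    have Sm: "S i k \<in> sets P" for i
    proof -
      have "{x \<in> space P. (i + 1) / m < F x} \<inter> {x \<in> space P. f k x < i / m} \<in> sets P"
        using Fm fm[OF elim(2)] by measurable
      also have "{x \<in> space P. (i + 1) / m < F x} \<inter> {x \<in> space P. f k x < i / m} = S i k"
        by (auto simp: S_def sp)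
      finally show ?thesis .
    qed
    have le: "F x \<le> f k x + 2 / m + (\<Sum>i\<le>m. indicator (S i k) x)" if x: "x \<in> space P" for x
    proof (cases "F x \<le> f k x + 2 / m")
      case True
      moreover have "0 \<le> (\<Sum>i\<le>m. indicator (S i k) x :: real)" by (intro sum_nonneg) auto
      ultimately show ?thesis by linarith
    next
      case False
      have r: "0 \<le> f k x" "f k x \<le> 1" using range elim(2) x sp by auto
      \<comment> \<open>The least level above \<open>f k x\<close>.\<close>
      define i where "i = nat \<lfloor>m * f k x\<rfloor> + 1"
      have "real (nat \<lfloor>m * f k x\<rfloor>) = real_of_int \<lfloor>m * f k x\<rfloor>" using r by simp
      then have "real (nat \<lfloor>m * f k x\<rfloor>) \<le> m * f k x" "m * f k x < nat \<lfloor>m * f k x\<rfloor> + 1"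
        by linarith+
      then have i: "m * f k x < i" "i \<le> m * f k x + 1" by (auto simp: i_def)
      have "m * f k x + 2 < m * F x" using False m by (simp add: field_simps)
      with i have "m * F x > i + 1" by linarith
      moreover have "m * F x \<le> m * (1::real)" using F01[of x] x sp by (intro mult_left_mono) auto
      ultimately have "m * (1::real) > i + 1" by linarith
      then have im: "i \<le> m" by simp
      have "x \<in> S i k" using \<open>m * F x > i + 1\<close> i m x sp by (auto simp: S_def field_simps)
      then have "1 \<le> (\<Sum>i\<le>m. indicator (S i k) x :: real)"
        using im by (intro order_trans[OF _ member_le_sum[of i "{..m}"]]) auto
      moreover have "F x \<le> 1" "0 \<le> 2 / real m" using F01 x sp by auto
      ultimately show ?thesis using r by linarith
    qed
    have int: "integrable P F" "integrable P (f k)"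
      by (rule integrable_const_bound[of _ 1]; use Fm fm elim(2) F01 range in \<open>auto simp: sp\<close>)+
    have intS: "integrable P (indicator (S i k) :: _ \<Rightarrow> real)" for i
      using Sm[of i] by (simp add: integrable_indicator_iff less_top[symmetric])
    have "integral\<^sup>L P F \<le> (\<integral>x. f k x + 2 / m + (\<Sum>i\<le>m. indicator (S i k) x) \<partial>P)"
    proof (rule integral_mono[OF int(1) _ le])
      show "integrable P (\<lambda>x. f k x + 2 / m + (\<Sum>i\<le>m. indicator (S i k) x))"
        by (intro Bochner_Integration.integrable_add Bochner_Integration.integrable_sum int(2) intS) simp
    qed
    also have "\<dots> = integral\<^sup>L P (f k) + 2 / m + (\<Sum>i\<le>m. measure P (S i k))"
      using int(2) intS Sm by (simp add: prob_space Bochner_Integration.integral_sum)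
    also have "(\<Sum>i\<le>m. measure P (S i k)) \<le> (\<Sum>i\<le>m. 1 / m / m)"
      using elim(1) by (intro sum_mono less_imp_le) auto
    also have "(\<Sum>i\<le>m. 1 / m / m) = (m + 1) / m / m" using m by (simp add: field_simps)
    also have "\<dots> \<le> 2 / m" using m by (simp add: field_simps)
    also have "2 / m \<le> \<epsilon> / 2" using m \<epsilon> by (simp add: field_simps)
    finally show ?case using m \<epsilon> by (simp add: field_simps)
  qed
qed

text \<open>
  If convergence failed, some ultrafilter finer than \<open>\<Phi>\<close> would stay away from the limit.  Along it the
  lower bound applies to the family and to its reflection \<open>1 - f\<close>.
\<close>
lemma limit_integral:
  assumes \<Phi>: "\<forall>\<^sub>F k in \<Phi>. k \<in> K"
    and lim: "\<And>x. x \<in> topspace X \<Longrightarrow> ((\<lambda>k. f k x) \<longlongrightarrow> F x) \<Phi>"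
    and P: "regular_Borel_prob X P" and X: "Hausdorff_space X"
  shows "((\<lambda>k. integral\<^sup>L P (f k)) \<longlongrightarrow> integral\<^sup>L P F) \<Phi>"
proof (rule tendstoI, rule ccontr)
  fix \<epsilon> :: real assume \<epsilon>: "0 < \<epsilon>"
  assume bad: "\<not> (\<forall>\<^sub>F k in \<Phi>. dist (integral\<^sup>L P (f k)) (integral\<^sup>L P F) < \<epsilon>)"
  let ?\<Psi> = "inf \<Phi> (principal {k. \<not> dist (integral\<^sup>L P (f k)) (integral\<^sup>L P F) < \<epsilon>})"
  have "?\<Psi> \<noteq> bot" using bad by (simp add: trivial_limit_def eventually_inf_principal)
  from ultra_exists[OF this] obtain U where U: "ultra U" "U \<le> ?\<Psi>" by blast
  have U\<Phi>: "U \<le> \<Phi>" using U(2) by simp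
  have UK: "\<forall>\<^sub>F k in U. k \<in> K" using U\<Phi> \<Phi> by (rule filter_leD)
  have limU: "((\<lambda>k. f k x) \<longlongrightarrow> F x) U" if "x \<in> topspace X" for x
    using lim[OF that] U\<Phi> by (meson tendsto_mono)
  have Une: "U \<noteq> bot" using U by (simp add: ultra_def)
  interpret g: nip_family X K "\<lambda>k x. 1 - f k x" by (rule flip)
  interpret prob_space P using P by (rule regular_Borel_probD)
  have sp: "space P = topspace X" by (rule regular_Borel_probD(3)[OF P])
  have Fm: "F \<in> borel_measurable P" by (rule measurable_limit[OF P Une UK limU])
  note fm = measurable_members[OF P]
  have F01: "0 \<le> F x \<and> F x \<le> 1" if "x \<in> topspace X" for x by (rule limit_range[OF Une UK that limU[OF that]])
  have intF: "integrable P F"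
    by (rule integrable_const_bound[of _ 1]) (use Fm F01 in \<open>auto simp: sp\<close>)
  have 1: "\<forall>\<^sub>F k in U. integral\<^sup>L P F \<le> integral\<^sup>L P (f k) + \<epsilon> / 2"
    by (rule integral_lower[OF U(1) UK limU P X]) (use \<epsilon> in auto)
  have 2: "\<forall>\<^sub>F k in U. (\<integral>x. 1 - F x \<partial>P) \<le> (\<integral>x. 1 - f k x \<partial>P) + \<epsilon> / 2"
    by (rule g.integral_lower[OF U(1) UK _ P X]) (use \<epsilon> in \<open>auto intro!: tendsto_intros limU\<close>)
  have 3: "\<forall>\<^sub>F k in U. \<not> dist (integral\<^sup>L P (f k)) (integral\<^sup>L P F) < \<epsilon>"
    using U(2) by (rule filter_leD) (simp add: eventually_inf_principal)
  from 1 2 3 UK have "\<forall>\<^sub>F k in U. False"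
  proof eventually_elim
    case (elim k)
    have intf: "integrable P (f k)"
      by (rule integrable_const_bound[of _ 1]) (use fm elim range in \<open>auto simp: sp\<close>)
    have "(\<integral>x. 1 - F x \<partial>P) = 1 - integral\<^sup>L P F" "(\<integral>x. 1 - f k x \<partial>P) = 1 - integral\<^sup>L P (f k)"
      using intF intf by (simp_all add: prob_space)
    with elim \<epsilon> show ?case by (auto simp: dist_real_def)
  qed
  with Une show False by (simp add: trivial_limit_def)
qed

end

section \<open>Regular Borel measures on Boolean spaces\<close>

text \<open>
  In a finite measure outer regularity follows from inner regularity of complements.
\<close>
lemma regular_Borel_probI:
  assumes p: "prob_space P" and s: "sets P = sets (borel_of_top X)" and X: "Hausdorff_space X"
    and inner: "\<And>B e. B \<in> sets P \<Longrightarrow> 0 < e \<Longrightarrow> \<exists>K. compactin X K \<and> K \<subseteq> B \<and> measure P (B - K) < e"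
  shows "regular_Borel_prob X P"
proof -
  interpret prob_space P by (rule p)
  have sp: "space P = topspace X" using sets_eq_imp_space_eq[OF s] by (simp add: space_borel_of_top)
  have compP: "K \<in> sets P" if "compactin X K" for K
    unfolding s by (rule closedin_borel[OF compactin_imp_closedin[OF X that]])
  have openP: "U \<in> sets P" if "openin X U" for U unfolding s by (rule openin_borel[OF that])
  have in_eq: "emeasure P B = (SUP K\<in>{K. compactin X K \<and> K \<subseteq> B}. emeasure P K)" if B: "B \<in> sets P" for B
  proof (rule antisym)
    show "(SUP K\<in>{K. compactin X K \<and> K \<subseteq> B}. emeasure P K) \<le> emeasure P B"
      by (rule SUP_least) (use B emeasure_mono in blast)
    show "emeasure P B \<le> (SUP K\<in>{K. compactin X K \<and> K \<subseteq> B}. emeasure P K)"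
    proof (rule ennreal_le_epsilon)
      fix e :: real assume e: "0 < e"
      from inner[OF B e] obtain K where K: "compactin X K" "K \<subseteq> B" "measure P (B - K) < e" by blast
      have "measure P (B - K) = measure P B - measure P K"
        by (rule finite_measure_Diff[OF B compP[OF K(1)] K(2)])
      then have "measure P B \<le> measure P K + e" using K(3) by linarith
      then have "emeasure P B \<le> emeasure P K + ennreal e"
        using e by (simp add: emeasure_eq_measure ennreal_plus[symmetric] ennreal_leI del: ennreal_plus)
      also have "emeasure P K \<le> (SUP K\<in>{K. compactin X K \<and> K \<subseteq> B}. emeasure P K)"
        by (rule SUP_upper) (use K in simp)
      finally show "emeasure P B \<le> (SUP K\<in>{K. compactin X K \<and> K \<subseteq> B}. emeasure P K) + ennreal e"
        by (simp add: add_mono)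
    qed
  qed
  have out_eq: "emeasure P B = (INF U\<in>{U. openin X U \<and> B \<subseteq> U}. emeasure P U)" if B: "B \<in> sets P" for B
  proof (rule antisym)
    show "emeasure P B \<le> (INF U\<in>{U. openin X U \<and> B \<subseteq> U}. emeasure P U)"
      by (rule INF_greatest) (use openP emeasure_mono in blast)
    show "(INF U\<in>{U. openin X U \<and> B \<subseteq> U}. emeasure P U) \<le> emeasure P B"
    proof (rule ennreal_le_epsilon)
      fix e :: real assume e: "0 < e"
      have cB: "topspace X - B \<in> sets P" using sets.compl_sets[OF B] by (simp add: sp)
      from inner[OF this e] obtain K where K: "compactin X K" "K \<subseteq> topspace X - B"
        "measure P (topspace X - B - K) < e" by blast
      have Bs: "B \<subseteq> topspace X" using sets.sets_into_space[OF B] by (simp add: sp)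
      have U: "openin X (topspace X - K)" using compactin_imp_closedin[OF X K(1)] by (simp add: closedin_def)
      have "measure P (topspace X - K) = measure P (B \<union> (topspace X - B - K))"
        by (rule arg_cong[where f = "measure P"]) (use K(2) Bs in blast)
      also have "\<dots> \<le> measure P B + measure P (topspace X - B - K)"
        by (rule measure_Un_le[OF B sets.Diff[OF cB compP[OF K(1)]]])
      finally have "measure P (topspace X - K) \<le> measure P B + e" using K(3) by linarith
      then have "emeasure P (topspace X - K) \<le> emeasure P B + ennreal e"
        using e by (simp add: emeasure_eq_measure ennreal_plus[symmetric] ennreal_leI del: ennreal_plus)
      moreover have "(INF U\<in>{U. openin X U \<and> B \<subseteq> U}. emeasure P U) \<le> emeasure P (topspace X - K)"
        by (rule INF_lower) (use U K(2) Bs in blast)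
      ultimately show "(INF U\<in>{U. openin X U \<and> B \<subseteq> U}. emeasure P U) \<le> emeasure P B + ennreal e"
        by (rule order_trans[rotated])
    qed
  qed
  show ?thesis unfolding regular_Borel_prob_def using p s in_eq out_eq by blast
qed

text \<open>
  A finitely additive probability on a base \<open>\<C>\<close> of clopen sets of a Boolean space.  Clopen sets alone generate
  only the Baire sets, so the extension to Borel sets goes through open sets and Caratheodory's theorem.
\<close>
locale boolean_content =
  fixes X :: "'x topology" and \<C> :: "'x set set" and m :: "'x set \<Rightarrow> real"
  assumes compact: "compact_space X" and Hausdorff: "Hausdorff_space X"
    and clopen: "\<And>C. C \<in> \<C> \<Longrightarrow> openin X C"
    and compl: "\<And>C. C \<in> \<C> \<Longrightarrow> topspace X - C \<in> \<C>"
    and un: "\<And>C D. C \<in> \<C> \<Longrightarrow> D \<in> \<C> \<Longrightarrow> C \<union> D \<in> \<C>"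
    and empty: "{} \<in> \<C>"
    and base: "\<And>U x. openin X U \<Longrightarrow> x \<in> U \<Longrightarrow> \<exists>C\<in>\<C>. x \<in> C \<and> C \<subseteq> U"
    and nonneg: "\<And>C. C \<in> \<C> \<Longrightarrow> 0 \<le> m C"
    and total: "m (topspace X) = 1"
    and add: "\<And>C D. C \<in> \<C> \<Longrightarrow> D \<in> \<C> \<Longrightarrow> C \<inter> D = {} \<Longrightarrow> m (C \<union> D) = m C + m D"
begin

lemma sub: "C \<in> \<C> \<Longrightarrow> C \<subseteq> topspace X"
  using clopen openin_subset by blast

lemma top: "topspace X \<in> \<C>"
  using compl[OF empty] by simp

lemma diff: "C \<in> \<C> \<Longrightarrow> D \<in> \<C> \<Longrightarrow> C - D \<in> \<C>"
proof -
  assume CD: "C \<in> \<C>" "D \<in> \<C>"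
  have "C - D = topspace X - ((topspace X - C) \<union> D)" using sub[OF CD(1)] by blast
  then show ?thesis using compl un CD by metis
qed

lemma m_empty: "m {} = 0"
  using add[OF empty empty] by simp

lemma m_mono: assumes "C \<in> \<C>" "D \<in> \<C>" "C \<subseteq> D" shows "m C \<le> m D"
proof -
  have "m (C \<union> (D - C)) = m C + m (D - C)" using assms by (intro add diff) auto
  moreover have "C \<union> (D - C) = D" using assms by blast
  ultimately show ?thesis using nonneg[OF diff[OF assms(2,1)]] by simp
qed

lemma m_Un_le: assumes "C \<in> \<C>" "D \<in> \<C>" shows "m (C \<union> D) \<le> m C + m D"
proof -
  have "m (C \<union> (D - C)) = m C + m (D - C)" using assms by (intro add diff) auto
  moreover have "C \<union> (D - C) = C \<union> D" by blast
  ultimately show ?thesis using m_mono[OF diff[OF assms(2,1)] assms(2)] by simp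
qed

lemma fin_un: "finite I \<Longrightarrow> (\<And>i. i \<in> I \<Longrightarrow> E i \<in> \<C>) \<Longrightarrow> (\<Union>i\<in>I. E i) \<in> \<C>"
  by (induction rule: finite_induct) (auto intro: un empty)

lemma m_UN_le: "finite I \<Longrightarrow> (\<And>i. i \<in> I \<Longrightarrow> E i \<in> \<C>) \<Longrightarrow> m (\<Union>i\<in>I. E i) \<le> (\<Sum>i\<in>I. m (E i))"
proof (induction rule: finite_induct)
  case empty
  then show ?case by (simp add: m_empty)
next
  case (insert i I)
  have "m (E i \<union> (\<Union>i\<in>I. E i)) \<le> m (E i) + m (\<Union>i\<in>I. E i)"
    by (rule m_Un_le) (rule insert.prems, simp, rule fin_un[OF insert.hyps(1)], rule insert.prems, simp)
  moreover have "m (\<Union>i\<in>I. E i) \<le> (\<Sum>i\<in>I. m (E i))"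
    by (rule insert.IH) (rule insert.prems, simp)
  ultimately have "m (E i \<union> (\<Union>i\<in>I. E i)) \<le> m (E i) + (\<Sum>i\<in>I. m (E i))" by linarith
  then show ?case using insert.hyps by simp
qed

definition inner :: "'x set \<Rightarrow> ennreal" where
  "inner U = (SUP C\<in>{C\<in>\<C>. C \<subseteq> U}. ennreal (m C))"

definition outer :: "'x set \<Rightarrow> ennreal" where
  "outer E = (INF U\<in>{U. openin X U \<and> E \<subseteq> U}. inner U)"

lemma inner_ge: "C \<in> \<C> \<Longrightarrow> C \<subseteq> U \<Longrightarrow> ennreal (m C) \<le> inner U"
  unfolding inner_def by (rule SUP_upper) simp

lemma inner_mono: "U \<subseteq> V \<Longrightarrow> inner U \<le> inner V"
  unfolding inner_def by (rule SUP_subset_mono) auto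

lemma inner_clopen: "C \<in> \<C> \<Longrightarrow> inner C = m C"
  unfolding inner_def by (intro antisym SUP_least SUP_upper) (auto intro: ennreal_leI m_mono)

lemma outer_le: "openin X U \<Longrightarrow> E \<subseteq> U \<Longrightarrow> outer E \<le> inner U"
  unfolding outer_def by (rule INF_lower) simp

lemma outer_mono: "E \<subseteq> F \<Longrightarrow> outer E \<le> outer F"
  unfolding outer_def by (rule INF_superset_mono) auto

lemma outer_open: "openin X U \<Longrightarrow> outer U = inner U"
  unfolding outer_def by (intro antisym INF_greatest INF_lower) (auto intro: inner_mono)

lemma outer_le_1: assumes "E \<subseteq> topspace X" shows "outer E \<le> 1"
  using outer_le[OF openin_topspace assms] inner_clopen[OF top] total by simp

text \<open>
  Countable subadditivity comes from compactness: a clopen set covered by open sets is covered by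
  finitely many clopen subsets of them, which are grouped by the open set that they belong to.
\<close>
lemma m_le_suminf_inner:
  assumes C: "C \<in> \<C>" and U: "\<And>n. openin X (U n)" and sub: "C \<subseteq> (\<Union>n. U n)"
  shows "ennreal (m C) \<le> (\<Sum>n. inner (U n))"
proof -
  have "\<forall>x\<in>C. \<exists>n. x \<in> U n" using sub by blast
  from bchoice[OF this] obtain n where n: "\<And>x. x \<in> C \<Longrightarrow> x \<in> U (n x)" by blast
  have "\<forall>x\<in>C. \<exists>D. D \<in> \<C> \<and> x \<in> D \<and> D \<subseteq> U (n x)" using base[OF U n] by blast
  from bchoice[OF this] obtain D where D: "\<And>x. x \<in> C \<Longrightarrow> D x \<in> \<C>" "\<And>x. x \<in> C \<Longrightarrow> x \<in> D x"
    "\<And>x. x \<in> C \<Longrightarrow> D x \<subseteq> U (n x)" by blast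
  have "closedin X C" using clopen[OF compl[OF C]] openin_subset[OF clopen[OF C]] by (simp add: closedin_def)
  then have "compactin X C" using compact closedin_compact_space by blast
  moreover have "C \<subseteq> \<Union> (D ` C)" using D(2) by blast
  moreover have "\<forall>V\<in>D ` C. openin X V" using D(1) clopen by blast
  ultimately obtain \<F> where \<F>: "finite \<F>" "\<F> \<subseteq> D ` C" "C \<subseteq> \<Union> \<F>"
    unfolding compactin_def by meson
  from finite_subset_image[OF \<F>(1,2)] obtain S where S: "S \<subseteq> C" "finite S" "\<F> = D ` S" by blast
  define E where "E k = (\<Union>x\<in>{x\<in>S. n x = k}. D x)" for k
  have E\<C>: "E k \<in> \<C>" for k unfolding E_def by (rule fin_un) (use S(1,2) D(1) in auto)
  have EU: "E k \<subseteq> U k" for k unfolding E_def using S(1) D(3) by blast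
  let ?I = "n ` S"
  have "C \<subseteq> (\<Union>n\<in>?I. E n)"
  proof
    fix x assume "x \<in> C"
    then obtain y where y: "y \<in> S" "x \<in> D y" using \<F>(3) S(3) by blast
    then have "x \<in> E (n y)" unfolding E_def by blast
    moreover have "n y \<in> ?I" using y(1) by blast
    ultimately show "x \<in> (\<Union>n\<in>?I. E n)" by (rule UN_I[rotated])
  qed
  moreover have I: "finite ?I" using S(2) by simp
  then have "(\<Union>n\<in>?I. E n) \<in> \<C>" by (rule fin_un) (rule E\<C>)
  ultimately have "m C \<le> m (\<Union>n\<in>?I. E n)" using m_mono[OF C] by blast
  also have "\<dots> \<le> (\<Sum>n\<in>?I. m (E n))" using I by (rule m_UN_le) (rule E\<C>)
  finally have "ennreal (m C) \<le> ennreal (\<Sum>n\<in>?I. m (E n))" by (rule ennreal_leI)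
  also have "\<dots> = (\<Sum>n\<in>?I. ennreal (m (E n)))" by (rule sum_ennreal[symmetric]) (rule nonneg, rule E\<C>)
  also have "\<dots> \<le> (\<Sum>n\<in>?I. inner (U n))" by (intro sum_mono inner_ge E\<C> EU)
  also have "\<dots> \<le> (\<Sum>n. inner (U n))" using I by (intro sum_le_suminf) simp_all
  finally show ?thesis .
qed

lemma inner_UN_le:
  assumes U: "\<And>n. openin X (U n)"
  shows "inner (\<Union>n. U n) \<le> (\<Sum>n. inner (U n))"
proof -
  have "(SUP C\<in>{C\<in>\<C>. C \<subseteq> (\<Union>n. U n)}. ennreal (m C)) \<le> (\<Sum>n. inner (U n))"
    by (rule SUP_least) (simp add: m_le_suminf_inner[OF _ U])
  then show ?thesis unfolding inner_def[of "\<Union>n. U n"] .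
qed

lemma outer_UN_le:
  assumes "\<And>n. A n \<subseteq> topspace X"
  shows "outer (\<Union>n. A n) \<le> (\<Sum>n. outer (A n))"
proof (rule ennreal_le_epsilon)
  fix e :: real assume e: "0 < e"
  have "\<forall>n. \<exists>V. openin X V \<and> A n \<subseteq> V \<and> inner V \<le> outer (A n) + ennreal (e * (1/2) ^ Suc n)"
  proof
    fix n
    have "outer (A n) \<noteq> \<infinity>" using outer_le_1[OF assms, of n] by (auto simp: top_unique)
    moreover have "0 < e * (1/2) ^ Suc n" using e by simp
    ultimately obtain V where "V \<in> {U. openin X U \<and> A n \<subseteq> U}" "inner V < outer (A n) + ennreal (e * (1/2) ^ Suc n)"
      using INF_approx_ennreal[OF _ outer_def] by blast
    then show "\<exists>V. openin X V \<and> A n \<subseteq> V \<and> inner V \<le> outer (A n) + ennreal (e * (1/2) ^ Suc n)"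
      by (intro exI[of _ V]) (simp add: less_imp_le)
  qed
  from choice[OF this] obtain V where V: "\<And>n. openin X (V n)" "\<And>n. A n \<subseteq> V n"
    "\<And>n. inner (V n) \<le> outer (A n) + ennreal (e * (1/2) ^ Suc n)" by blast
  have "outer (\<Union>n. A n) \<le> inner (\<Union>n. V n)"
    by (rule outer_le) (use V(1,2) in blast)+
  also have "\<dots> \<le> (\<Sum>n. inner (V n))" by (rule inner_UN_le[OF V(1)])
  also have "\<dots> \<le> (\<Sum>n. outer (A n) + ennreal (e * (1/2) ^ Suc n))"
    by (rule suminf_le) (rule V(3), simp_all)
  also have "\<dots> = (\<Sum>n. outer (A n)) + (\<Sum>n. ennreal (e * (1/2) ^ Suc n))"
    by (rule suminf_add[symmetric]) simp_all
  also have "(\<Sum>n. ennreal (e * (1/2) ^ Suc n)) = ennreal e"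
  proof -
    have "(\<lambda>n. e * (1/2) ^ Suc n) sums (e * 1)" by (intro sums_mult power_half_series)
    then show ?thesis using e by (intro suminf_ennreal_eq) auto
  qed
  finally show "outer (\<Union>n. A n) \<le> (\<Sum>n. outer (A n)) + ennreal e" .
qed

lemma outer_empty: "outer {} = 0"
  using outer_open[of "{}"] inner_clopen[OF empty] m_empty by simp

lemma outer_Un_le:
  assumes "A \<subseteq> topspace X" "B \<subseteq> topspace X"
  shows "outer (A \<union> B) \<le> outer A + outer B"
proof -
  have "outer (\<Union>n. binaryset A B n) \<le> (\<Sum>n. outer (binaryset A B n))"
    by (rule outer_UN_le) (use assms in \<open>simp add: binaryset_def\<close>)
  also have "\<dots> = outer A + outer B" by (rule suminf_binaryset_eq) (simp add: outer_empty)
  finally show ?thesis by (simp add: UN_binaryset_eq)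
qed

text \<open>
  Exhaust \<open>V \<inter> U\<close> by a clopen \<open>C\<close> and then the open remainder \<open>V - C\<close>, which contains \<open>V - U\<close>, by a clopen
  \<open>D\<close>; the two are disjoint subsets of \<open>V\<close>.
\<close>
lemma inner_split:
  assumes U: "openin X U" and V: "openin X V"
  shows "inner (V \<inter> U) + outer (V - U) \<le> inner V"
proof -
  have ne: "{C\<in>\<C>. C \<subseteq> W} \<noteq> {}" for W using empty by blast
  have "inner (V \<inter> U) + outer (V - U) = (SUP C\<in>{C\<in>\<C>. C \<subseteq> V \<inter> U}. ennreal (m C) + outer (V - U))"
    unfolding inner_def by (rule ennreal_SUP_add_left[OF ne, symmetric])
  also have "\<dots> \<le> inner V"
  proof (rule SUP_least)
    fix C assume "C \<in> {C\<in>\<C>. C \<subseteq> V \<inter> U}"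
    then have C: "C \<in> \<C>" "C \<subseteq> V" "C \<subseteq> U" by auto
    have "V - C = V \<inter> (topspace X - C)" using openin_subset[OF V] by blast
    then have op: "openin X (V - C)" using openin_Int[OF V clopen[OF compl[OF C(1)]]] by simp
    have "V - U \<subseteq> V - C" using C(3) by blast
    then have "ennreal (m C) + outer (V - U) \<le> ennreal (m C) + inner (V - C)"
      by (intro add_left_mono outer_le[OF op])
    also have "\<dots> = inner (V - C) + ennreal (m C)" by (rule add.commute)
    also have "\<dots> = (SUP D\<in>{D\<in>\<C>. D \<subseteq> V - C}. ennreal (m D) + ennreal (m C))"
      unfolding inner_def by (rule ennreal_SUP_add_left[OF ne, symmetric])
    also have "\<dots> \<le> inner V"
    proof (rule SUP_least)
      fix D assume "D \<in> {D\<in>\<C>. D \<subseteq> V - C}"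
      then have D: "D \<in> \<C>" "D \<subseteq> V - C" by auto
      have "ennreal (m D) + ennreal (m C) = ennreal (m (D \<union> C))"
      proof -
        have "m (D \<union> C) = m D + m C" by (rule add) (use C D in blast)+
        then show ?thesis using nonneg[OF C(1)] nonneg[OF D(1)] by simp
      qed
      also have "\<dots> \<le> inner V" using C D by (intro inner_ge un) blast+
      finally show "ennreal (m D) + ennreal (m C) \<le> inner V" .
    qed
    finally show "ennreal (m C) + outer (V - U) \<le> inner V" .
  qed
  finally show ?thesis .
qed

text \<open>
  Open sets are measurable in the sense of Caratheodory.
\<close>
lemma outer_split:
  assumes U: "openin X U" and E: "E \<subseteq> topspace X"
  shows "outer (E \<inter> U) + outer (E - U) = outer E"
proof (rule antisym)
  show "outer E \<le> outer (E \<inter> U) + outer (E - U)"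
  proof -
    have "E \<inter> U \<subseteq> topspace X" "E - U \<subseteq> topspace X" using E by blast+
    from outer_Un_le[OF this] show ?thesis by (simp add: Int_Diff_Un)
  qed
  show "outer (E \<inter> U) + outer (E - U) \<le> outer E"
  proof (subst (3) outer_def, rule INF_greatest)
    fix V assume "V \<in> {V. openin X V \<and> E \<subseteq> V}"
    then have V: "openin X V" "E \<subseteq> V" by auto
    have "outer (E \<inter> U) + outer (E - U) \<le> inner (V \<inter> U) + outer (V - U)"
      using V U by (intro add_mono outer_le outer_mono) auto
    also have "\<dots> \<le> inner V" by (rule inner_split[OF U V(1)])
    finally show "outer (E \<inter> U) + outer (E - U) \<le> inner V" .
  qed
qed

definition radon :: "'x measure" where
  "radon = measure_of (topspace X) {U. openin X U} outer"

lemma open_Pow: "{U. openin X U} \<subseteq> Pow (topspace X)"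
  by (auto dest: openin_subset)

lemma emeasure_radon: "A \<in> sets radon \<Longrightarrow> emeasure radon A = outer A"
  and sets_radon: "sets radon = sets (borel_of_top X)"
  and space_radon: "space radon = topspace X"
proof -
  let ?\<Omega> = "topspace X"
  interpret P: sigma_algebra ?\<Omega> "Pow ?\<Omega>" by (rule sigma_algebra_Pow)
  let ?L = "lambda_system ?\<Omega> (Pow ?\<Omega>) outer"
  have "outer_measure_space (Pow ?\<Omega>) outer"
    unfolding outer_measure_space_def positive_def increasing_def countably_subadditive_def
  proof (intro conjI ballI allI impI)
    show "outer {} = 0" by (rule outer_empty)
    show "outer A \<le> outer B" if "A \<subseteq> B" for A B using that by (rule outer_mono)
    fix A :: "nat \<Rightarrow> 'x set" assume "range A \<subseteq> Pow ?\<Omega>"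
    then have "A n \<subseteq> ?\<Omega>" for n by auto
    then show "outer (\<Union>i. A i) \<le> (\<Sum>i. outer (A i))" by (rule outer_UN_le)
  qed
  from P.caratheodory_lemma[OF this] have L: "measure_space ?\<Omega> ?L outer" .
  then have saL: "sigma_algebra ?\<Omega> ?L" by (simp add: measure_space_def)
  have "{U. openin X U} \<subseteq> ?L"
  proof
    fix U assume "U \<in> {U. openin X U}"
    then have U: "openin X U" by simp
    have "outer (U \<inter> x) + outer ((?\<Omega> - U) \<inter> x) = outer x" if "x \<subseteq> ?\<Omega>" for x
    proof -
      have "U \<inter> x = x \<inter> U" "(?\<Omega> - U) \<inter> x = x - U" using that by blast+
      then show ?thesis using outer_split[OF U that] by simp
    qed
    then show "U \<in> ?L" using openin_subset[OF U] by (simp add: lambda_system_def)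
  qed
  then have sub: "sigma_sets ?\<Omega> {U. openin X U} \<subseteq> ?L" by (rule sigma_algebra.sigma_sets_subset[OF saL])
  have "countably_additive (sigma_sets ?\<Omega> {U. openin X U}) outer"
    unfolding countably_additive_def
  proof (intro allI impI)
    fix A :: "nat \<Rightarrow> 'x set"
    assume A: "range A \<subseteq> sigma_sets ?\<Omega> {U. openin X U}" "disjoint_family A" "(\<Union>i. A i) \<in> sigma_sets ?\<Omega> {U. openin X U}"
    then have "range A \<subseteq> ?L" "(\<Union>i. A i) \<in> ?L" using sub by blast+
    with L A(2) show "(\<Sum>i. outer (A i)) = outer (\<Union>i. A i)"
      unfolding measure_space_def countably_additive_def by blast
  qed
  moreover have "positive (sigma_sets ?\<Omega> {U. openin X U}) outer"
    by (simp add: positive_def outer_empty)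
  ultimately show "A \<in> sets radon \<Longrightarrow> emeasure radon A = outer A"
    using open_Pow by (intro emeasure_measure_of[OF radon_def]) (simp_all add: radon_def)
  show "sets radon = sets (borel_of_top X)" "space radon = topspace X"
    using open_Pow by (simp_all add: radon_def)
qed

lemma regular_radon: "regular_Borel_prob X radon"
proof (rule regular_Borel_probI[OF _ sets_radon Hausdorff])
  show p: "prob_space radon"
  proof
    have "emeasure radon (space radon) = outer (topspace X)" by (simp add: emeasure_radon space_radon[symmetric])
    also have "\<dots> = 1" using outer_open[OF openin_topspace] inner_clopen[OF top] total by simp
    finally show "emeasure radon (space radon) = 1" .
  qed
  interpret prob_space radon by (rule p)
  fix B and e :: real assume B: "B \<in> sets radon" and e: "0 < e"
  let ?B = "topspace X - B"
  have openP: "U \<in> sets radon" if "openin X U" for U unfolding sets_radon by (rule openin_borel[OF that])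
  have cB: "?B \<in> sets radon" using sets.compl_sets[OF B] by (simp add: space_radon)
  have eq: "emeasure radon ?B = (INF U\<in>{U. openin X U \<and> ?B \<subseteq> U}. inner U)"
    unfolding emeasure_radon[OF cB] by (rule outer_def)
  have fin: "emeasure radon ?B \<noteq> \<infinity>" by simp
  from INF_approx_ennreal[OF e eq fin]
  obtain V where "V \<in> {U. openin X U \<and> ?B \<subseteq> U}" and lt: "inner V < emeasure radon ?B + ennreal e" ..
  then have V: "openin X V" "?B \<subseteq> V" by simp_all
  have "inner V = emeasure radon V" unfolding emeasure_radon[OF openP[OF V(1)]] by (rule outer_open[OF V(1), symmetric])
  then have "ennreal (prob V) < ennreal (prob ?B + e)" using lt e by (simp add: emeasure_eq_measure)
  then have "prob V < prob ?B + e" by (simp add: ennreal_less_iff)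
  moreover have "prob (V - ?B) = prob V - prob ?B" by (rule finite_measure_Diff[OF openP[OF V(1)] cB V(2)])
  moreover have "B - (topspace X - V) = V - ?B"
    using sets.sets_into_space[OF B] openin_subset[OF V(1)] by (auto simp: space_radon)
  ultimately have "prob (B - (topspace X - V)) < e" by simp
  moreover have "closedin X (topspace X - V)" using V(1) by (rule openin_closedin_eq[THEN iffD1, THEN conjunct2])
  then have "compactin X (topspace X - V)" using compact closedin_compact_space by blast
  moreover have "topspace X - V \<subseteq> B" using V(2) by blast
  ultimately show "\<exists>K. compactin X K \<and> K \<subseteq> B \<and> prob (B - K) < e" by blast
qed

lemma measure_radon: "C \<in> \<C> \<Longrightarrow> measure radon C = m C"
proof -
  assume C: "C \<in> \<C>"
  then have "C \<in> sets radon" using openin_borel[OF clopen] by (simp add: sets_radon)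
  then have "emeasure radon C = m C" using outer_open[OF clopen[OF C]] inner_clopen[OF C] by (simp add: emeasure_radon)
  then show ?thesis using nonneg[OF C] by (simp add: measure_def)
qed

end

text \<open>
  A compact subset of an open \<open>U\<close> lies in a clopen subset of \<open>U\<close>, so inner regularity determines the
  measure on open sets, and outer regularity on all Borel sets.
\<close>
lemma regular_Borel_prob_eqI:
  assumes P: "regular_Borel_prob X P" and Q: "regular_Borel_prob X Q" and X: "Hausdorff_space X"
    and un: "\<And>C D. C \<in> \<C> \<Longrightarrow> D \<in> \<C> \<Longrightarrow> C \<union> D \<in> \<C>" and empty: "{} \<in> \<C>"
    and clopen: "\<And>C. C \<in> \<C> \<Longrightarrow> openin X C"
    and base: "\<And>U x. openin X U \<Longrightarrow> x \<in> U \<Longrightarrow> \<exists>C\<in>\<C>. x \<in> C \<and> C \<subseteq> U"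
    and eq: "\<And>C. C \<in> \<C> \<Longrightarrow> measure P C = measure Q C"
  shows "P = Q"
proof -
  have le: "emeasure P U \<le> emeasure Q U"
    if P: "regular_Borel_prob X P" and Q: "regular_Borel_prob X Q" and U: "openin X U"
      and eq: "\<And>C. C \<in> \<C> \<Longrightarrow> measure P C = measure Q C" for P Q U
  proof -
    interpret P: prob_space P using P by (rule regular_Borel_probD)
    interpret Q: prob_space Q using Q by (rule regular_Borel_probD)
    have UP: "U \<in> sets P" "U \<in> sets Q" using openin_borel[OF U] regular_Borel_probD(2)[OF P] regular_Borel_probD(2)[OF Q] by simp_all
    then have "emeasure P U = (SUP K\<in>{K. compactin X K \<and> K \<subseteq> U}. emeasure P K)"
      using P by (simp add: regular_Borel_prob_def)
    also have "\<dots> \<le> emeasure Q U"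
    proof (rule SUP_least)
      fix K assume "K \<in> {K. compactin X K \<and> K \<subseteq> U}"
      then have K: "compactin X K" "K \<subseteq> U" by auto
      have "\<forall>x\<in>K. \<exists>C. C \<in> \<C> \<and> x \<in> C \<and> C \<subseteq> U" using base[OF U] K by blast
      from bchoice[OF this] obtain c where c: "\<And>x. x \<in> K \<Longrightarrow> c x \<in> \<C>" "\<And>x. x \<in> K \<Longrightarrow> x \<in> c x"
        "\<And>x. x \<in> K \<Longrightarrow> c x \<subseteq> U" by blast
      have "K \<subseteq> \<Union> (c ` K)" using c(2) by blast
      moreover have "\<And>V. V \<in> c ` K \<Longrightarrow> openin X V" using c(1) clopen by blast
      ultimately obtain \<F> where \<F>: "finite \<F>" "\<F> \<subseteq> c ` K" "K \<subseteq> \<Union> \<F>"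
        using K(1) unfolding compactin_def by meson
      have "finite \<G> \<Longrightarrow> \<G> \<subseteq> \<C> \<Longrightarrow> \<Union> \<G> \<in> \<C>" for \<G>
        by (induction rule: finite_induct) (auto intro: un empty)
      then have C: "\<Union> \<F> \<in> \<C>" using \<F> c(1) by blast
      have CU: "\<Union> \<F> \<subseteq> U" using \<F>(2) c(3) by blast
      have CP: "\<Union> \<F> \<in> sets P" "\<Union> \<F> \<in> sets Q"
        using openin_borel[OF clopen[OF C]] regular_Borel_probD(2)[OF P] regular_Borel_probD(2)[OF Q] by simp_all
      have "emeasure P K \<le> emeasure P (\<Union> \<F>)" using \<F>(3) CP(1) by (rule emeasure_mono)
      also have "\<dots> = emeasure Q (\<Union> \<F>)" using eq[OF C] by (simp add: P.emeasure_eq_measure Q.emeasure_eq_measure)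
      also have "\<dots> \<le> emeasure Q U" using CU UP(2) by (rule emeasure_mono)
      finally show "emeasure P K \<le> emeasure Q U" .
    qed
    finally show ?thesis .
  qed
  have "emeasure P U = emeasure Q U" if "openin X U" for U
    using le[OF P Q that eq] le[OF Q P that eq[symmetric]] by (rule antisym)
  then have op: "(INF U\<in>{U. openin X U \<and> B \<subseteq> U}. emeasure P U) = (INF U\<in>{U. openin X U \<and> B \<subseteq> U}. emeasure Q U)" for B
    by (intro INF_cong) auto
  have sets: "sets P = sets Q" using regular_Borel_probD(2)[OF P] regular_Borel_probD(2)[OF Q] by simp
  show ?thesis
  proof (rule measure_eqI[OF sets])
    fix B assume "B \<in> sets P"
    then have "emeasure P B = (INF U\<in>{U. openin X U \<and> B \<subseteq> U}. emeasure P U)"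
      "emeasure Q B = (INF U\<in>{U. openin X U \<and> B \<subseteq> U}. emeasure Q U)"
      using P Q sets unfolding regular_Borel_prob_def by blast+
    then show "emeasure P B = emeasure Q B" using op by simp
  qed
qed

lemma continuous_map_borel:
  assumes "continuous_map X Y r"
  shows "r \<in> measurable (borel_of_top X) (borel_of_top Y)"
proof (rule measurable_measure_of)
  show "{U. openin Y U} \<subseteq> Pow (topspace Y)" by (auto dest: openin_subset)
  show "r \<in> space (borel_of_top X) \<rightarrow> topspace Y"
    using continuous_map_image_subset_topspace[OF assms] by (auto simp: space_borel_of_top)
  fix U assume "U \<in> {U. openin Y U}"
  then have "openin X {x \<in> topspace X. r x \<in> U}" using openin_continuous_map_preimage[OF assms] by blast
  moreover have "{x \<in> topspace X. r x \<in> U} = r -` U \<inter> space (borel_of_top X)" by (auto simp: space_borel_of_top)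
  ultimately show "r -` U \<inter> space (borel_of_top X) \<in> sets (borel_of_top X)" using openin_borel[of X] by simp
qed

text \<open>
  Images of compact sets are compact, so inner regularity passes to image measures.
\<close>
lemma regular_Borel_prob_distr:
  assumes P: "regular_Borel_prob X P" and r: "continuous_map X Y r"
    and X: "Hausdorff_space X" and Y: "Hausdorff_space Y"
  shows "regular_Borel_prob Y (distr P (borel_of_top Y) r)"
proof (rule regular_Borel_probI[OF _ _ Y])
  interpret prob_space P using P by (rule regular_Borel_probD)
  have rm: "r \<in> measurable P (borel_of_top Y)"
    using continuous_map_borel[OF r] by (simp add: measurable_cong_sets[OF regular_Borel_probD(2)[OF P] refl])
  show "prob_space (distr P (borel_of_top Y) r)" by (rule prob_space_distr[OF rm])
  show "sets (distr P (borel_of_top Y) r) = sets (borel_of_top Y)" by (rule sets_distr)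
  fix B and e :: real assume B: "B \<in> sets (distr P (borel_of_top Y) r)" and e: "0 < e"
  then have B': "B \<in> sets (borel_of_top Y)" by simp
  have "r -` B \<inter> space P \<in> sets P" by (rule measurable_sets[OF rm B'])
  from inner_approx[OF P X this e] obtain K where K: "compactin X K" "K \<subseteq> r -` B \<inter> space P"
    "measure P (r -` B \<inter> space P - K) < e" by blast
  have KP: "K \<in> sets P"
    using closedin_borel[OF compactin_imp_closedin[OF X K(1)]] regular_Borel_probD(2)[OF P] by simp
  have C: "compactin Y (r ` K)" by (rule image_compactin[OF K(1) r])
  have CY: "r ` K \<in> sets (borel_of_top Y)" by (rule closedin_borel[OF compactin_imp_closedin[OF Y C]])
  have "measure (distr P (borel_of_top Y) r) (B - r ` K) = measure P (r -` (B - r ` K) \<inter> space P)"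
    by (rule measure_distr[OF rm sets.Diff[OF B' CY]])
  also have "\<dots> \<le> measure P (r -` B \<inter> space P - K)"
    by (rule finite_measure_mono) (use \<open>r -` B \<inter> space P \<in> sets P\<close> KP in auto)
  also have "\<dots> < e" by (rule K(3))
  finally show "\<exists>K. compactin Y K \<and> K \<subseteq> B \<and> measure (distr P (borel_of_top Y) r) (B - K) < e"
    using C K(2) by blast
qed

section \<open>Definable sets\<close>

lemma eval_tm_cong:
  "(\<And>s n. (s, n) \<in> fv_tm t \<Longrightarrow> e s n = e' s n) \<Longrightarrow> eval_tm M e t = eval_tm M e' t"
proof (induction t)
  case (Fun f ts)
  have "map (eval_tm M e) ts = map (eval_tm M e') ts"
    by (rule map_cong[OF refl], rule Fun.IH) (use Fun.prems in auto)
  then show ?case by (simp only: eval_tm.simps)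
qed simp

lemma sat_cong:
  "(\<And>s n. (s, n) \<in> fv \<phi> \<Longrightarrow> e s n = e' s n) \<Longrightarrow> sat M e \<phi> \<longleftrightarrow> sat M e' \<phi>"
proof (induction \<phi> arbitrary: e e')
  case (Eq t u)
  then show ?case using eval_tm_cong[of t e e' M] eval_tm_cong[of u e e' M] by simp
next
  case (Rel R ts)
  have "map (eval_tm M e) ts = map (eval_tm M e') ts"
    by (rule map_cong[OF refl], rule eval_tm_cong) (use Rel.prems in auto)
  then show ?case by (simp only: sat.simps)
next
  case (Neg \<phi>)
  have "sat M e \<phi> \<longleftrightarrow> sat M e' \<phi>" by (rule Neg.IH) (rule Neg.prems, simp)
  then show ?case by simp
next
  case (Conj \<phi> \<psi>)
  have "sat M e \<phi> \<longleftrightarrow> sat M e' \<phi>" by (rule Conj.IH(1)) (rule Conj.prems, simp)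
  moreover have "sat M e \<psi> \<longleftrightarrow> sat M e' \<psi>" by (rule Conj.IH(2)) (rule Conj.prems, simp)
  ultimately show ?case by simp
next
  case (Ex s n \<phi>)
  have "sat M (env_upd e s n a) \<phi> \<longleftrightarrow> sat M (env_upd e' s n a) \<phi>" for a
  proof (rule Ex.IH)
    fix t k assume "(t, k) \<in> fv \<phi>"
    then show "env_upd e s n a t k = env_upd e' s n a t k"
      using Ex.prems[of t k] by (auto simp: env_upd_def)
  qed
  then show ?case by simp
qed

lemma finite_fv_tm: "finite (fv_tm t)"
  by (induction t) auto

lemma finite_fv: "finite (fv \<phi>)"
  by (induction \<phi>) (auto simp: finite_fv_tm)

primrec ren_tm :: "('s \<Rightarrow> nat \<Rightarrow> nat) \<Rightarrow> ('s, 'f) tm \<Rightarrow> ('s, 'f) tm" where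
  "ren_tm f (Var s n) = Var s (f s n)"
| "ren_tm f (Fun g ts) = Fun g (map (ren_tm f) ts)"

text \<open>
  Bound variables are renamed together with the free ones, so an injective renaming causes no capture.
\<close>
primrec ren :: "('s \<Rightarrow> nat \<Rightarrow> nat) \<Rightarrow> ('s, 'f, 'r) fm \<Rightarrow> ('s, 'f, 'r) fm" where
  "ren f (Eq t u) = Eq (ren_tm f t) (ren_tm f u)"
| "ren f (Rel R ts) = Rel R (map (ren_tm f) ts)"
| "ren f (Neg \<phi>) = Neg (ren f \<phi>)"
| "ren f (Conj \<phi> \<psi>) = Conj (ren f \<phi>) (ren f \<psi>)"
| "ren f (Ex s n \<phi>) = Ex s (f s n) (ren f \<phi>)"

lemma eval_ren_tm: "eval_tm M e (ren_tm f t) = eval_tm M (\<lambda>s n. e s (f s n)) t"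
proof (induction t)
  case (Fun g ts)
  have "map (eval_tm M e) (map (ren_tm f) ts) = map (eval_tm M (\<lambda>s n. e s (f s n))) ts"
    by (simp add: Fun.IH)
  then show ?case by (simp only: ren_tm.simps eval_tm.simps)
qed simp

lemma sat_ren:
  assumes inj: "\<And>s. inj (f s)"
  shows "sat M e (ren f \<phi>) \<longleftrightarrow> sat M (\<lambda>s n. e s (f s n)) \<phi>"
proof (induction \<phi> arbitrary: e)
  case (Rel R ts)
  have "map (eval_tm M e) (map (ren_tm f) ts) = map (eval_tm M (\<lambda>s n. e s (f s n))) ts"
    by (simp add: eval_ren_tm)
  then show ?case by (simp only: ren.simps sat.simps)
next
  case (Ex s n \<phi>)
  have "(\<lambda>t k. env_upd e s (f s n) a t (f t k)) = env_upd (\<lambda>s n. e s (f s n)) s n a" for a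
    using inj[of s] by (auto simp: env_upd_def fun_eq_iff inj_eq)
  then show ?case by (simp add: Ex.IH)
qed (simp_all add: eval_ren_tm)

lemma has_sort_ren_tm: "has_sort L t s \<Longrightarrow> has_sort L (ren_tm f t) s"
proof (induction rule: has_sort.induct)
  case (2 g ss s ts)
  have "list_all2 (has_sort L) (map (ren_tm f) ts) ss"
    using 2(2) by (auto simp: list_all2_conv_all_nth)
  with 2(1) show ?case by (simp add: has_sort.intros(2))
qed (simp add: has_sort.intros(1))

lemma wf_ren: "wf_fm L \<phi> \<Longrightarrow> wf_fm L (ren f \<phi>)"
proof (induction \<phi>)
  case (Eq t u)
  then show ?case by (auto intro: has_sort_ren_tm)
next
  case (Rel R ts)
  then show ?case by (auto simp: list_all2_conv_all_nth intro: has_sort_ren_tm)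
qed auto

lemma fv_ren_tm: "fv_tm (ren_tm f t) = (\<lambda>(s, n). (s, f s n)) ` fv_tm t"
  by (induction t) auto

lemma fv_ren:
  assumes "\<And>s. inj (f s)"
  shows "fv (ren f \<phi>) = (\<lambda>(s, n). (s, f s n)) ` fv \<phi>"
proof (induction \<phi>)
  case (Ex s n \<phi>)
  then show ?case using assms[of s] by (auto simp: inj_eq image_iff)
qed (auto simp: fv_ren_tm)

lemma valid_env_upd: "valid_env M e \<Longrightarrow> a \<in> univ M s \<Longrightarrow> valid_env M (env_upd e s n a)"
  by (auto simp: valid_env_def env_upd_def)

lemma valid_env_exists: "is_struct L M \<Longrightarrow> \<exists>e. valid_env M e"
proof -
  assume "is_struct L M"
  then have "\<forall>s. \<exists>a. a \<in> univ M s" by (auto simp: is_struct_def)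
  from choice[OF this] obtain c where "\<forall>s. c s \<in> univ M s" ..
  then have "valid_env M (\<lambda>s n. c s)" by (simp add: valid_env_def)
  then show ?thesis by blast
qed

lemma wf_Var_eq: "wf_fm L (Eq (Var s n) (Var s k))"
  by (auto intro: has_sort.intros(1))

lemma defsetsI:
  assumes "wf_fm L \<phi>" "valid_env M e" "\<And>t n. (t, n) \<in> fv \<phi> \<Longrightarrow> (t, n) \<noteq> (s, 0) \<Longrightarrow> e t n \<in> A t"
    and "D = {a \<in> univ M s. sat M (env_upd e s 0 a) \<phi>}"
  shows "D \<in> defsets L M s A"
  unfolding defsets_def using assms by blast

lemma defsetsE:
  assumes "D \<in> defsets L M s A"
  obtains \<phi> e where "wf_fm L \<phi>" "valid_env M e" "\<And>t n. (t, n) \<in> fv \<phi> \<Longrightarrow> (t, n) \<noteq> (s, 0) \<Longrightarrow> e t n \<in> A t"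
    "D = {a \<in> univ M s. sat M (env_upd e s 0 a) \<phi>}"
  using assms unfolding defsets_def by blast

lemma defsets_mono: "(\<And>t. A t \<subseteq> B t) \<Longrightarrow> defsets L M s A \<subseteq> defsets L M s B"
proof
  fix D assume AB: "\<And>t. A t \<subseteq> B t" and "D \<in> defsets L M s A"
  from this(2) obtain \<phi> e where "wf_fm L \<phi>" "valid_env M e" "\<And>t n. (t, n) \<in> fv \<phi> \<Longrightarrow> (t, n) \<noteq> (s, 0) \<Longrightarrow> e t n \<in> A t"
    "D = {a \<in> univ M s. sat M (env_upd e s 0 a) \<phi>}" by (rule defsetsE) (rule that)
  then show "D \<in> defsets L M s B" by (intro defsetsI[of L \<phi> M e]) (use AB in blast)+
qed

lemma defsets_sub: "D \<in> defsets L M s A \<Longrightarrow> D \<subseteq> univ M s"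
  by (auto simp: defsets_def)

lemma defsets_compl: assumes "D \<in> defsets L M s A" shows "univ M s - D \<in> defsets L M s A"
proof -
  from assms obtain \<phi> e where "wf_fm L \<phi>" "valid_env M e" "\<And>t n. (t, n) \<in> fv \<phi> \<Longrightarrow> (t, n) \<noteq> (s, 0) \<Longrightarrow> e t n \<in> A t"
    "D = {a \<in> univ M s. sat M (env_upd e s 0 a) \<phi>}" by (rule defsetsE) (rule that)
  then show ?thesis by (intro defsetsI[of L "Neg \<phi>" M e]) auto
qed

lemma defsets_univ: assumes "is_struct L M" shows "univ M s \<in> defsets L M s A"
proof -
  obtain e where "valid_env M e" using valid_env_exists[OF assms] ..
  then show ?thesis by (intro defsetsI[of L "Eq (Var s 0) (Var s 0)" M e]) (simp_all add: wf_Var_eq del: wf_fm.simps)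
qed

text \<open>
  The parameters of the two formulas are kept apart by moving the variables of one to even and those of the
  other to odd indices; the variable \<open>Var s 0\<close> is common to both.
\<close>
lemma defsets_Int:
  fixes s :: 's
  assumes "D \<in> defsets L M s A" "E \<in> defsets L M s A"
  shows "D \<inter> E \<in> defsets L M s A"
proof -
  from assms(1) obtain \<phi> e where 1: "wf_fm L \<phi>" "valid_env M e" "\<And>t n. (t, n) \<in> fv \<phi> \<Longrightarrow> (t, n) \<noteq> (s, 0) \<Longrightarrow> e t n \<in> A t"
    "D = {a \<in> univ M s. sat M (env_upd e s 0 a) \<phi>}" by (rule defsetsE) (rule that)
  from assms(2) obtain \<psi> e' where 2: "wf_fm L \<psi>" "valid_env M e'" "\<And>t n. (t, n) \<in> fv \<psi> \<Longrightarrow> (t, n) \<noteq> (s, 0) \<Longrightarrow> e' t n \<in> A t"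
    "E = {a \<in> univ M s. sat M (env_upd e' s 0 a) \<psi>}" by (rule defsetsE) (rule that)
  define f :: "'s \<Rightarrow> nat \<Rightarrow> nat" where "f t n = 2 * n" for t n
  define g :: "'s \<Rightarrow> nat \<Rightarrow> nat" where "g t n = (if t = s \<and> n = 0 then 0 else 2 * n + 1)" for t n
  have inj: "inj (f t)" "inj (g t)" for t
    by (auto simp: f_def g_def inj_def split: if_splits)
  define h where "h t k = (if even k then e t (k div 2) else e' t (k div 2))" for t and k :: nat
  have hf: "env_upd h s 0 a t (f t n) = env_upd e s 0 a t n" for a t n
    by (auto simp: env_upd_def h_def f_def)
  have hg: "env_upd h s 0 a t (g t n) = env_upd e' s 0 a t n" for a t n
    by (auto simp: env_upd_def h_def g_def)
  show ?thesis
  proof (rule defsetsI[of L "Conj (ren f \<phi>) (ren g \<psi>)" M h])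
    show "wf_fm L (Conj (ren f \<phi>) (ren g \<psi>))" using 1 2 by (simp add: wf_ren)
    show "valid_env M h" using 1 2 by (auto simp: valid_env_def h_def)
    show "h t n \<in> A t" if "(t, n) \<in> fv (Conj (ren f \<phi>) (ren g \<psi>))" "(t, n) \<noteq> (s, 0)" for t n
    proof -
      from that(1) consider k where "(t, k) \<in> fv \<phi>" "n = f t k" | k where "(t, k) \<in> fv \<psi>" "n = g t k"
        by (auto simp: fv_ren inj)
      then show ?thesis
      proof cases
        case 1
        then show ?thesis using \<open>\<And>t n. (t, n) \<in> fv \<phi> \<Longrightarrow> _ \<Longrightarrow> e t n \<in> A t\<close>[of t k] that(2)
          by (auto simp: h_def f_def)
      next
        case 2
        then show ?thesis using \<open>\<And>t n. (t, n) \<in> fv \<psi> \<Longrightarrow> _ \<Longrightarrow> e' t n \<in> A t\<close>[of t k] that(2)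
          by (auto simp: h_def g_def split: if_splits)
      qed
    qed
    show "D \<inter> E = {a \<in> univ M s. sat M (env_upd h s 0 a) (Conj (ren f \<phi>) (ren g \<psi>))}"
      by (auto simp: 1(4) 2(4) sat_ren inj hf hg)
  qed
qed

lemma defsets_Diff:
  assumes "D \<in> defsets L M s A" "E \<in> defsets L M s A"
  shows "D - E \<in> defsets L M s A"
proof -
  have "D - E = D \<inter> (univ M s - E)" using defsets_sub[OF assms(1)] by blast
  then show ?thesis using defsets_Int[OF assms(1) defsets_compl[OF assms(2)]] by simp
qed

lemma defsets_Un: 
  assumes "D \<in> defsets L M s A" "E \<in> defsets L M s A"
  shows "D \<union> E \<in> defsets L M s A"
proof -
  have "univ M s - ((univ M s - D) \<inter> (univ M s - E)) = D \<union> E"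
    using defsets_sub[OF assms(1)] defsets_sub[OF assms(2)] by blast
  then show ?thesis using defsets_compl[OF defsets_Int[OF defsets_compl[OF assms(1)] defsets_compl[OF assms(2)]]] by simp
qed

lemma defsets_finite_params:
  assumes "D \<in> defsets L M s A"
  obtains B where "\<And>t. B t \<subseteq> A t" "finite (Sigma UNIV B)" "D \<in> defsets L M s B"
proof -
  from assms obtain \<phi> e where 1: "wf_fm L \<phi>" "valid_env M e" "\<And>t n. (t, n) \<in> fv \<phi> \<Longrightarrow> (t, n) \<noteq> (s, 0) \<Longrightarrow> e t n \<in> A t"
    "D = {a \<in> univ M s. sat M (env_upd e s 0 a) \<phi>}" by (rule defsetsE) (rule that)
  define B where "B t = {e t n | n. (t, n) \<in> fv \<phi> \<and> (t, n) \<noteq> (s, 0)}" for t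
  have "Sigma UNIV B \<subseteq> (\<lambda>(t, n). (t, e t n)) ` fv \<phi>" by (auto simp: B_def)
  then have 2: "finite (Sigma UNIV B)" by (rule finite_subset) (intro finite_imageI finite_fv)
  have 3: "B t \<subseteq> A t" for t using 1(3) by (auto simp: B_def)
  have 4: "D \<in> defsets L M s B" by (rule defsetsI[OF 1(1,2) _ 1(4)]) (auto simp: B_def)
  show ?thesis by (rule that[OF 3 2 4])
qed

text \<open>
  If \<open>\<phi>(x)\<close> has the variable \<open>x = Var s 0\<close>, this is \<open>\<phi>(x\<^sub>i \<cdot> x\<^sub>j)\<close> for the variables \<open>x\<^sub>i = Var s i\<close> and
  \<open>x\<^sub>j = Var s j\<close>.  The product is named by the bound variable \<open>Var s 1\<close>; all parameters move up by 3, so that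
  the indices 0 and 2 are free for the factors.
\<close>
definition product_fm :: "'s \<Rightarrow> 'f \<Rightarrow> nat \<Rightarrow> nat \<Rightarrow> ('s, 'f, 'r) fm \<Rightarrow> ('s, 'f, 'r) fm" where
  "product_fm s m i j \<phi> = Ex s 1 (Conj (Eq (Var s 1) (Fun m [Var s i, Var s j]))
     (ren (\<lambda>t n. if t = s \<and> n = 0 then 1 else n + 3) \<phi>))"

lemma wf_product_fm:
  assumes "fun_arity L m = Some ([s, s], s)" and "wf_fm L \<phi>"
  shows "wf_fm L (product_fm s m i j \<phi>)"
proof -
  have "has_sort L (Fun m [Var s i, Var s j]) s"
    by (rule has_sort.intros(2)[OF assms(1)]) (simp add: has_sort.intros(1))
  then have "wf_fm L (Eq (Var s 1) (Fun m [Var s i, Var s j]))"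
    by (simp, blast intro: has_sort.intros(1))
  then show ?thesis
    unfolding product_fm_def wf_fm.simps(4,5) using wf_ren[OF assms(2)] by blast
qed

lemma inj_product_ren: "inj (\<lambda>n. if t = s \<and> n = (0::nat) then 1 else n + 3)"
  by (rule injI) (simp split: if_splits)

lemma fv_product_fm:
  "fv (product_fm s m i j \<phi>) \<subseteq> {(s, i), (s, j)} \<union> {(t, n + 3) | t n. (t, n) \<in> fv \<phi> \<and> (t, n) \<noteq> (s, 0)}"
proof
  fix x assume "x \<in> fv (product_fm s m i j \<phi>)"
  then have "x \<in> {(s, i), (s, j)} \<or>
      x \<noteq> (s, 1) \<and> x \<in> (\<lambda>(t, n). (t, if t = s \<and> n = 0 then 1 else n + 3)) ` fv \<phi>"
    unfolding product_fm_def fv.simps fv_ren[OF inj_product_ren] by auto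
  then show "x \<in> {(s, i), (s, j)} \<union> {(t, n + 3) | t n. (t, n) \<in> fv \<phi> \<and> (t, n) \<noteq> (s, 0)}"
  proof
    assume "x \<noteq> (s, 1) \<and> x \<in> (\<lambda>(t, n). (t, if t = s \<and> n = 0 then 1 else n + 3)) ` fv \<phi>"
    then obtain y where y: "y \<in> fv \<phi>" "x = (\<lambda>(t, n). (t, if t = s \<and> n = 0 then 1 else n + 3)) y" "x \<noteq> (s, 1)"
      by blast
    obtain t n where "y = (t, n)" by (cases y)
    with y have tn: "(t, n) \<in> fv \<phi>" "x = (t, if t = s \<and> n = 0 then 1 else n + 3)" "x \<noteq> (s, 1)"
      by simp_all
    then have "x = (t, n + 3)" "(t, n) \<noteq> (s, 0)" by (auto split: if_splits)
    with tn(1) show ?thesis by blast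
  qed blast
qed

lemma sat_product_fm:
  assumes "i \<in> {0, 2}" "j \<in> {0, 2}" "mul M m (e s i) (e s j) \<in> univ M s"
  shows "sat M e (product_fm s m i j \<phi>) \<longleftrightarrow> sat M (env_upd (\<lambda>t n. e t (n + 3)) s 0 (mul M m (e s i) (e s j))) \<phi>"
proof -
  have env: "(\<lambda>t n. env_upd e s 1 a t (if t = s \<and> n = 0 then 1 else n + 3)) = env_upd (\<lambda>t n. e t (n + 3)) s 0 a" for a
    by (auto simp: env_upd_def fun_eq_iff)
  have ij: "i \<noteq> 1" "j \<noteq> 1" using assms(1,2) by auto
  have "sat M e (product_fm s m i j \<phi>) \<longleftrightarrow>
    (\<exists>a\<in>univ M s. a = mul M m (e s i) (e s j) \<and> sat M (env_upd (\<lambda>t n. e t (n + 3)) s 0 a) \<phi>)"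
    unfolding product_fm_def sat.simps sat_ren[OF inj_product_ren] env
    using ij by (simp add: env_upd_def mul_def)
  then show ?thesis using assms(3) by blast
qed

definition product_env :: "'s \<Rightarrow> ('s \<Rightarrow> nat \<Rightarrow> 'm) \<Rightarrow> 'm \<Rightarrow> 'm \<Rightarrow> 's \<Rightarrow> nat \<Rightarrow> 'm" where
  "product_env s e a d t n = (if t = s \<and> n = 0 then a else if t = s \<and> n = 2 then d else e t (n - 3))"

lemma defsets_rshift:
  assumes ar: "fun_arity L m = Some ([s, s], s)" and cl: "\<And>a b. a \<in> univ M s \<Longrightarrow> b \<in> univ M s \<Longrightarrow> mul M m a b \<in> univ M s"
    and D: "D \<in> defsets L M s A" and d: "d \<in> A s" "d \<in> univ M s"
  shows "rshift M s m d D \<in> defsets L M s A" and "lshift M s m d D \<in> defsets L M s A"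
proof -
  from D obtain \<phi> e where 1: "wf_fm L \<phi>" "valid_env M e" "\<And>t n. (t, n) \<in> fv \<phi> \<Longrightarrow> (t, n) \<noteq> (s, 0) \<Longrightarrow> e t n \<in> A t"
    "D = {a \<in> univ M s. sat M (env_upd e s 0 a) \<phi>}" by (rule defsetsE) (rule that)
  define h where "h = product_env s e d d"
  have v: "valid_env M h" using 1(2) d by (auto simp: valid_env_def h_def product_env_def)
  have h3: "(\<lambda>t n. env_upd h s 0 a t (n + 3)) = e" for a
    by (auto simp: h_def product_env_def env_upd_def fun_eq_iff)
  have h0: "env_upd h s 0 a s 0 = a" "env_upd h s 0 a s 2 = d" for a
    by (auto simp: h_def product_env_def env_upd_def)
  have A: "h t n \<in> A t" if "(t, n) \<in> fv (product_fm s m i j \<phi>)" "(t, n) \<noteq> (s, 0)" "i \<in> {0, 2}" "j \<in> {0, 2}" for t n i j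
    using subsetD[OF fv_product_fm that(1)] that(2-) 1(3) d by (auto simp: h_def product_env_def)
  show "rshift M s m d D \<in> defsets L M s A"
  proof (rule defsetsI[OF wf_product_fm[OF ar 1(1)] v])
    show "h t n \<in> A t" if "(t, n) \<in> fv (product_fm s m 0 2 \<phi>)" "(t, n) \<noteq> (s, 0)" for t n using A[OF that] by simp
    show "rshift M s m d D = {a \<in> univ M s. sat M (env_upd h s 0 a) (product_fm s m 0 2 \<phi>)}"
      using cl d by (auto simp: rshift_def 1(4) sat_product_fm h3 h0)
  qed
  show "lshift M s m d D \<in> defsets L M s A"
  proof (rule defsetsI[OF wf_product_fm[OF ar 1(1)] v])
    show "h t n \<in> A t" if "(t, n) \<in> fv (product_fm s m 2 0 \<phi>)" "(t, n) \<noteq> (s, 0)" for t n using A[OF that] by simp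
    show "lshift M s m d D = {a \<in> univ M s. sat M (env_upd h s 0 a) (product_fm s m 2 0 \<phi>)}"
      using cl d by (auto simp: lshift_def 1(4) sat_product_fm h3 h0)
  qed
qed

text \<open>
  Shattering by products would give the independence property to \<open>\<phi>(x \<cdot> y)\<close>, partitioned with the variable
  \<open>x\<close> on one side and \<open>y\<close> together with the parameters on the other.
\<close>
lemma NIP_products:
  assumes ar: "fun_arity L m = Some ([s, s], s)" and cl: "\<And>a b. a \<in> univ M s \<Longrightarrow> b \<in> univ M s \<Longrightarrow> mul M m a b \<in> univ M s"
    and nip: "\<And>\<phi> X. wf_fm L \<phi> \<Longrightarrow> \<not> has_IP M \<phi> X" and D: "D \<in> defsets L M s A"
  shows "\<exists>n. \<not> (\<exists>g. (\<forall>i<n. g i \<in> univ M s) \<and> (\<forall>I\<subseteq>{..<n}. \<exists>d\<in>univ M s. \<forall>i<(n::nat). mul M m (g i) d \<in> D \<longleftrightarrow> i \<in> I))"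
proof (rule ccontr)
  assume "\<not> ?thesis"
  then have sh: "\<And>n::nat. \<exists>g. (\<forall>i<n. g i \<in> univ M s) \<and> (\<forall>I\<subseteq>{..<n}. \<exists>d\<in>univ M s. \<forall>i<n. mul M m (g i) d \<in> D \<longleftrightarrow> i \<in> I)"
    by blast
  from D obtain \<phi> e where 1: "wf_fm L \<phi>" "valid_env M e" "\<And>t n. (t, n) \<in> fv \<phi> \<Longrightarrow> (t, n) \<noteq> (s, 0) \<Longrightarrow> e t n \<in> A t"
    "D = {a \<in> univ M s. sat M (env_upd e s 0 a) \<phi>}" by (rule defsetsE) (rule that)
  have "has_IP M (product_fm s m 0 2 \<phi>) {(s, 0)}"
    unfolding has_IP_def
  proof
    fix n :: nat
    obtain g where g: "\<forall>i<n. g i \<in> univ M s" "\<forall>I\<subseteq>{..<n}. \<exists>d\<in>univ M s. \<forall>i<n. mul M m (g i) d \<in> D \<longleftrightarrow> i \<in> I"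
      using sh by blast
    then have "\<forall>I\<in>Pow {..<n}. \<exists>d. d \<in> univ M s \<and> (\<forall>i<n. mul M m (g i) d \<in> D \<longleftrightarrow> i \<in> I)" by (simp add: Bex_def)
    from bchoice[OF this] obtain d where d: "\<And>I. I \<subseteq> {..<n} \<Longrightarrow> d I \<in> univ M s"
      "\<And>I i. I \<subseteq> {..<n} \<Longrightarrow> i < n \<Longrightarrow> mul M m (g i) (d I) \<in> D \<longleftrightarrow> i \<in> I" by auto
    define a where "a i = product_env s e (g i) (g i)" for i
    define b where "b I = product_env s e (d I) (d I)" for I
    have "valid_env M (a i)" if "i < n" for i
      using 1(2) g(1) that by (auto simp: valid_env_def a_def product_env_def)
    moreover have "valid_env M (b I)" if "I \<subseteq> {..<n}" for I
      using 1(2) d(1)[OF that] by (auto simp: valid_env_def b_def product_env_def)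
    moreover have "sat M (\<lambda>t k. if (t, k) \<in> {(s, 0)} then a i t k else b I t k) (product_fm s m 0 2 \<phi>) \<longleftrightarrow> i \<in> I"
      if i: "i < n" and I: "I \<subseteq> {..<n}" for i I
    proof -
      let ?e = "\<lambda>t k. if (t, k) \<in> {(s, 0)} then a i t k else b I t k"
      have e0: "?e s 0 = g i" "?e s 2 = d I" by (auto simp: a_def b_def product_env_def)
      have e3: "(\<lambda>t k. ?e t (k + 3)) = e" by (auto simp: a_def b_def product_env_def fun_eq_iff)
      have cl': "mul M m (g i) (d I) \<in> univ M s" using cl g(1) i d(1)[OF I] by blast
      have "sat M ?e (product_fm s m 0 2 \<phi>) \<longleftrightarrow> sat M (env_upd e s 0 (mul M m (g i) (d I))) \<phi>"
        using sat_product_fm[of 0 2 M m ?e s \<phi>] cl' unfolding e0 e3 by simp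
      also have "\<dots> \<longleftrightarrow> mul M m (g i) (d I) \<in> D" using cl' by (simp add: 1(4))
      finally show ?thesis using d(2)[OF I i] by simp
    qed
    ultimately show "\<exists>a b. (\<forall>i<n. valid_env M (a i)) \<and> (\<forall>I\<subseteq>{..<n}. valid_env M (b I)) \<and>
        (\<forall>i<n. \<forall>I\<subseteq>{..<n}. sat M (\<lambda>t k. if (t, k) \<in> {(s, 0)} then a i t k else b I t k) (product_fm s m 0 2 \<phi>) \<longleftrightarrow> i \<in> I)"
      by blast
  qed
  with nip[OF wf_product_fm[OF ar 1(1)]] show False by blast
qed

section \<open>The downward Loewenheim-Skolem theorem\<close>

text \<open>
  The lists of each fixed length are handled by induction, and there are countably many lengths.
\<close>
lemma card_of_lists_le:
  assumes inf: "infinite Z" and B: "|B| \<le>o |Z|"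
  shows "|lists B| \<le>o |Z|"
proof -
  have co: "Card_order |Z|" and iF: "infinite (Field |Z| )" 
    by (rule card_of_Card_order) (simp add: inf Field_card_of)
  have step: "|{xs \<in> lists B. length xs = n}| \<le>o |Z|" for n
  proof (induction n)
    case 0
    have "{xs \<in> lists B. length xs = 0} = {[]}" by auto
    then have "finite {xs \<in> lists B. length xs = 0}" by simp
    then show ?case 
      using inf by (intro ordLess_imp_ordLeq finite_ordLess_infinite card_of_Well_order) (simp_all add: Field_card_of)
  next
    case (Suc n)
    have "{xs \<in> lists B. length xs = Suc n} \<subseteq> (\<lambda>(x, xs). x # xs) ` (B \<times> {xs \<in> lists B. length xs = n})"
    proof
      fix ys assume "ys \<in> {xs \<in> lists B. length xs = Suc n}"
      then obtain x xs where "ys = x # xs" "x \<in> B" "xs \<in> lists B" "length xs = n"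
        by (cases ys) auto
      then show "ys \<in> (\<lambda>(x, xs). x # xs) ` (B \<times> {xs \<in> lists B. length xs = n})" by blast
    qed
    then have "|{xs \<in> lists B. length xs = Suc n}| \<le>o |(\<lambda>(x, xs). x # xs) ` (B \<times> {xs \<in> lists B. length xs = n})|"
      by (rule card_of_mono1)
    also have "|(\<lambda>(x, xs). x # xs) ` (B \<times> {xs \<in> lists B. length xs = n})| \<le>o |B \<times> {xs \<in> lists B. length xs = n}|"
      by (rule card_of_image)
    also have "|B \<times> {xs \<in> lists B. length xs = n}| \<le>o |Z|"
      by (rule card_of_Times_ordLeq_infinite_Field[OF iF B Suc co])
    finally show ?case .
  qed
  have "lists B = (\<Union>n. {xs \<in> lists B. length xs = n})" by auto
  moreover have "|\<Union>n. {xs \<in> lists B. length xs = n}| \<le>o |Z|"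
  proof (rule card_of_UNION_ordLeq_infinite[OF inf])
    show "|UNIV :: nat set| \<le>o |Z|" using inf by (simp add: infinite_iff_card_of_nat)
    show "\<forall>n\<in>UNIV. |{xs \<in> lists B. length xs = n}| \<le>o |Z|" using step by blast
  qed
  ultimately show ?thesis by simp
qed

lemma infinite_wf_fm: "infinite {\<phi> :: ('s, 'f, 'r) fm. wf_fm L \<phi>}"
proof -
  fix s :: 's
  let ?f = "\<lambda>n. Eq (Var s n) (Var s n) :: ('s, 'f, 'r) fm"
  have "infinite (range ?f)" by (rule range_inj_infinite) (simp add: inj_def)
  moreover have "range ?f \<subseteq> {\<phi>. wf_fm L \<phi>}" by (rule image_subsetI) (simp only: mem_Collect_eq wf_Var_eq)
  ultimately show ?thesis by (rule infinite_super[rotated])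
qed

lemma monster_infinite:
  assumes "monster L \<kappa> (M :: ('s, 'f, 'r, 'm) struct)"
  shows "infinite (Field \<kappa>)"
proof -
  have co: "Card_order \<kappa>" and le: "|{\<phi> :: ('s, 'f, 'r) fm. wf_fm L \<phi>}| <o \<kappa>"
    using assms unfolding monster_def by blast+
  have "|{\<phi> :: ('s, 'f, 'r) fm. wf_fm L \<phi>}| \<le>o |Field \<kappa>|"
    using ordLess_imp_ordLeq[OF le] card_of_Field_ordIso[OF co] ordLeq_ordIso_trans ordIso_symmetric by blast
  then show ?thesis using infinite_wf_fm card_of_ordLeq_infinite by blast
qed

text \<open>
  The model is the closure of \<open>A\<close> under Skolem functions \<open>w\<close>, one for each existential formula and each list of values
  for its free variables.  This closure condition is the Tarski-Vaught test; closure under the function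
  symbols is its instance for the formula \<open>y = f(x\<^sub>1, \<dots>, x\<^sub>n)\<close>, and that every sort is inhabited its instance for
  \<open>y = y\<close>.
\<close>
lemma lowenheim_skolem:
  fixes M :: "('s, 'f, 'r, 'm) struct" and L :: "('s, 'f, 'r) language"
  assumes mon: "monster L \<kappa> M" and A: "\<And>t. A t \<subseteq> univ M t" and small: "small \<kappa> A"
  shows "\<exists>N. elem_sub L N M \<and> small \<kappa> (univ N) \<and> (\<forall>t. A t \<subseteq> univ N t)"
proof -
  have co: "Card_order \<kappa>" and le: "|{\<phi> :: ('s, 'f, 'r) fm. wf_fm L \<phi>}| <o \<kappa>" and st: "is_struct L M"
    using mon unfolding monster_def by blast+
  have infF: "infinite (Field \<kappa>)" by (rule monster_infinite[OF mon])
  let ?FM = "{\<phi> :: ('s, 'f, 'r) fm. wf_fm L \<phi>}"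
  obtain c where c: "\<And>s. c s \<in> univ M s"
  proof -
    have "\<forall>s. \<exists>a. a \<in> univ M s" using st by (auto simp: is_struct_def)
    from choice[OF this] show ?thesis using that by blast
  qed
  have "\<forall>\<phi> :: ('s, 'f, 'r) fm. \<exists>vs. set vs = fv \<phi>" using finite_list[OF finite_fv] by blast
  from choice[OF this] obtain vs :: "('s, 'f, 'r) fm \<Rightarrow> ('s \<times> nat) list" where vs: "\<And>\<phi>. set (vs \<phi>) = fv \<phi>" by blast
  \<comment> \<open>The list \<open>xs\<close> supplies values for the free variables of \<open>\<phi>\<close>, and \<open>c\<close> for all others.\<close>
  define env where "env \<phi> xs t i = (case map_of (zip (vs \<phi>) xs) (t, i) of None \<Rightarrow> c t | Some a \<Rightarrow> a)"
    for \<phi> :: "('s, 'f, 'r) fm" and xs :: "'m list" and t i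
  define w where "w s n \<phi> xs = (if \<exists>a\<in>univ M s. sat M (env_upd (env \<phi> xs) s n a) \<phi>
      then SOME a. a \<in> univ M s \<and> sat M (env_upd (env \<phi> xs) s n a) \<phi> else c s)" for s n \<phi> xs
  have w_univ: "w s n \<phi> xs \<in> univ M s" for s n \<phi> xs
  proof (cases "\<exists>a\<in>univ M s. sat M (env_upd (env \<phi> xs) s n a) \<phi>")
    case True
    then have "\<exists>a. a \<in> univ M s \<and> sat M (env_upd (env \<phi> xs) s n a) \<phi>" by blast
    from someI_ex[OF this] show ?thesis using True by (simp add: w_def)
  next
    case False
    then show ?thesis by (simp add: w_def c)
  qed
  have w_sat: "sat M (env_upd (env \<phi> xs) s n (w s n \<phi> xs)) \<phi>"
    if "\<exists>a\<in>univ M s. sat M (env_upd (env \<phi> xs) s n a) \<phi>" for s n \<phi> xs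
  proof -
    from that have "\<exists>a. a \<in> univ M s \<and> sat M (env_upd (env \<phi> xs) s n a) \<phi>" by blast
    from someI_ex[OF this] show ?thesis using that by (simp add: w_def)
  qed
  define new where "new H = {(s, w s n \<phi> xs) | s n \<phi> xs. wf_fm L \<phi> \<and> xs \<in> lists (snd ` H)}" for H :: "('s \<times> 'm) set"
  define H where "H k = ((\<lambda>H. H \<union> new H) ^^ k) (Sigma UNIV A)" for k
  have H0: "H 0 = Sigma UNIV A" and HS: "H (Suc k) = H k \<union> new (H k)" for k by (simp_all add: H_def)
  have Hmono: "H k \<subseteq> H l" if "k \<le> l" for k l
    using that by (induction rule: dec_induct) (auto simp: HS)
  have HM: "a \<in> univ M s" if "(s, a) \<in> H k" for s a k
    using that
  proof (induction k)
    case 0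
    then show ?case using A by (auto simp: H0)
  next
    case (Suc k)
    then show ?case using w_univ by (auto simp: HS new_def)
  qed
  define V where "V s = {a. \<exists>k. (s, a) \<in> H k}" for s
  define N where "N = M\<lparr>univ := V\<rparr>"
  have uN: "univ N = V" and fN: "fun_int N = fun_int M" and rN: "rel_int N = rel_int M" by (simp_all add: N_def)
  have VM: "V s \<subseteq> univ M s" for s using HM by (auto simp: V_def)
  have w_V: "w s n \<phi> [] \<in> V s" if "wf_fm L \<phi>" for s n \<phi>
  proof -
    have "(s, w s n \<phi> []) \<in> H (Suc 0)" using that by (auto simp: HS new_def)
    then show ?thesis unfolding V_def by blast
  qed
  have TV: "\<exists>a\<in>V s. sat M (env_upd e s n a) \<phi>"
    if wf: "wf_fm L \<phi>" and e: "\<And>t i. e t i \<in> V t" and ex: "\<exists>a\<in>univ M s. sat M (env_upd e s n a) \<phi>" for s n \<phi> e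
  proof -
    have fin: "\<exists>k. F \<subseteq> H k" if "finite F" "\<And>x. x \<in> F \<Longrightarrow> \<exists>k. x \<in> H k" for F
      using that
    proof (induction rule: finite_induct)
      case empty
      show ?case by blast
    next
      case (insert x F)
      from insert.prems have "\<exists>k. x \<in> H k" by blast
      then obtain k where k: "x \<in> H k" ..
      have "\<exists>k. F \<subseteq> H k" by (rule insert.IH) (rule insert.prems, blast)
      then obtain l where l: "F \<subseteq> H l" ..
      have "insert x F \<subseteq> H (max k l)" using k l Hmono[of k "max k l"] Hmono[of l "max k l"] by auto
      then show ?case ..
    qed
    have "\<exists>k. (\<lambda>(t, i). (t, e t i)) ` fv \<phi> \<subseteq> H k"
      by (rule fin) (use finite_fv e in \<open>auto simp: V_def\<close>)
    then obtain k where k: "(\<lambda>(t, i). (t, e t i)) ` fv \<phi> \<subseteq> H k" ..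
    define xs where "xs = map (\<lambda>(t, i). e t i) (vs \<phi>)"
    have env: "env \<phi> xs t i = e t i" if "(t, i) \<in> fv \<phi>" for t i
      using that by (simp add: env_def xs_def map_of_zip_map vs)
    have eq: "sat M (env_upd (env \<phi> xs) s n a) \<phi> \<longleftrightarrow> sat M (env_upd e s n a) \<phi>" for a
      by (rule sat_cong) (auto simp: env_upd_def env)
    have "xs \<in> lists (snd ` H k)"
      unfolding in_lists_conv_set
    proof
      fix x assume "x \<in> set xs"
      then obtain t i where ti: "(t, i) \<in> fv \<phi>" "x = e t i" by (auto simp: xs_def vs)
      then have "(t, x) \<in> H k" using k by blast
      then show "x \<in> snd ` H k" by (rule image_eqI[rotated]) simp
    qed
    then have "(s, w s n \<phi> xs) \<in> H (Suc k)" using wf unfolding HS new_def by blast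
    then have "w s n \<phi> xs \<in> V s" unfolding V_def by blast
    moreover have "sat M (env_upd e s n (w s n \<phi> xs)) \<phi>" using w_sat[of s \<phi> xs n] ex unfolding eq by blast
    ultimately show ?thesis by blast
  qed
  have ev: "eval_tm N e t = eval_tm M e t" for e t
  proof (induction t)
    case (Fun f ts)
    have "map (eval_tm N e) ts = map (eval_tm M e) ts" using Fun.IH by simp
    then show ?case by (simp only: eval_tm.simps fN)
  qed simp
  have sat: "sat N e \<phi> \<longleftrightarrow> sat M e \<phi>" if "wf_fm L \<phi>" "\<And>t i. e t i \<in> V t" for \<phi> e
    using that
  proof (induction \<phi> arbitrary: e)
    case (Eq t u)
    show ?case by (simp add: ev)
  next
    case (Rel R ts)
    have "map (eval_tm N e) ts = map (eval_tm M e) ts" by (simp add: ev)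
    then show ?case by (simp only: sat.simps rN)
  next
    case (Neg \<phi>)
    have "sat N e \<phi> \<longleftrightarrow> sat M e \<phi>" by (rule Neg.IH) (use Neg.prems in simp_all)
    then show ?case by simp
  next
    case (Conj \<phi> \<psi>)
    have "sat N e \<phi> \<longleftrightarrow> sat M e \<phi>" by (rule Conj.IH) (use Conj.prems in simp_all)
    moreover have "sat N e \<psi> \<longleftrightarrow> sat M e \<psi>" by (rule Conj.IH) (use Conj.prems in simp_all)
    ultimately show ?case by simp
  next
    case (Ex s n \<phi>)
    have wf: "wf_fm L \<phi>" using Ex.prems(1) by simp
    have "sat N (env_upd e s n a) \<phi> \<longleftrightarrow> sat M (env_upd e s n a) \<phi>" if "a \<in> V s" for a
      by (rule Ex.IH[OF wf]) (use that Ex.prems(2) in \<open>simp add: env_upd_def\<close>)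
    then have "sat N e (Ex s n \<phi>) \<longleftrightarrow> (\<exists>a\<in>V s. sat M (env_upd e s n a) \<phi>)" by (simp add: uN)
    also have "\<dots> \<longleftrightarrow> (\<exists>a\<in>univ M s. sat M (env_upd e s n a) \<phi>)"
      using TV[where e = e and s = s and n = n, OF wf Ex.prems(2)] VM by blast
    finally show ?case by simp
  qed
  have stN: "is_struct L N"
    unfolding is_struct_def
  proof (intro conjI allI impI)
    show "univ N s \<noteq> {}" for s using w_V[OF wf_Var_eq] unfolding uN by blast
    fix f ss s as
    assume "fun_arity L f = Some (ss, s) \<and> list_all2 (\<lambda>a s'. a \<in> univ N s') as ss"
    then have f: "fun_arity L f = Some (ss, s)" and as: "list_all2 (\<lambda>a s'. a \<in> V s') as ss" by (simp_all add: uN)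
    have len: "length as = length ss" using as by (rule list_all2_lengthD)
    let ?n = "length ss"
    let ?ts = "map (\<lambda>i. Var (ss ! i) i) [0..<?n]"
    define d where "d t = w t 0 (Eq (Var t 0) (Var t 0)) []" for t
    have d: "d t \<in> V t" for t unfolding d_def by (rule w_V[OF wf_Var_eq])
    define e where "e t i = (if i < ?n \<and> t = ss ! i then as ! i else d t)" for t i
    have eV: "e t i \<in> V t" for t i using as d by (auto simp: e_def list_all2_conv_all_nth)
    have "list_all2 (has_sort L) ?ts ss" by (auto simp: list_all2_conv_all_nth intro: has_sort.intros(1))
    then have hs: "has_sort L (Fun f ?ts) s" by (rule has_sort.intros(2)[OF f])
    then have wf: "wf_fm L (Eq (Var s ?n) (Fun f ?ts))" by (simp, blast intro: has_sort.intros(1))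
    have vals: "map (eval_tm M (env_upd e s ?n a)) ?ts = as" for a
      by (rule nth_equalityI) (simp_all add: len env_upd_def e_def)
    have iff: "sat M (env_upd e s ?n a) (Eq (Var s ?n) (Fun f ?ts)) \<longleftrightarrow> a = fun_int M f as" for a
      by (simp only: sat.simps eval_tm.simps vals) (simp add: env_upd_def)
    have "list_all2 (\<lambda>a s'. a \<in> univ M s') as ss" 
      using as by (rule list_all2_mono) (rule subsetD[OF VM])
    then have "fun_int M f as \<in> univ M s" using st f unfolding is_struct_def by blast
    then have "\<exists>a\<in>univ M s. sat M (env_upd e s ?n a) (Eq (Var s ?n) (Fun f ?ts))" unfolding iff by blast
    from TV[OF wf eV this] show "fun_int N f as \<in> univ N s" unfolding iff uN fN by blast
  qed
  have "elem_sub L N M"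
    unfolding elem_sub_def using stN st VM sat by (simp add: uN valid_env_def)
  moreover have "A t \<subseteq> univ N t" for t
  proof
    fix a assume "a \<in> A t"
    then have "(t, a) \<in> H 0" by (simp add: H0)
    then show "a \<in> univ N t" unfolding uN V_def by blast
  qed
  moreover have "small \<kappa> (univ N)"
  proof -
    let ?Z = "Sigma UNIV A <+> ?FM"
    have infZ: "infinite ?Z" using infinite_wf_fm[of L] by (simp add: finite_Plus_iff)
    have coZ: "Card_order |?Z|" by (rule card_of_Card_order)
    have iFZ: "infinite (Field |?Z| )" using infZ by (simp add: Field_card_of)
    have FM: "|?FM| \<le>o |?Z|" by (rule card_of_Plus2)
    have Hk: "|H k| \<le>o |?Z|" for k
    proof (induction k)
      case 0
      show ?case unfolding H0 by (rule card_of_Plus1)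
    next
      case (Suc k)
      \<comment> \<open>Sort, variable and matrix of an existential formula are counted together, as this formula.\<close>
      let ?g = "\<lambda>(\<psi>, xs). case \<psi> of Ex s n \<phi> \<Rightarrow> (s, w s n \<phi> xs) | _ \<Rightarrow> undefined"
      have "|snd ` H k| \<le>o |?Z|" using card_of_image Suc by (rule ordLeq_transitive)
      then have l: "|lists (snd ` H k)| \<le>o |?Z|" by (rule card_of_lists_le[OF infZ])
      have "new (H k) \<subseteq> ?g ` (?FM \<times> lists (snd ` H k))"
      proof
        fix y assume "y \<in> new (H k)"
        then obtain s n \<phi> xs where y: "y = (s, w s n \<phi> xs)" "wf_fm L \<phi>" "xs \<in> lists (snd ` H k)"
          unfolding new_def by blast
        then have "(Ex s n \<phi>, xs) \<in> ?FM \<times> lists (snd ` H k)" by simp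
        moreover have "y = ?g (Ex s n \<phi>, xs)" using y(1) by simp
        ultimately show "y \<in> ?g ` (?FM \<times> lists (snd ` H k))" by (rule image_eqI[rotated])
      qed
      then have "|new (H k)| \<le>o |?g ` (?FM \<times> lists (snd ` H k))|" by (rule card_of_mono1)
      also have "|?g ` (?FM \<times> lists (snd ` H k))| \<le>o |?FM \<times> lists (snd ` H k)|" by (rule card_of_image)
      also have "|?FM \<times> lists (snd ` H k)| \<le>o |?Z|"
        by (rule card_of_Times_ordLeq_infinite_Field[OF iFZ FM l coZ])
      finally show ?case unfolding HS by (intro card_of_Un_ordLeq_infinite_Field[OF iFZ Suc _ coZ])
    qed
    have "Sigma UNIV (univ N) = (\<Union>k. H k)" by (auto simp: uN V_def)
    moreover have "|\<Union>k. H k| \<le>o |?Z|"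
    proof (rule card_of_UNION_ordLeq_infinite[OF infZ])
      show "|UNIV :: nat set| \<le>o |?Z|" by (rule infinite_iff_card_of_nat[THEN iffD1, OF infZ])
      show "\<forall>k\<in>UNIV. |H k| \<le>o |?Z|" using Hk by blast
    qed
    moreover have "|?Z| <o \<kappa>"
      using small by (intro card_of_Plus_ordLess_infinite_Field[OF infF co _ le]) (simp add: small_def)
    ultimately show ?thesis unfolding small_def using ordLeq_ordLess_trans by simp
  qed
  ultimately show ?thesis by blast
qed

section \<open>Type spaces\<close>

text \<open>
  \<open>DA\<close> is the algebra of \<open>A\<close>-definable sets and \<open>S\<close> the set of types with its topology \<open>X\<close>.
\<close>
locale type_space =
  fixes L :: "('s, 'f, 'r) language" and M :: "('s, 'f, 'r, 'm) struct" and s :: 's and A :: "'s \<Rightarrow> 'm set"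
  assumes struct: "is_struct L M"
begin

abbreviation "DA \<equiv> defsets L M s A"
abbreviation "S \<equiv> types L M s A"
abbreviation "X \<equiv> type_topology L M s A"

definition cl :: "'m set \<Rightarrow> 'm set set set" where "cl D = {p \<in> S. D \<in> p}"

lemma univ_DA: "univ M s \<in> DA" by (rule defsets_univ[OF struct])
lemma empty_DA: "{} \<in> DA" using defsets_compl[OF univ_DA] by simp

lemma types_D: "p \<in> S \<Longrightarrow> D \<in> p \<Longrightarrow> D \<in> DA" unfolding types_def by blast
lemma types_empty: "p \<in> S \<Longrightarrow> {} \<notin> p" unfolding types_def by blast
lemma types_Int: "p \<in> S \<Longrightarrow> D \<in> p \<Longrightarrow> E \<in> p \<Longrightarrow> D \<inter> E \<in> p" unfolding types_def by blast
lemma types_cases: "p \<in> S \<Longrightarrow> D \<in> DA \<Longrightarrow> D \<in> p \<or> univ M s - D \<in> p" unfolding types_def by blast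

lemma types_univ: "p \<in> S \<Longrightarrow> univ M s \<in> p"
  using types_cases[OF _ univ_DA, of p] types_empty[of p] by auto

lemma types_compl: assumes "p \<in> S" "D \<in> DA" shows "univ M s - D \<in> p \<longleftrightarrow> D \<notin> p"
proof
  assume a: "univ M s - D \<in> p"
  show "D \<notin> p"
  proof
    assume "D \<in> p"
    with a have "(univ M s - D) \<inter> D \<in> p" by (intro types_Int[OF assms(1)])
    moreover have "(univ M s - D) \<inter> D = {}" by blast
    ultimately have "{} \<in> p" by simp
    with types_empty[OF assms(1)] show False by contradiction
  qed
qed (use types_cases[OF assms] in blast)

lemma types_up: assumes "p \<in> S" "D \<in> p" "E \<in> DA" "D \<subseteq> E" shows "E \<in> p"
proof (rule ccontr)
  assume "E \<notin> p"
  then have "univ M s - E \<in> p" using types_cases[OF assms(1,3)] by blast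
  then have "D \<inter> (univ M s - E) \<in> p" by (rule types_Int[OF assms(1,2)])
  moreover have "D \<inter> (univ M s - E) = {}" using assms(4) by blast
  ultimately show False using types_empty[OF assms(1)] by simp
qed

lemma types_Un: assumes "p \<in> S" "D \<in> DA" "E \<in> DA" shows "D \<union> E \<in> p \<longleftrightarrow> D \<in> p \<or> E \<in> p"
proof
  assume DE: "D \<union> E \<in> p"
  show "D \<in> p \<or> E \<in> p"
  proof (rule ccontr)
    assume "\<not> ?thesis"
    then have "univ M s - D \<in> p" "univ M s - E \<in> p" using types_cases[OF assms(1)] assms(2,3) by blast+
    then have "(univ M s - D) \<inter> (univ M s - E) \<inter> (D \<union> E) \<in> p" by (intro types_Int[OF assms(1)] DE)
    moreover have "(univ M s - D) \<inter> (univ M s - E) \<inter> (D \<union> E) = {}" by blast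
    ultimately show False using types_empty[OF assms(1)] by simp
  qed
next
  have "D \<union> E \<in> DA" by (rule defsets_Un[OF assms(2,3)])
  then show "D \<in> p \<or> E \<in> p \<Longrightarrow> D \<union> E \<in> p" using types_up[OF assms(1)] by blast
qed

lemma topspace_X: "topspace X = S"
proof -
  have "topspace X = \<Union> {{p \<in> S. D \<in> p} |D. D \<in> DA}" unfolding type_topology_def by (rule topology_generated_by_topspace)
  also have "\<dots> = S" using types_univ univ_DA by blast
  finally show ?thesis .
qed

lemma cl_univ: "cl (univ M s) = S" unfolding cl_def using types_univ by blast
lemma cl_empty: "cl {} = {}" unfolding cl_def using types_empty by blast
lemma cl_Un: "D \<in> DA \<Longrightarrow> E \<in> DA \<Longrightarrow> cl (D \<union> E) = cl D \<union> cl E" unfolding cl_def using types_Un by blast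
lemma cl_compl: "D \<in> DA \<Longrightarrow> cl (univ M s - D) = S - cl D" unfolding cl_def using types_compl by blast
lemma cl_Int: "D \<in> DA \<Longrightarrow> E \<in> DA \<Longrightarrow> cl (D \<inter> E) = cl D \<inter> cl E"
  unfolding cl_def using types_Int types_up[of _ "D \<inter> E"] by blast

lemma openin_cl: "D \<in> DA \<Longrightarrow> openin X (cl D)"
  unfolding type_topology_def cl_def by (rule topology_generated_by_Basis) blast

lemma base: assumes "openin X U" "x \<in> U" shows "\<exists>D\<in>DA. x \<in> cl D \<and> cl D \<subseteq> U"
proof -
  have "generate_topology_on {{p \<in> S. D \<in> p} |D. D \<in> DA} U"
    using assms(1) unfolding type_topology_def by (rule openin_topology_generated_by)
  then show ?thesis
    using assms(2)
  proof (induction arbitrary: x rule: generate_topology_on.induct)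
    case Empty
    then show ?case by simp
  next
    case (Int a b)
    from Int.IH(1)[of x] Int.prems obtain D where D: "D \<in> DA" "x \<in> cl D" "cl D \<subseteq> a" by blast
    from Int.IH(2)[of x] Int.prems obtain E where E: "E \<in> DA" "x \<in> cl E" "cl E \<subseteq> b" by blast
    have "cl (D \<inter> E) = cl D \<inter> cl E" by (rule cl_Int[OF D(1) E(1)])
    then have "x \<in> cl (D \<inter> E)" "cl (D \<inter> E) \<subseteq> a \<inter> b" using D E by blast+
    moreover have "D \<inter> E \<in> DA" by (rule defsets_Int[OF D(1) E(1)])
    ultimately show ?case by blast
  next
    case (UN K)
    from UN.prems obtain k where k: "k \<in> K" "x \<in> k" by blast
    from UN.IH[OF k] obtain D where "D \<in> DA" "x \<in> cl D" "cl D \<subseteq> k" by blast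
    with k show ?case by blast
  next
    case (Basis b)
    then obtain D where "D \<in> DA" "b = cl D" unfolding cl_def by blast
    with Basis.prems show ?case by blast
  qed
qed

lemma Hausdorff_X: "Hausdorff_space X"
  unfolding Hausdorff_space_def topspace_X
proof (intro allI impI)
  fix p q assume pq: "p \<in> S \<and> q \<in> S \<and> p \<noteq> q"
  have "\<exists>D\<in>DA. D \<in> p \<and> D \<notin> q"
  proof (rule ccontr)
    assume no: "\<not> ?thesis"
    have "D \<in> p" if "D \<in> q" for D
    proof (rule ccontr)
      assume "D \<notin> p"
      have D: "D \<in> DA" using types_D that pq by blast
      then have "univ M s - D \<in> p" using \<open>D \<notin> p\<close> types_compl pq by blast
      then have "univ M s - D \<in> q" using no defsets_compl[OF D] by blast
      then show False using types_compl D pq that by blast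
    qed
    moreover have "D \<in> q" if "D \<in> p" for D using no that types_D pq by blast
    ultimately show False using pq by blast
  qed
  then obtain D where D: "D \<in> DA" "D \<in> p" "D \<notin> q" by blast
  have "openin X (cl D)" "openin X (cl (univ M s - D))" by (intro openin_cl D defsets_compl)+
  moreover have "p \<in> cl D" using D pq by (simp add: cl_def)
  moreover have "q \<in> cl (univ M s - D)" "disjnt (cl D) (cl (univ M s - D))"
    unfolding cl_compl[OF D(1)] using D pq by (auto simp: cl_def disjnt_def)
  ultimately show "\<exists>U V. openin X U \<and> openin X V \<and> p \<in> U \<and> q \<in> V \<and> disjnt U V" by blast
qed

definition tp :: "'m \<Rightarrow> 'm set set" where "tp d = {D \<in> DA. d \<in> D}"

lemma tp_types: assumes "d \<in> univ M s" shows "tp d \<in> S"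
  unfolding types_def tp_def using assms by (auto intro: defsets_Int defsets_compl)

lemma realizes_iff: assumes "q \<in> S" "realizes M s d q" "D \<in> DA" shows "d \<in> D \<longleftrightarrow> D \<in> q"
proof
  assume "d \<in> D"
  show "D \<in> q"
  proof (rule ccontr)
    assume "D \<notin> q"
    then have "univ M s - D \<in> q" using types_cases[OF assms(1,3)] by blast
    with assms(2) \<open>d \<in> D\<close> show False unfolding realizes_def by blast
  qed
qed (use assms(2) in \<open>simp add: realizes_def\<close>)

text \<open>
  An ultrafilter on the structure induces the type of its generic element; this is where types come from.
\<close>
lemma ultra_types:
  assumes U: "ultra U" and ev: "\<forall>\<^sub>F x in U. x \<in> univ M s"
  shows "{D \<in> DA. \<forall>\<^sub>F x in U. x \<in> D} \<in> S"
proof -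
  have Une: "U \<noteq> bot" using U by (simp add: ultra_def)
  have "(\<forall>\<^sub>F x in U. x \<in> D) \<or> (\<forall>\<^sub>F x in U. x \<in> univ M s - D)" for D
  proof -
    have "(\<forall>\<^sub>F x in U. x \<in> D) \<or> (\<forall>\<^sub>F x in U. x \<notin> D)" using U unfolding ultra_def by blast
    then show ?thesis
    proof
      assume "\<forall>\<^sub>F x in U. x \<notin> D"
      with ev have "\<forall>\<^sub>F x in U. x \<in> univ M s - D" by eventually_elim simp
      then show ?thesis ..
    qed simp
  qed
  then show ?thesis
    unfolding types_def using Une defsets_Int[of _ L M s A] defsets_compl[of _ L M s A]
    by (simp add: eventually_conj_iff)
qed

text \<open>
  By passing to basic sets, it is enough to see that finitely many of the definable sets \<open>\<D>\<close> cover the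
  structure.  Otherwise their complements generate a proper filter, and the type of a finer
  ultrafilter lies in no member of the cover.
\<close>
lemma compact_X: "compact_space X"
  unfolding compact_space_def compactin_def topspace_X
proof (intro conjI allI impI)
  show "S \<subseteq> S" ..
  fix \<U> assume \<U>: "(\<forall>U\<in>\<U>. openin X U) \<and> S \<subseteq> \<Union> \<U>"
  define \<D> where "\<D> = {D \<in> DA. \<exists>U\<in>\<U>. cl D \<subseteq> U}"
  have "\<exists>\<F>. finite \<F> \<and> \<F> \<subseteq> \<D> \<and> univ M s \<subseteq> \<Union> \<F>"
  proof (rule ccontr)
    assume no: "\<not> ?thesis"
    define \<F> where "\<F> = (INF D\<in>\<D>. principal (univ M s - D))"
    have "(INF D\<in>Y. principal (univ M s - D)) \<noteq> bot" if Y: "Y \<subseteq> \<D>" "finite Y" for Y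
    proof -
      from no Y have "\<not> univ M s \<subseteq> \<Union> Y" by blast
      then obtain x where "x \<in> univ M s" "x \<notin> \<Union> Y" by blast
      then have "x \<in> (\<Inter>D\<in>Y. univ M s - D)" by blast
      then have "(\<Inter>D\<in>Y. univ M s - D) \<noteq> {}" by blast
      then show ?thesis using INF_principal_finite[OF Y(2), of "\<lambda>D. univ M s - D"] by (simp add: principal_eq_bot_iff)
    qed
    then have "\<F> \<noteq> bot" unfolding \<F>_def by (rule INF_filter_not_bot)
    from ultra_exists[OF this] obtain V where V: "ultra V" "V \<le> \<F>" by blast
    have ev: "\<forall>\<^sub>F x in V. x \<in> univ M s - D" if "D \<in> \<D>" for D
    proof -
      have "V \<le> principal (univ M s - D)" using V(2) INF_lower[OF that] unfolding \<F>_def by (rule order_trans)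
      then show ?thesis by (simp add: le_principal)
    qed
    have "S \<noteq> {}" using tp_types struct unfolding is_struct_def by blast
    then obtain U0 where "U0 \<in> \<U>" using \<U> by blast
    then have "{} \<in> \<D>" unfolding \<D>_def using empty_DA cl_empty by blast
    from ev[OF this] have "\<forall>\<^sub>F x in V. x \<in> univ M s" by simp
    from ultra_types[OF V(1) this] have p: "{D \<in> DA. \<forall>\<^sub>F x in V. x \<in> D} \<in> S" (is "?p \<in> S") .
    then obtain U where U: "U \<in> \<U>" "?p \<in> U" using \<U> by blast
    have "openin X U" using \<U> U(1) by blast
    from base[OF this U(2)] obtain D where D: "D \<in> DA" "?p \<in> cl D" "cl D \<subseteq> U" by blast
    then have "D \<in> \<D>" unfolding \<D>_def using U(1) by blast
    from ev[OF this] have 1: "\<forall>\<^sub>F x in V. x \<in> univ M s - D" .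
    from D(2) have 2: "\<forall>\<^sub>F x in V. x \<in> D" by (simp add: cl_def)
    from 1 2 have "\<forall>\<^sub>F x in V. False" by eventually_elim simp
    with V(1) show False by (simp add: ultra_def trivial_limit_def)
  qed
  then obtain \<F> where \<F>: "finite \<F>" "\<F> \<subseteq> \<D>" "univ M s \<subseteq> \<Union> \<F>" by blast
  have "\<forall>D\<in>\<F>. \<exists>U. U \<in> \<U> \<and> cl D \<subseteq> U" using \<F>(2) unfolding \<D>_def by blast
  from bchoice[OF this] obtain u where u: "\<And>D. D \<in> \<F> \<Longrightarrow> u D \<in> \<U>" "\<And>D. D \<in> \<F> \<Longrightarrow> cl D \<subseteq> u D" by blast
  have Un: "\<Union> \<G> \<in> DA \<and> (\<forall>p\<in>S. \<Union> \<G> \<in> p \<longrightarrow> (\<exists>D\<in>\<G>. D \<in> p))" if "finite \<G>" "\<G> \<subseteq> DA" for \<G>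
    using that
  proof (induction rule: finite_induct)
    case empty
    show ?case using empty_DA types_empty by simp
  next
    case (insert D \<G>)
    then have IH: "\<Union> \<G> \<in> DA" "\<forall>p\<in>S. \<Union> \<G> \<in> p \<longrightarrow> (\<exists>D\<in>\<G>. D \<in> p)" and D: "D \<in> DA" by blast+
    have "D \<union> \<Union> \<G> \<in> DA" by (rule defsets_Un[OF D IH(1)])
    moreover have "\<exists>E\<in>insert D \<G>. E \<in> p" if "p \<in> S" "D \<union> \<Union> \<G> \<in> p" for p
      using types_Un[OF that(1) D IH(1)] that IH(2) by blast
    ultimately show ?case by simp
  qed
  have F_DA: "\<F> \<subseteq> DA" using \<F>(2) unfolding \<D>_def by blast
  have "S \<subseteq> \<Union> (u ` \<F>)"
  proof
    fix p assume p: "p \<in> S"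
    have "\<Union> \<F> \<in> p" using types_up[OF p types_univ[OF p] _ \<F>(3)] Un[OF \<F>(1) F_DA] by blast
    then obtain D where D: "D \<in> \<F>" "D \<in> p" using Un[OF \<F>(1) F_DA] p by blast
    then have "p \<in> cl D" using p by (simp add: cl_def)
    then show "p \<in> \<Union> (u ` \<F>)" using u(2)[OF D(1)] D(1) by blast
  qed
  moreover have "finite (u ` \<F>)" "u ` \<F> \<subseteq> \<U>" using \<F>(1) u(1) by auto
  ultimately show "\<exists>\<F>. finite \<F> \<and> \<F> \<subseteq> \<U> \<and> S \<subseteq> \<Union> \<F>" by blast
qed

lemma cl_inj: assumes "D \<in> DA" "E \<in> DA" "cl D = cl E" shows "D = E"
proof -
  have "d \<in> D \<longleftrightarrow> d \<in> E" if "d \<in> univ M s" for d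
  proof -
    have "tp d \<in> cl D \<longleftrightarrow> tp d \<in> cl E" using assms(3) by simp
    then show ?thesis using assms(1,2) tp_types[OF that] by (simp add: cl_def tp_def)
  qed
  then show ?thesis using defsets_sub[OF assms(1)] defsets_sub[OF assms(2)] by blast
qed

lemma keisler_content:
  assumes \<mu>: "\<mu> \<in> keisler L M s A"
  shows "boolean_content X (cl ` DA) (\<lambda>C. \<mu> (inv_into DA cl C))"
proof -
  have inv: "inv_into DA cl (cl D) = D" if "D \<in> DA" for D
    by (rule inv_into_f_f[OF inj_onI that]) (rule cl_inj)
  show ?thesis
  proof
    show "compact_space X" by (rule compact_X)
    show "Hausdorff_space X" by (rule Hausdorff_X)
    show "openin X C" if "C \<in> cl ` DA" for C using that openin_cl by blast
    show "topspace X - C \<in> cl ` DA" if C: "C \<in> cl ` DA" for C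
    proof -
      from C obtain D where D: "D \<in> DA" "C = cl D" by blast
      then have "topspace X - C = cl (univ M s - D)" by (simp add: topspace_X cl_compl)
      then show ?thesis using defsets_compl[OF D(1)] by blast
    qed
    show "C \<union> C' \<in> cl ` DA" if C: "C \<in> cl ` DA" "C' \<in> cl ` DA" for C C'
    proof -
      from C obtain D E where D: "D \<in> DA" "C = cl D" "E \<in> DA" "C' = cl E" by blast
      then have "C \<union> C' = cl (D \<union> E)" by (simp add: cl_Un)
      then show ?thesis using defsets_Un[OF D(1,3)] by blast
    qed
    show "{} \<in> cl ` DA" using empty_DA cl_empty by blast
    show "\<exists>C\<in>cl ` DA. x \<in> C \<and> C \<subseteq> U" if "openin X U" "x \<in> U" for U x using base[OF that] by blast
    show "0 \<le> \<mu> (inv_into DA cl C)" if "C \<in> cl ` DA" for C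
      using that \<mu> inv by (auto simp: keisler_def)
    show "\<mu> (inv_into DA cl (topspace X)) = 1"
      using \<mu> inv[OF univ_DA] by (simp add: topspace_X cl_univ keisler_def)
    fix C C' assume C: "C \<in> cl ` DA" "C' \<in> cl ` DA" "C \<inter> C' = {}"
    from C obtain D E where D: "D \<in> DA" "C = cl D" "E \<in> DA" "C' = cl E" by blast
    have "cl (D \<inter> E) = cl {}" using C(3) D by (simp add: cl_Int cl_empty)
    then have "D \<inter> E = {}" using cl_inj[OF defsets_Int[OF D(1,3)] empty_DA] by blast
    then have "\<mu> (D \<union> E) = \<mu> D + \<mu> E" using \<mu> D by (simp add: keisler_def)
    moreover have "C \<union> C' = cl (D \<union> E)" using D by (simp add: cl_Un)
    ultimately show "\<mu> (inv_into DA cl (C \<union> C')) = \<mu> (inv_into DA cl C) + \<mu> (inv_into DA cl C')"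
      using D inv defsets_Un[OF D(1,3)] by simp
  qed
qed

lemma type_measure_unique:
  assumes P: "regular_Borel_prob X P" "\<And>D. D \<in> DA \<Longrightarrow> measure P (cl D) = \<mu> D"
    and Q: "regular_Borel_prob X Q" "\<And>D. D \<in> DA \<Longrightarrow> measure Q (cl D) = \<mu> D"
  shows "P = Q"
proof (rule regular_Borel_prob_eqI[OF P(1) Q(1) Hausdorff_X, of "cl ` DA"])
  show "C \<union> C' \<in> cl ` DA" if C: "C \<in> cl ` DA" "C' \<in> cl ` DA" for C C'
  proof -
    from C obtain D E where D: "D \<in> DA" "C = cl D" "E \<in> DA" "C' = cl E" by blast
    then have "C \<union> C' = cl (D \<union> E)" by (simp add: cl_Un)
    then show ?thesis using defsets_Un[OF D(1,3)] by blast
  qed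
  show "{} \<in> cl ` DA" using empty_DA cl_empty by blast
  show "openin X C" if "C \<in> cl ` DA" for C using that openin_cl by blast
  show "\<exists>C\<in>cl ` DA. x \<in> C \<and> C \<subseteq> U" if "openin X U" "x \<in> U" for U x using base[OF that] by blast
  show "measure P C = measure Q C" if "C \<in> cl ` DA" for C using that P(2) Q(2) by auto
qed

lemma type_measure_ex1:
  assumes \<mu>: "\<mu> \<in> keisler L M s A"
  shows "\<exists>!P. regular_Borel_prob X P \<and> (\<forall>D\<in>DA. measure P (cl D) = \<mu> D)"
proof -
  interpret boolean_content X "cl ` DA" "\<lambda>C. \<mu> (inv_into DA cl C)" by (rule keisler_content[OF \<mu>])
  have inv: "inv_into DA cl (cl D) = D" if "D \<in> DA" for D
    by (rule inv_into_f_f[OF inj_onI that]) (rule cl_inj)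
  have R: "\<forall>D\<in>DA. measure radon (cl D) = \<mu> D"
  proof
    fix D assume D: "D \<in> DA"
    then have "measure radon (cl D) = \<mu> (inv_into DA cl (cl D))" by (intro measure_radon imageI)
    then show "measure radon (cl D) = \<mu> D" unfolding inv[OF D] .
  qed
  show ?thesis
  proof (rule ex1I[of _ radon])
    show "regular_Borel_prob X radon \<and> (\<forall>D\<in>DA. measure radon (cl D) = \<mu> D)"
      using regular_radon R ..
    fix P assume P: "regular_Borel_prob X P \<and> (\<forall>D\<in>DA. measure P (cl D) = \<mu> D)"
    show "P = radon"
      by (rule type_measure_unique[OF conjunct1[OF P] bspec[OF conjunct2[OF P]] regular_radon bspec[OF R]])
  qed
qed

lemma type_measure:
  assumes \<mu>: "\<mu> \<in> keisler L M s A"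
  shows "regular_Borel_prob X (type_measure L M s A \<mu>)"
    and "D \<in> DA \<Longrightarrow> measure (type_measure L M s A \<mu>) (cl D) = \<mu> D"
proof -
  have "type_measure L M s A \<mu> = (THE P. regular_Borel_prob X P \<and> (\<forall>D\<in>DA. measure P (cl D) = \<mu> D))"
    unfolding type_measure_def cl_def ..
  then have *: "regular_Borel_prob X (type_measure L M s A \<mu>) \<and> (\<forall>D\<in>DA. measure (type_measure L M s A \<mu>) (cl D) = \<mu> D)"
    using theI'[OF type_measure_ex1[OF \<mu>]] by simp
  from * show "regular_Borel_prob X (type_measure L M s A \<mu>)" by (rule conjunct1)
  from * show "D \<in> DA \<Longrightarrow> measure (type_measure L M s A \<mu>) (cl D) = \<mu> D" by simp
qed

text \<open>
  The complement of the support is a union of clopen null sets.  Such a union may be uncountable, but each compact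
  subset lies in a finite subunion, and inner regularity applies.
\<close>
lemma support_null:
  assumes \<mu>: "\<mu> \<in> keisler L M s A"
  shows "support L M s A \<mu> \<in> sets (type_measure L M s A \<mu>)"
    and "AE p in type_measure L M s A \<mu>. p \<in> support L M s A \<mu>"
proof -
  let ?P = "type_measure L M s A \<mu>" and ?Z = "support L M s A \<mu>"
  have P: "regular_Borel_prob X ?P" by (rule type_measure(1)[OF \<mu>])
  interpret prob_space ?P using P by (rule regular_Borel_probD)
  have \<mu>0: "0 \<le> \<mu> D" if "D \<in> DA" for D using \<mu> that by (simp add: keisler_def)
  have Z: "S - ?Z = \<Union> {cl D | D. D \<in> DA \<and> \<mu> D = 0}" (is "_ = \<Union> ?N")
  proof (intro equalityI subsetI)
    fix p assume "p \<in> S - ?Z"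
    then have pS: "p \<in> S" "\<exists>D\<in>p. \<not> \<mu> D > 0" by (simp_all add: support_def)
    then obtain D where D: "p \<in> S" "D \<in> p" "\<not> \<mu> D > 0" by blast
    then have "D \<in> DA" using types_D by blast
    then have "\<mu> D = 0" using \<mu>0[OF \<open>D \<in> DA\<close>] D(3) by simp
    with D \<open>D \<in> DA\<close> show "p \<in> \<Union> ?N" unfolding cl_def by blast
  next
    fix p assume "p \<in> \<Union> ?N"
    then obtain D where D: "D \<in> DA" "\<mu> D = 0" "p \<in> cl D" by blast
    then have "\<not> 0 < \<mu> D" "p \<in> S" "D \<in> p" by (simp_all add: cl_def)
    then show "p \<in> S - ?Z" unfolding support_def by blast
  qed
  have Nop: "openin X U" if "U \<in> ?N" for U using that openin_cl by auto
  have op: "openin X (S - ?Z)" unfolding Z by (rule openin_Union) (rule Nop)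
  have ZS: "?Z \<subseteq> S" unfolding support_def by blast
  have "closedin X ?Z" using op ZS by (simp add: closedin_def topspace_X)
  then show Zm: "?Z \<in> sets ?P" using closedin_borel[of X ?Z] regular_Borel_probD(2)[OF P] by simp
  have Um: "S - ?Z \<in> sets ?P" using openin_borel[OF op] regular_Borel_probD(2)[OF P] by simp
  have "emeasure ?P (S - ?Z) = (SUP K\<in>{K. compactin X K \<and> K \<subseteq> S - ?Z}. emeasure ?P K)"
    using P Um by (simp add: regular_Borel_prob_def)
  also have "\<dots> \<le> 0"
  proof (rule SUP_least)
    fix K assume "K \<in> {K. compactin X K \<and> K \<subseteq> S - ?Z}"
    then have K: "compactin X K" "K \<subseteq> \<Union> ?N" using Z by blast+
    from K(1) have "\<exists>\<F>. finite \<F> \<and> \<F> \<subseteq> ?N \<and> K \<subseteq> \<Union> \<F>"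
      unfolding compactin_def using Nop K(2) by blast
    then obtain \<F> where \<F>: "finite \<F>" "\<F> \<subseteq> ?N" "K \<subseteq> \<Union> \<F>" by blast
    have F0: "emeasure ?P C = 0 \<and> C \<in> sets ?P" if "C \<in> \<F>" for C
    proof -
      from that \<F>(2) obtain D where D: "D \<in> DA" "\<mu> D = 0" "C = cl D" by blast
      then have "measure ?P C = 0" using type_measure(2)[OF \<mu> D(1)] by (simp only:)
      moreover have "C \<in> sets ?P" using D openin_borel[OF openin_cl] regular_Borel_probD(2)[OF P] by simp
      ultimately show ?thesis by (simp add: emeasure_eq_measure)
    qed
    have "\<Union> \<F> \<in> sets ?P" using \<F>(1) F0 by blast
    with \<F>(3) have "emeasure ?P K \<le> emeasure ?P (\<Union> \<F>)" by (rule emeasure_mono)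
    also have "\<dots> \<le> (\<Sum>C\<in>\<F>. emeasure ?P C)"
      using emeasure_subadditive_finite[OF \<F>(1), of "\<lambda>C. C" ?P] F0 by auto
    also have "\<dots> = 0" using F0 by simp
    finally show "emeasure ?P K \<le> 0" .
  qed
  finally have "S - ?Z \<in> null_sets ?P" using Um by (simp add: null_sets_def)
  moreover have "{p \<in> space ?P. p \<notin> ?Z} \<subseteq> S - ?Z" by (auto simp: regular_Borel_probD(3)[OF P] topspace_X)
  ultimately show "AE p in ?P. p \<in> ?Z" by (intro AE_I'[of "S - ?Z"])
qed

end

lemma keisler_restrict:
  assumes \<nu>: "\<nu> \<in> keisler L M s B" and AB: "\<And>t. A t \<subseteq> B t" and st: "is_struct L M"
  shows "restrict \<nu> (defsets L M s A) \<in> keisler L M s A"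
proof -
  have sub: "defsets L M s A \<subseteq> defsets L M s B" by (rule defsets_mono[OF AB])
  have u: "univ M s \<in> defsets L M s A" by (rule defsets_univ[OF st])
  have "\<nu> (D \<union> E) = \<nu> D + \<nu> E" if "D \<in> defsets L M s A" "E \<in> defsets L M s A" "D \<inter> E = {}" for D E
    using \<nu> sub that unfolding keisler_def by blast
  moreover have "0 \<le> \<nu> D" if "D \<in> defsets L M s A" for D using \<nu> sub that unfolding keisler_def by blast
  moreover have "\<nu> (univ M s) = 1" using \<nu> by (simp add: keisler_def)
  ultimately show ?thesis using u defsets_Un[of _ L M s A] by (simp add: keisler_def)
qed

text \<open>
  The restriction \<open>r\<close> of types to a smaller set of parameters.
\<close>
locale type_restriction = A: type_space L M s A + B: type_space L M s B
  for L :: "('s, 'f, 'r) language" and M :: "('s, 'f, 'r, 'm) struct" and s :: 's and A B :: "'s \<Rightarrow> 'm set" +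
  assumes AB: "\<And>t. A t \<subseteq> B t"
begin

definition r :: "'m set set \<Rightarrow> 'm set set" where "r p = p \<inter> A.DA"

lemma DA_sub: "A.DA \<subseteq> B.DA" by (rule defsets_mono[OF AB])

lemma r_types: assumes p: "p \<in> B.S" shows "r p \<in> A.S"
proof -
  have "D \<inter> E \<in> r p" if "D \<in> r p" "E \<in> r p" for D E
    using that B.types_Int[OF p] defsets_Int[of D L M s A E] by (simp add: r_def)
  moreover have "D \<in> r p \<or> univ M s - D \<in> r p" if D: "D \<in> A.DA" for D
    using B.types_cases[OF p subsetD[OF DA_sub D]] D defsets_compl[OF D] by (auto simp: r_def)
  moreover have "r p \<subseteq> A.DA" "{} \<notin> r p" using B.types_empty[OF p] by (auto simp: r_def)
  ultimately show ?thesis unfolding types_def by blast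
qed

lemma realizes_r: "realizes M s d p \<Longrightarrow> realizes M s d (r p)"
  by (simp add: realizes_def r_def)

lemma r_cl: assumes "D \<in> A.DA" shows "{p \<in> B.S. r p \<in> A.cl D} = B.cl D"
  using assms r_types by (auto simp: A.cl_def B.cl_def r_def)

lemma continuous_r: "continuous_map B.X A.X r"
  unfolding continuous_map_alt
proof (intro conjI allI impI)
  show "r \<in> topspace B.X \<rightarrow> topspace A.X" using r_types by (simp add: A.topspace_X B.topspace_X)
  fix U assume U: "openin A.X U"
  have "r -` U \<inter> topspace B.X = \<Union> {B.cl D | D. D \<in> A.DA \<and> A.cl D \<subseteq> U}" (is "_ = \<Union> ?N")
  proof (intro equalityI subsetI)
    fix p assume "p \<in> r -` U \<inter> topspace B.X"
    then have p: "p \<in> B.S" "r p \<in> U" by (simp_all add: B.topspace_X)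
    from A.base[OF U p(2)] obtain D where D: "D \<in> A.DA" "r p \<in> A.cl D" "A.cl D \<subseteq> U" by blast
    then have "p \<in> B.cl D" using r_cl[OF D(1)] p(1) by blast
    with D show "p \<in> \<Union> ?N" by blast
  next
    fix p assume "p \<in> \<Union> ?N"
    then obtain D where D: "D \<in> A.DA" "A.cl D \<subseteq> U" "p \<in> B.cl D" by blast
    have "p \<in> {p \<in> B.S. r p \<in> A.cl D}" using D(3) unfolding r_cl[OF D(1)] .
    then show "p \<in> r -` U \<inter> topspace B.X" using D(2) by (auto simp: B.topspace_X)
  qed
  moreover have "openin B.X V" if "V \<in> ?N" for V
  proof -
    from that obtain D where "D \<in> A.DA" "V = B.cl D" by blast
    then show ?thesis using B.openin_cl DA_sub by blast
  qed
  then have "openin B.X (\<Union> ?N)" by (rule openin_Union)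
  ultimately show "openin B.X (r -` U \<inter> topspace B.X)" by simp
qed

text \<open>
  The image measure is regular and has the right values on clopen sets.
\<close>
lemma type_measure_restrict:
  assumes \<nu>: "\<nu> \<in> keisler L M s B"
  shows "type_measure L M s A (restrict \<nu> A.DA) = distr (type_measure L M s B \<nu>) (borel_of_top A.X) r"
proof (rule A.type_measure_unique)
  let ?P = "type_measure L M s B \<nu>"
  have rest: "restrict \<nu> A.DA \<in> keisler L M s A" by (rule keisler_restrict[OF \<nu> AB A.struct])
  show "regular_Borel_prob A.X (type_measure L M s A (restrict \<nu> A.DA))" by (rule A.type_measure(1)[OF rest])
  show "measure (type_measure L M s A (restrict \<nu> A.DA)) (A.cl D) = restrict \<nu> A.DA D" if "D \<in> A.DA" for D
    by (rule A.type_measure(2)[OF rest that])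
  have P: "regular_Borel_prob B.X ?P" by (rule B.type_measure(1)[OF \<nu>])
  show "regular_Borel_prob A.X (distr ?P (borel_of_top A.X) r)"
    by (rule regular_Borel_prob_distr[OF P continuous_r B.Hausdorff_X A.Hausdorff_X])
  fix D assume D: "D \<in> A.DA"
  have rm: "r \<in> measurable ?P (borel_of_top A.X)"
    using continuous_map_borel[OF continuous_r] by (simp add: measurable_cong_sets[OF regular_Borel_probD(2)[OF P] refl])
  have "measure (distr ?P (borel_of_top A.X) r) (A.cl D) = measure ?P (r -` A.cl D \<inter> space ?P)"
    by (rule measure_distr[OF rm openin_borel[OF A.openin_cl[OF D]]])
  also have "r -` A.cl D \<inter> space ?P = B.cl D"
    unfolding r_cl[OF D, symmetric] by (auto simp: regular_Borel_probD(3)[OF P] B.topspace_X)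
  also have "measure ?P (B.cl D) = \<nu> D" by (rule B.type_measure(2)[OF \<nu> subsetD[OF DA_sub D]])
  finally show "measure (distr ?P (borel_of_top A.X) r) (A.cl D) = restrict \<nu> A.DA D" using D by simp
qed

lemma r_support:
  assumes p: "p \<in> support L M s B \<nu>"
  shows "r p \<in> support L M s A (restrict \<nu> A.DA)"
proof -
  have "p \<in> B.S" "\<And>D. D \<in> p \<Longrightarrow> 0 < \<nu> D" using p by (simp_all add: support_def)
  then show ?thesis using r_types by (simp add: support_def) (simp add: r_def)
qed

end

section \<open>Measures finitely satisfiable in the small model\<close>

text \<open>
  In what follows, \<open>DM\<close> is the algebra of definable sets, \<open>FS\<close> the set of measures finitely satisfiable in \<open>G\<close>,
  \<open>CH\<close> the convex hull of the point masses, and \<open>lsh\<close>, \<open>rsh\<close> are the left and right shifts of definable sets.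
\<close>
locale monster_group =
  fixes L :: "('s, 'f, 'r) language" and T :: "('s, 'f, 'r) fm set" and \<kappa> :: "'k rel"
    and M G :: "('s, 'f, 'r, 'm) struct" and s :: 's and m :: 'f
  assumes grp: "expands_group L T s m TYPE('m)"
    and NIP: "NIP_theory L T TYPE('m)"
    and mod: "models L T M"
    and mon: "monster L \<kappa> M"
    and subG: "elem_sub L G M"
    and smallG: "small \<kappa> (univ G)"
begin

abbreviation "DM \<equiv> defsets L M s (univ M)"
abbreviation "FS \<equiv> keisler_fs L M G s"
abbreviation "CH \<equiv> conv_hull L M G s"
abbreviation "mu \<equiv> mul M m"
abbreviation "lsh \<equiv> lshift M s m"
abbreviation "rsh \<equiv> rshift M s m"

lemma struct: "is_struct L M" using mon by (simp add: monster_def)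
lemma ar: "fun_arity L m = Some ([s, s], s)" using grp by (simp add: expands_group_def)

lemma group_M: "\<exists>e. group \<lparr>carrier = univ M s, monoid.mult = mu, one = e\<rparr>"
  using grp mod unfolding expands_group_def by blast

lemma mu_closed: assumes "a \<in> univ M s" "b \<in> univ M s" shows "mu a b \<in> univ M s"
proof -
  obtain e where "group \<lparr>carrier = univ M s, monoid.mult = mu, one = e\<rparr>" using group_M ..
  then interpret group "\<lparr>carrier = univ M s, monoid.mult = mu, one = e\<rparr>" .
  show ?thesis using m_closed assms by simp
qed

lemma mu_assoc: assumes "a \<in> univ M s" "b \<in> univ M s" "c \<in> univ M s" shows "mu (mu a b) c = mu a (mu b c)"
proof -
  obtain e where "group \<lparr>carrier = univ M s, monoid.mult = mu, one = e\<rparr>" using group_M ..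
  then interpret group "\<lparr>carrier = univ M s, monoid.mult = mu, one = e\<rparr>" .
  show ?thesis using m_assoc assms by simp
qed

lemma mu_cancel: assumes g: "g \<in> univ M s" shows "\<exists>h\<in>univ M s. \<forall>a\<in>univ M s. mu (mu a g) h = a"
proof -
  obtain e where "group \<lparr>carrier = univ M s, monoid.mult = mu, one = e\<rparr>" using group_M ..
  then interpret group "\<lparr>carrier = univ M s, monoid.mult = mu, one = e\<rparr>" .
  let ?H = "\<lparr>carrier = univ M s, monoid.mult = mu, one = e\<rparr>"
  have "mu (mu a g) (inv\<^bsub>?H\<^esub> g) = a" if "a \<in> univ M s" for a
    using m_assoc[of a g "inv\<^bsub>?H\<^esub> g"] r_inv[of g] r_one[of a] that g inv_closed[of g] by simp
  then show ?thesis using inv_closed[of g] g by auto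
qed

lemma univ_G: "univ G t \<subseteq> univ M t" using subG by (simp add: elem_sub_def)
lemma G_in: "g \<in> univ G s \<Longrightarrow> g \<in> univ M s" using univ_G by blast

lemma G_nonempty: "univ G s \<noteq> {}" using subG by (simp add: elem_sub_def is_struct_def)

text \<open>
  The graph of the multiplication is definable, so \<open>G\<close> and \<open>M\<close> have the same products of elements of \<open>G\<close>.
\<close>
lemma mu_G: assumes a: "a \<in> univ G s" and b: "b \<in> univ G s" shows "mu a b \<in> univ G s"
proof -
  have stG: "is_struct L G" using subG by (simp add: elem_sub_def)
  have c: "fun_int G m [a, b] \<in> univ G s" 
  proof -
    have "list_all2 (\<lambda>a s'. a \<in> univ G s') [a, b] [s, s]" using a b by simp
    then show ?thesis using stG ar unfolding is_struct_def by blast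
  qed
  obtain e0 where e0: "valid_env G e0" using valid_env_exists[OF stG] ..
  define e where "e = env_upd (env_upd (env_upd e0 s 0 a) s 1 b) s 2 (fun_int G m [a, b])"
  have e: "valid_env G e" unfolding e_def using e0 a b c by (intro valid_env_upd)
  have "has_sort L (Fun m [Var s 0, Var s 1]) s"
    by (rule has_sort.intros(2)[OF ar]) (simp add: has_sort.intros(1))
  then have wf: "wf_fm L (Eq (Var s 2) (Fun m [Var s 0, Var s 1]))"
    by (simp, blast intro: has_sort.intros(1))
  have "sat G e (Eq (Var s 2) (Fun m [Var s 0, Var s 1]))" by (simp add: e_def env_upd_def)
  then have "sat M e (Eq (Var s 2) (Fun m [Var s 0, Var s 1]))"
    using subG wf e unfolding elem_sub_def by blast
  then show ?thesis using c by (simp add: e_def env_upd_def mul_def)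
qed

lemma rshift_DM: assumes "D \<in> DM" "d \<in> univ M s" shows "rsh d D \<in> DM"
  by (rule defsets_rshift(1)[OF ar mu_closed assms(1,2,2)])

lemma lshift_DM: assumes "D \<in> DM" "d \<in> univ M s" shows "lsh d D \<in> DM"
  by (rule defsets_rshift(2)[OF ar mu_closed assms(1,2,2)])

lemma FS_keisler: "\<mu> \<in> FS \<Longrightarrow> \<mu> \<in> keisler L M s (univ M)" by (simp add: keisler_fs_def)
lemma FS_ext: "\<mu> \<in> FS \<Longrightarrow> \<mu> \<in> extensional DM" by (simp add: keisler_fs_def keisler_def)
lemma FS_nonneg: "\<mu> \<in> FS \<Longrightarrow> D \<in> DM \<Longrightarrow> 0 \<le> \<mu> D" by (simp add: keisler_fs_def keisler_def)
lemma FS_univ: "\<mu> \<in> FS \<Longrightarrow> \<mu> (univ M s) = 1" by (simp add: keisler_fs_def keisler_def)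
lemma FS_add: "\<mu> \<in> FS \<Longrightarrow> D \<in> DM \<Longrightarrow> E \<in> DM \<Longrightarrow> D \<inter> E = {} \<Longrightarrow> \<mu> (D \<union> E) = \<mu> D + \<mu> E"
  by (simp add: keisler_fs_def keisler_def)
lemma FS_fs: "\<mu> \<in> FS \<Longrightarrow> D \<in> DM \<Longrightarrow> \<mu> D > 0 \<Longrightarrow> \<exists>a\<in>univ G s. a \<in> D" by (simp add: keisler_fs_def)

lemma univ_DM: "univ M s \<in> DM" by (rule defsets_univ[OF struct])
lemma empty_DM: "{} \<in> DM" using defsets_compl[OF univ_DM] by simp

lemma FS_le_1: assumes "\<mu> \<in> FS" "D \<in> DM" shows "\<mu> D \<le> 1"
proof -
  have "\<mu> (D \<union> (univ M s - D)) = \<mu> D + \<mu> (univ M s - D)"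
    by (rule FS_add[OF assms defsets_compl[OF assms(2)]]) blast
  moreover have "D \<union> (univ M s - D) = univ M s" using defsets_sub[OF assms(2)] by blast
  ultimately show ?thesis using FS_univ[OF assms(1)] FS_nonneg[OF assms(1) defsets_compl[OF assms(2)]] by simp
qed

lemma FS_empty: "\<mu> \<in> FS \<Longrightarrow> \<mu> {} = 0" using FS_add[OF _ empty_DM empty_DM] by simp

lemma conv_rep_eval:
  assumes "conv_rep L M G s k n r g" "D \<in> DM"
  shows "k D = (\<Sum>i<n. r i * of_bool (g i \<in> D))"
  using assms by (simp add: conv_rep_def dirac_def indicator_def of_bool_def)

lemma conv_rep_FS:
  assumes rep: "conv_rep L M G s k n r g"
  shows "k \<in> FS"
proof -
  note ev = conv_rep_eval[OF rep]
  have r: "\<And>i. i < n \<Longrightarrow> 0 \<le> r i" "\<And>i. i < n \<Longrightarrow> g i \<in> univ G s" "(\<Sum>i<n. r i) = 1"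
    using rep by (auto simp: conv_rep_def)
  have "k \<in> extensional DM" using rep by (simp add: conv_rep_def)
  moreover have "0 \<le> k D" if "D \<in> DM" for D unfolding ev[OF that] using r by (intro sum_nonneg) simp
  moreover have "k (univ M s) = 1"
  proof -
    have "k (univ M s) = (\<Sum>i<n. r i)" unfolding ev[OF univ_DM] by (rule sum.cong) (use r(2) G_in in auto)
    then show ?thesis using r(3) by simp
  qed
  moreover have "k (D \<union> E) = k D + k E" if D: "D \<in> DM" "E \<in> DM" "D \<inter> E = {}" for D E
  proof -
    have "r i * of_bool (g i \<in> D \<union> E) = r i * of_bool (g i \<in> D) + r i * of_bool (g i \<in> E)" for i
      using D(3) by auto
    then show ?thesis unfolding ev[OF D(1)] ev[OF D(2)] ev[OF defsets_Un[OF D(1,2)]] by (simp only: sum.distrib)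
  qed
  moreover have "\<exists>a\<in>univ G s. a \<in> D" if "D \<in> DM" "k D > 0" for D
  proof (rule ccontr)
    assume "\<not> ?thesis"
    then have "k D = 0" unfolding ev[OF that(1)] using r(2) by (intro sum.neutral) auto
    with that(2) show False by simp
  qed
  ultimately show ?thesis by (simp add: keisler_fs_def keisler_def)
qed

lemma CH_FS: "CH \<subseteq> FS" using conv_rep_FS unfolding conv_hull_def by blast

lemma dirac_CH: assumes "g \<in> univ G s" shows "dirac L M s g \<in> CH"
proof -
  have "conv_rep L M G s (dirac L M s g) 1 (\<lambda>_. 1) (\<lambda>_. g)"
    using assms by (simp add: conv_rep_def dirac_def restrict_def fun_eq_iff)
  then show ?thesis unfolding conv_hull_def by blast
qed

lemma FS_sum:
  assumes \<mu>: "\<mu> \<in> FS" and "finite \<P>" "\<P> \<subseteq> DM" "disjoint \<P>"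
  shows "\<Union> \<P> \<in> DM \<and> \<mu> (\<Union> \<P>) = (\<Sum>P\<in>\<P>. \<mu> P)"
  using assms(2-)
proof (induction rule: finite_induct)
  case empty
  show ?case using empty_DM FS_empty[OF \<mu>] by simp
next
  case (insert P \<P>)
  then have IH: "\<Union> \<P> \<in> DM" "\<mu> (\<Union> \<P>) = (\<Sum>P\<in>\<P>. \<mu> P)" and P: "P \<in> DM" by (auto simp: pairwise_insert)
  have "P \<inter> Q = {}" if "Q \<in> \<P>" for Q
    using insert.prems(2) insert.hyps(2) that by (auto simp: disjoint_def)
  then have "P \<inter> \<Union> \<P> = {}" by blast
  then have "\<mu> (P \<union> \<Union> \<P>) = \<mu> P + \<mu> (\<Union> \<P>)" by (rule FS_add[OF \<mu> P IH(1)])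
  then show ?case using IH defsets_Un[OF P IH(1)] insert.hyps by simp
qed

lemma partition_exists:
  assumes "finite \<D>" "\<D> \<subseteq> DM"
  shows "\<exists>\<P>. finite \<P> \<and> \<P> \<subseteq> DM \<and> disjoint \<P> \<and> \<Union> \<P> = univ M s \<and> (\<forall>D\<in>\<D>. \<forall>P\<in>\<P>. P \<subseteq> D \<or> P \<inter> D = {})"
  using assms
proof (induction rule: finite_induct)
  case empty
  show ?case by (rule exI[of _ "{univ M s}"]) (simp add: univ_DM disjoint_def)
next
  case (insert E \<D>)
  then obtain \<P> where P: "finite \<P>" "\<P> \<subseteq> DM" "disjoint \<P>" "\<Union> \<P> = univ M s"
    "\<forall>D\<in>\<D>. \<forall>P\<in>\<P>. P \<subseteq> D \<or> P \<inter> D = {}" by auto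
  have E: "E \<in> DM" using insert.prems by blast
  define \<Q> where "\<Q> = (\<lambda>P. P \<inter> E) ` \<P> \<union> (\<lambda>P. P - E) ` \<P>"
  have 1: "finite \<Q>" unfolding \<Q>_def using P(1) by simp
  have 2: "\<Q> \<subseteq> DM" unfolding \<Q>_def using P(2) defsets_Int[OF _ E] defsets_Diff[OF _ E] by blast
  have 3: "disjoint \<Q>"
    unfolding disjoint_def
  proof (intro ballI impI)
    fix A B assume AB: "A \<in> \<Q>" "B \<in> \<Q>" "A \<noteq> B"
    from AB(1) obtain P1 where P1: "P1 \<in> \<P>" "A = P1 \<inter> E \<or> A = P1 - E" unfolding \<Q>_def by blast
    from AB(2) obtain P2 where P2: "P2 \<in> \<P>" "B = P2 \<inter> E \<or> B = P2 - E" unfolding \<Q>_def by blast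
    show "A \<inter> B = {}"
    proof (cases "P1 = P2")
      case True
      then show ?thesis using P1(2) P2(2) AB(3) by blast
    next
      case False
      then have "P1 \<inter> P2 = {}" using P(3) P1(1) P2(1) by (auto simp: disjoint_def)
      then show ?thesis using P1(2) P2(2) by blast
    qed
  qed
  have 4: "\<Union> \<Q> = univ M s"
  proof -
    have "\<Union> \<Q> = \<Union> \<P>" unfolding \<Q>_def by blast
    then show ?thesis using P(4) by simp
  qed
  have 5: "A \<subseteq> D \<or> A \<inter> D = {}" if "D \<in> insert E \<D>" "A \<in> \<Q>" for A D
  proof -
    from that(2) obtain P1 where P1: "P1 \<in> \<P>" "A = P1 \<inter> E \<or> A = P1 - E" unfolding \<Q>_def by blast
    show ?thesis
    proof (cases "D = E")
      case True
      then show ?thesis using P1(2) by blast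
    next
      case False
      then have "P1 \<subseteq> D \<or> P1 \<inter> D = {}" using that(1) P(5) P1(1) by blast
      then show ?thesis using P1(2) by blast
    qed
  qed
  show ?case by (intro exI[of _ \<Q>] conjI ballI 1 2 3 4 5)
qed

text \<open>
  On the finite partition generated by the given sets, put the mass of each piece of positive measure
  at a point of \<open>G\<close> in this piece, which exists by finite satisfiability.
\<close>
lemma conv_interpolate:
  assumes \<mu>: "\<mu> \<in> FS" and \<D>: "finite \<D>" "\<D> \<subseteq> DM"
  shows "\<exists>k\<in>CH. \<forall>D\<in>\<D>. k D = \<mu> D"
proof -
  obtain \<P> where P: "finite \<P>" "\<P> \<subseteq> DM" "disjoint \<P>" "\<Union> \<P> = univ M s"
    "\<forall>D\<in>\<D>. \<forall>P\<in>\<P>. P \<subseteq> D \<or> P \<inter> D = {}" using partition_exists[OF \<D>] by (elim exE conjE)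
  \<comment> \<open>Only pieces of positive measure are known to contain points of \<open>G\<close>.\<close>
  define \<Q> where "\<Q> = {P \<in> \<P>. \<mu> P > 0}"
  have Q: "finite \<Q>" "\<Q> \<subseteq> \<P>" using P(1) by (simp_all add: \<Q>_def)
  have "\<forall>P\<in>\<Q>. \<exists>a. a \<in> univ G s \<and> a \<in> P" using FS_fs[OF \<mu>] P(2) unfolding \<Q>_def by blast
  from bchoice[OF this] obtain a where a: "\<And>P. P \<in> \<Q> \<Longrightarrow> a P \<in> univ G s" "\<And>P. P \<in> \<Q> \<Longrightarrow> a P \<in> P" by blast
  obtain h where h: "bij_betw h {..<card \<Q>} \<Q>" using bij_betw_from_nat_into_finite[OF Q(1)] by blast
  then have hQ: "h i \<in> \<Q>" if "i < card \<Q>" for i using that by (auto simp: bij_betw_def)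
  have sumQ: "(\<Sum>P\<in>\<Q>. if P \<subseteq> D then \<mu> P else 0) = \<mu> D" if D: "D \<in> DM" "\<forall>P\<in>\<P>. P \<subseteq> D \<or> P \<inter> D = {}" for D
  proof -
    let ?R = "{P \<in> \<P>. P \<subseteq> D}"
    have R: "finite ?R" "?R \<subseteq> DM" "disjoint ?R" using P(1,2,3) by (auto simp: disjoint_def)
    have "\<Union> ?R = D"
    proof
      show "D \<subseteq> \<Union> ?R"
      proof
        fix x assume x: "x \<in> D"
        then have "x \<in> \<Union> \<P>" using P(4) defsets_sub[OF D(1)] by blast
        then obtain P1 where "P1 \<in> \<P>" "x \<in> P1" by blast
        then show "x \<in> \<Union> ?R" using D(2) x by blast
      qed
    qed blast
    then have "\<mu> D = (\<Sum>P\<in>?R. \<mu> P)" using FS_sum[OF \<mu> R] by simp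
    also have "\<dots> = (\<Sum>P\<in>\<P>. if P \<subseteq> D then \<mu> P else 0)" using P(1) by (simp add: sum.If_cases Int_def)
    also have "\<dots> = (\<Sum>P\<in>\<Q>. if P \<subseteq> D then \<mu> P else 0)"
    proof (rule sum.mono_neutral_right[OF P(1) Q(2)])
      show "\<forall>P\<in>\<P> - \<Q>. (if P \<subseteq> D then \<mu> P else 0) = 0"
      proof
        fix P1 assume P1: "P1 \<in> \<P> - \<Q>"
        then have "0 \<le> \<mu> P1" using FS_nonneg[OF \<mu>] P(2) by blast
        then have "\<mu> P1 = 0" using P1 by (simp add: \<Q>_def)
        then show "(if P1 \<subseteq> D then \<mu> P1 else 0) = 0" by simp
      qed
    qed
    finally show ?thesis by simp
  qed
  define r where "r i = \<mu> (h i)" for i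
  define g where "g i = a (h i)" for i
  define k where "k = (\<lambda>D\<in>DM. \<Sum>i<card \<Q>. r i * dirac L M s (g i) D)"
  have rep: "conv_rep L M G s k (card \<Q>) r g"
    unfolding conv_rep_def
  proof (intro conjI allI impI)
    show "0 \<le> r i" if "i < card \<Q>" for i using hQ[OF that] by (simp add: r_def \<Q>_def)
    show "g i \<in> univ G s" if "i < card \<Q>" for i using a(1)[OF hQ[OF that]] by (simp add: g_def)
    have "(\<Sum>i<card \<Q>. r i) = (\<Sum>P\<in>\<Q>. \<mu> P)" unfolding r_def by (rule sum.reindex_bij_betw[OF h])
    also have "\<dots> = (\<Sum>P\<in>\<Q>. if P \<subseteq> univ M s then \<mu> P else 0)"
    proof (rule sum.cong[OF refl])
      fix P1 assume "P1 \<in> \<Q>"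
      then have "P1 \<subseteq> univ M s" using Q(2) P(4) by blast
      then show "\<mu> P1 = (if P1 \<subseteq> univ M s then \<mu> P1 else 0)" by simp
    qed
    also have "\<dots> = \<mu> (univ M s)" by (rule sumQ[OF univ_DM]) (use P(4) in blast)
    finally show "(\<Sum>i<card \<Q>. r i) = 1" using FS_univ[OF \<mu>] by simp
  qed (rule k_def)
  have "k D = \<mu> D" if D: "D \<in> \<D>" for D
  proof -
    have D': "D \<in> DM" "\<forall>P\<in>\<P>. P \<subseteq> D \<or> P \<inter> D = {}" using D \<D>(2) P(5) by blast+
    have "k D = (\<Sum>i<card \<Q>. r i * of_bool (g i \<in> D))" by (rule conv_rep_eval[OF rep D'(1)])
    also have "\<dots> = (\<Sum>i<card \<Q>. (\<lambda>P. if P \<subseteq> D then \<mu> P else 0) (h i))"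
    proof (rule sum.cong[OF refl])
      fix i assume "i \<in> {..<card \<Q>}"
      then have hi: "h i \<in> \<Q>" using hQ by simp
      have "a (h i) \<in> D \<longleftrightarrow> h i \<subseteq> D" using a(2)[OF hi] D'(2) hi Q(2) by blast
      then show "r i * of_bool (g i \<in> D) = (if h i \<subseteq> D then \<mu> (h i) else 0)" by (simp add: r_def g_def)
    qed
    also have "\<dots> = (\<Sum>P\<in>\<Q>. if P \<subseteq> D then \<mu> P else 0)" by (rule sum.reindex_bij_betw[OF h])
    also have "\<dots> = \<mu> D" by (rule sumQ[OF D'])
    finally show ?thesis .
  qed
  moreover have "k \<in> CH" using rep unfolding conv_hull_def by blast
  ultimately show ?thesis by blast
qed

end

section \<open>The space of measures and the fibre functions\<close>

context monster_group
begin

abbreviation "KT \<equiv> keisler_fs_topology L M G s"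
abbreviation "cube \<equiv> product_topology (\<lambda>_. top_of_set {0..1::real}) DM"

lemma KT_eq: "KT = subtopology cube FS" by (simp add: keisler_fs_topology_def)

lemma topspace_cube: "topspace cube = (\<Pi>\<^sub>E D\<in>DM. {0..1})" by simp

lemma FS_cube: "FS \<subseteq> topspace cube"
proof
  fix \<mu> assume \<mu>: "\<mu> \<in> FS"
  show "\<mu> \<in> topspace cube"
    unfolding topspace_cube
  proof (rule PiE_I)
    show "\<mu> D \<in> {0..1}" if "D \<in> DM" for D using FS_nonneg[OF \<mu> that] FS_le_1[OF \<mu> that] by simp
    show "\<mu> D = undefined" if "D \<notin> DM" for D using FS_ext[OF \<mu>] that by (rule extensional_arb)
  qed
qed

lemma topspace_KT: "topspace KT = FS"
  unfolding KT_eq topspace_subtopology using FS_cube by blast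

lemma cube_eval: "D \<in> DM \<Longrightarrow> continuous_map cube euclideanreal (\<lambda>\<mu>. \<mu> D)"
  using continuous_map_product_projection[of D DM "\<lambda>_. top_of_set {0..1::real}"]
  by (rule continuous_map_into_fulltopology)

lemma KT_eval: "D \<in> DM \<Longrightarrow> continuous_map KT euclideanreal (\<lambda>\<mu>. \<mu> D)"
  unfolding KT_eq by (rule continuous_map_from_subtopology[OF cube_eval])

lemma continuous_map_KT:
  assumes f: "\<And>x. x \<in> topspace X \<Longrightarrow> f x \<in> FS"
    and cont: "\<And>D. D \<in> DM \<Longrightarrow> continuous_map X euclideanreal (\<lambda>x. f x D)"
  shows "continuous_map X KT f"
  unfolding KT_eq continuous_map_in_subtopology continuous_map_componentwise
proof (intro conjI ballI)
  show "f ` topspace X \<subseteq> extensional DM" using f FS_ext by blast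
  show "f \<in> topspace X \<rightarrow> FS" using f by blast
  fix D assume D: "D \<in> DM"
  show "continuous_map X euclideanreal (\<lambda>x. f x D)" by (rule cont[OF D])
  show "(\<lambda>x. f x D) \<in> topspace X \<rightarrow> {0..1}" using f FS_nonneg[OF _ D] FS_le_1[OF _ D] by auto
qed

lemma Hausdorff_KT: "Hausdorff_space KT"
  unfolding KT_eq by (rule Hausdorff_space_subtopology) (simp add: Hausdorff_space_product_topology Hausdorff_space_subtopology)

text \<open>
  Since measures are nonnegative, finite satisfiability says that definable sets without points of \<open>G\<close> have
  measure 0, which is a closed condition.
\<close>
lemma closedin_FS: "closedin cube FS"
proof -
  define F1 where "F1 D E = {\<mu> \<in> topspace cube. \<mu> (D \<union> E) = \<mu> D + \<mu> E}" for D E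
  define F2 where "F2 = {\<mu> \<in> topspace cube. \<mu> (univ M s) = 1}"
  define F3 where "F3 D = {\<mu> \<in> topspace cube. \<mu> D = 0}" for D
  define \<K> where "\<K> = {F2} \<union> {F1 D E | D E. D \<in> DM \<and> E \<in> DM \<and> D \<inter> E = {}} \<union> {F3 D | D. D \<in> DM \<and> univ G s \<inter> D = {}}"
  have H: "Hausdorff_space euclideanreal" by simp
  have "closedin cube (F1 D E)" if "D \<in> DM" "E \<in> DM" for D E
    unfolding F1_def
    by (rule closedin_continuous_maps_eq[OF H cube_eval[OF defsets_Un[OF that]] continuous_map_add[OF cube_eval[OF that(1)] cube_eval[OF that(2)]]])
  moreover have "closedin cube F2"
    unfolding F2_def by (rule closedin_continuous_maps_eq[OF H cube_eval[OF univ_DM]]) simp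
  moreover have "closedin cube (F3 D)" if "D \<in> DM" for D
    unfolding F3_def by (rule closedin_continuous_maps_eq[OF H cube_eval[OF that]]) simp
  ultimately have "closedin cube K" if "K \<in> \<K>" for K using that unfolding \<K>_def by blast
  then have "closedin cube (\<Inter> \<K>)" by (intro closedin_Inter) (auto simp: \<K>_def)
  moreover have "\<Inter> \<K> = FS"
  proof (intro equalityI subsetI)
    fix \<mu> assume "\<mu> \<in> \<Inter> \<K>"
    then have inK: "\<mu> \<in> K" if "K \<in> \<K>" for K using that by blast
    have in1: "\<mu> \<in> F1 D E" if "D \<in> DM" "E \<in> DM" "D \<inter> E = {}" for D E
      by (rule inK) (use that in \<open>auto simp: \<K>_def\<close>)
    have in2: "\<mu> \<in> F2" by (rule inK) (simp add: \<K>_def)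
    have in3: "\<mu> \<in> F3 D" if "D \<in> DM" "univ G s \<inter> D = {}" for D
      by (rule inK) (use that in \<open>auto simp: \<K>_def\<close>)
    have cube: "\<mu> \<in> (\<Pi>\<^sub>E D\<in>DM. {0..1})" using in2 unfolding F2_def topspace_cube by blast
    then have "\<mu> \<in> extensional DM" "\<And>D. D \<in> DM \<Longrightarrow> 0 \<le> \<mu> D" by (auto simp: PiE_iff)
    moreover have "\<mu> (univ M s) = 1" using in2 by (simp add: F2_def)
    moreover have "\<mu> (D \<union> E) = \<mu> D + \<mu> E" if "D \<in> DM" "E \<in> DM" "D \<inter> E = {}" for D E
      using in1[OF that] by (simp add: F1_def)
    moreover have "\<exists>a\<in>univ G s. a \<in> D" if "D \<in> DM" "0 < \<mu> D" for D
    proof (rule ccontr)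
      assume "\<not> ?thesis"
      then have "univ G s \<inter> D = {}" by blast
      from in3[OF that(1) this] that(2) show False by (simp add: F3_def)
    qed
    ultimately show "\<mu> \<in> FS" by (simp add: keisler_fs_def keisler_def)
  next
    fix \<mu> assume \<mu>: "\<mu> \<in> FS"
    have c: "\<mu> \<in> topspace cube" using FS_cube \<mu> by blast
    have "\<mu> \<in> F2" using c FS_univ[OF \<mu>] unfolding F2_def by blast
    moreover have "\<mu> \<in> F1 D E" if "D \<in> DM" "E \<in> DM" "D \<inter> E = {}" for D E
      using c FS_add[OF \<mu> that] unfolding F1_def by blast
    moreover have "\<mu> \<in> F3 D" if D: "D \<in> DM" "univ G s \<inter> D = {}" for D
    proof -
      have "\<not> 0 < \<mu> D" using FS_fs[OF \<mu> D(1)] D(2) by blast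
      then have "\<mu> D = 0" using FS_nonneg[OF \<mu> D(1)] by simp
      then show ?thesis using c unfolding F3_def by blast
    qed
    ultimately show "\<mu> \<in> \<Inter> \<K>" unfolding \<K>_def by blast
  qed
  ultimately show ?thesis by simp
qed

lemma compact_KT: "compact_space KT"
proof -
  have "compact_space cube"
    by (simp add: compact_space_product_topology compact_space_subtopology)
  then have "compactin cube FS" using closedin_FS by (rule closedin_compact_space)
  then show ?thesis unfolding KT_eq by (rule compact_space_subtopology)
qed

text \<open>
  A basic open set restricts finitely many values, and these can be interpolated.
\<close>
lemma dense_CH: "KT closure_of CH = FS"
proof (intro equalityI subsetI)
  fix \<mu> assume "\<mu> \<in> KT closure_of CH"
  then show "\<mu> \<in> FS" using closure_of_subset_topspace[of KT CH] topspace_KT by blast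
next
  fix \<mu> assume \<mu>: "\<mu> \<in> FS"
  show "\<mu> \<in> KT closure_of CH"
    unfolding in_closure_of topspace_KT
  proof (intro conjI allI impI \<mu>)
    fix W assume W: "\<mu> \<in> W \<and> openin KT W"
    then obtain V where V: "openin cube V" "W = V \<inter> FS" unfolding KT_eq openin_subtopology by blast
    then have "\<mu> \<in> V" using W by blast
    with V(1) obtain U where U: "finite {D \<in> DM. U D \<noteq> topspace (top_of_set {0..1::real})}"
      "\<mu> \<in> Pi\<^sub>E DM U" "Pi\<^sub>E DM U \<subseteq> V" unfolding openin_product_topology_alt by blast
    let ?F = "{D \<in> DM. U D \<noteq> topspace (top_of_set {0..1::real})}"
    obtain k where k: "k \<in> CH" "\<forall>D\<in>?F. k D = \<mu> D" using conv_interpolate[OF \<mu> U(1)] by blast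
    have kFS: "k \<in> FS" using k(1) CH_FS by blast
    have "k \<in> Pi\<^sub>E DM U"
    proof (rule PiE_I)
      fix D assume D: "D \<in> DM"
      show "k D \<in> U D"
      proof (cases "D \<in> ?F")
        case True
        then have "k D = \<mu> D" using k(2) by blast
        then show ?thesis using U(2) D by auto
      next
        case False
        then have "U D = {0..1}" using D by simp
        then show ?thesis using FS_nonneg[OF kFS D] FS_le_1[OF kFS D] by simp
      qed
    next
      fix D assume "D \<notin> DM"
      with FS_ext[OF kFS] show "k D = undefined" by (rule extensional_arb)
    qed
    then have "k \<in> W" using U(3) V(2) kFS by blast
    with k(1) show "\<exists>y. y \<in> CH \<and> y \<in> W" by blast
  qed
qed

text \<open>
  The filter of convergence to \<open>\<mu>\<close> through \<open>conv(G)\<close>.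
\<close>
definition near :: "('m set \<Rightarrow> real) \<Rightarrow> ('m set \<Rightarrow> real) filter" where
  "near \<mu> = inf (nhdsin KT \<mu>) (principal CH)"

lemma eventually_near:
  assumes "\<mu> \<in> FS"
  shows "eventually P (near \<mu>) \<longleftrightarrow> (\<exists>W. openin KT W \<and> \<mu> \<in> W \<and> (\<forall>k\<in>W \<inter> CH. P k))"
  using assms by (auto simp: near_def eventually_inf_principal eventually_nhdsin topspace_KT)

lemma near_ne: assumes \<mu>: "\<mu> \<in> FS" shows "near \<mu> \<noteq> bot"
proof
  assume "near \<mu> = bot"
  then have "eventually (\<lambda>_. False) (near \<mu>)" by simp
  then obtain W where W: "openin KT W" "\<mu> \<in> W" "W \<inter> CH = {}" unfolding eventually_near[OF \<mu>] by blast
  have "\<mu> \<in> KT closure_of CH" using \<mu> dense_CH by simp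
  with W show False unfolding in_closure_of by blast
qed

lemma near_CH: "\<forall>\<^sub>F k in near \<mu>. k \<in> CH"
  by (simp add: near_def eventually_inf_principal)

lemma near_tendsto: assumes \<mu>: "\<mu> \<in> FS" and D: "D \<in> DM" shows "((\<lambda>k. k D) \<longlongrightarrow> \<mu> D) (near \<mu>)"
proof (rule topological_tendstoI)
  fix V assume V: "open V" "\<mu> D \<in> V"
  have "openin KT {x \<in> topspace KT. x D \<in> V}"
    by (rule openin_continuous_map_preimage[OF KT_eval[OF D]]) (use V in simp)
  moreover have "\<mu> \<in> {x \<in> topspace KT. x D \<in> V}" using \<mu> V topspace_KT by simp
  ultimately show "eventually (\<lambda>k. k D \<in> V) (near \<mu>)" unfolding eventually_near[OF \<mu>] by blast
qed

text \<open>
  Extension by continuity: if \<open>h\<close> is close to \<open>h \<mu>\<close> on the part of \<open>conv(G)\<close> in a neighbourhood \<open>W\<close> of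
  \<open>\<mu>\<close>, then also at each \<open>\<nu>\<close> in \<open>W\<close>, because \<open>h \<nu>\<close> is a limit of such values.
\<close>
lemma continuous_from_dense:
  fixes h :: "('m set \<Rightarrow> real) \<Rightarrow> real"
  assumes lim: "\<And>\<mu>. \<mu> \<in> FS \<Longrightarrow> (h \<longlongrightarrow> h \<mu>) (near \<mu>)"
  shows "continuous_map KT euclideanreal h"
proof -
  have "continuous_map KT Met_TC.mtopology h"
    unfolding Met_TC.continuous_map_to_metric
  proof (intro ballI allI impI)
    fix \<mu> and e :: real assume \<mu>: "\<mu> \<in> topspace KT" and e: "0 < e"
    then have \<mu>: "\<mu> \<in> FS" by (simp add: topspace_KT)
    from tendstoD[OF lim[OF \<mu>], of "e / 2"] e have "\<forall>\<^sub>F k in near \<mu>. dist (h k) (h \<mu>) < e / 2" by simp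
    then obtain W where W: "openin KT W" "\<mu> \<in> W" "\<forall>k\<in>W \<inter> CH. dist (h k) (h \<mu>) < e / 2"
      unfolding eventually_near[OF \<mu>] by blast
    have "h \<nu> \<in> Met_TC.mball (h \<mu>) e" if \<nu>: "\<nu> \<in> W" for \<nu>
    proof -
      have \<nu>F: "\<nu> \<in> FS" using \<nu> openin_subset[OF W(1)] topspace_KT by blast
      have "\<forall>\<^sub>F k in near \<nu>. dist (h k) (h \<mu>) \<le> e / 2"
        unfolding eventually_near[OF \<nu>F] using W \<nu> by (intro exI[of _ W]) (auto intro: less_imp_le)
      moreover have "((\<lambda>k. dist (h k) (h \<mu>)) \<longlongrightarrow> dist (h \<nu>) (h \<mu>)) (near \<nu>)"
        by (intro tendsto_dist lim[OF \<nu>F] tendsto_const)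
      ultimately have "dist (h \<nu>) (h \<mu>) \<le> e / 2" using near_ne[OF \<nu>F] by (intro tendsto_upperbound)
      then show ?thesis using e by (simp add: dist_commute)
    qed
    with W show "\<exists>U. openin KT U \<and> \<mu> \<in> U \<and> (\<forall>y\<in>U. h y \<in> Met_TC.mball (h \<mu>) e)" by blast
  qed
  then show ?thesis by simp
qed

lemma small_Un:
  assumes "small \<kappa> A" "small \<kappa> B"
  shows "small \<kappa> (\<lambda>t. A t \<union> B t)"
proof -
  have co: "Card_order \<kappa>" using mon by (simp add: monster_def)
  have "Sigma UNIV (\<lambda>t. A t \<union> B t) = Sigma UNIV A \<union> Sigma UNIV B" by blast
  then show ?thesis using assms card_of_Un_ordLess_infinite_Field[OF monster_infinite[OF mon] co]
    unfolding small_def by simp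
qed

lemma small_finite: assumes "finite (Sigma UNIV A)" shows "small \<kappa> A"
  unfolding small_def
proof (rule finite_ordLess_infinite)
  show "Well_order \<kappa>" using mon by (simp add: monster_def card_order_on_def)
  show "Well_order |Sigma UNIV A|" by (rule card_of_Well_order)
  show "finite (Field |Sigma UNIV A| )" using assms by (simp add: Field_card_of)
  show "infinite (Field \<kappa>)" by (rule monster_infinite[OF mon])
qed

lemma small_model:
  assumes A: "\<And>t. A t \<subseteq> univ M t" "small \<kappa> A"
  shows "\<exists>N. elem_sub L N M \<and> small \<kappa> (univ N) \<and> (\<forall>t. univ G t \<subseteq> univ N t) \<and> (\<forall>t. A t \<subseteq> univ N t)"
proof -
  have "\<exists>N. elem_sub L N M \<and> small \<kappa> (univ N) \<and> (\<forall>t. univ G t \<union> A t \<subseteq> univ N t)"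
    by (rule lowenheim_skolem[OF mon _ small_Un[OF smallG A(2)]]) (use univ_G A(1) in blast)
  then show ?thesis by blast
qed

end

text \<open>
  The small models over which the convolution can be computed: they contain \<open>G\<close> and the parameters of \<open>D\<close>.
\<close>
locale monster_base = monster_group L T \<kappa> M G s m
  for L :: "('s, 'f, 'r) language" and T :: "('s, 'f, 'r) fm set" and \<kappa> :: "'k rel"
    and M G :: "('s, 'f, 'r, 'm) struct" and s :: 's and m :: 'f +
  fixes N :: "('s, 'f, 'r, 'm) struct" and D :: "'m set"
  assumes subN: "elem_sub L N M" and smallN: "small \<kappa> (univ N)" and GN: "\<And>t. univ G t \<subseteq> univ N t"
    and D: "D \<in> defsets L M s (univ N)"
begin

sublocale N: type_space L M s "univ N"
  by unfold_locales (rule struct)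

lemma NM: "univ N t \<subseteq> univ M t" using subN by (simp add: elem_sub_def)
lemma N_DM: "N.DA \<subseteq> DM" by (rule defsets_mono[OF NM])
lemma D_DM: "D \<in> DM" using D N_DM by blast

lemma realized: assumes "q \<in> N.S" shows "realizes M s (SOME d. realizes M s d q) q"
proof -
  have "saturated L \<kappa> M" using mon by (simp add: monster_def)
  then have "\<exists>d. realizes M s d q" unfolding saturated_def using NM smallN assms by blast
  then show ?thesis by (rule someI_ex)
qed

lemma lshift_N: assumes "g \<in> univ G s" shows "lsh g D \<in> N.DA"
proof -
  have "g \<in> univ N s" using GN assms by blast
  from defsets_rshift(2)[OF ar mu_closed D this G_in[OF assms]] show ?thesis .
qed

lemma mem_rshift:
  assumes q: "q \<in> N.S" and d: "realizes M s d q" and g: "g \<in> univ G s"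
  shows "g \<in> rsh d D \<longleftrightarrow> lsh g D \<in> q"
proof -
  have "d \<in> univ M s" using d by (simp add: realizes_def)
  then have "g \<in> rsh d D \<longleftrightarrow> d \<in> lsh g D"
    using G_in[OF g] by (simp add: rshift_def lshift_def)
  also have "\<dots> \<longleftrightarrow> lsh g D \<in> q" by (rule N.realizes_iff[OF q d lshift_N[OF g]])
  finally show ?thesis .
qed

text \<open>
  For \<open>k\<close> in \<open>conv(G)\<close> the value of the fibre function depends only on which of the shifts of \<open>D\<close> by
  elements of \<open>G\<close> belong to the type, because these shifts are definable over \<open>N\<close>.
\<close>
lemma conv_rshift:
  assumes q: "q \<in> N.S" and d: "realizes M s d q" and rep: "conv_rep L M G s k n r g"
  shows "k (rsh d D) = (\<Sum>i<n. r i * of_bool (lsh (g i) D \<in> q))"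
proof -
  have "d \<in> univ M s" using d by (simp add: realizes_def)
  then have "k (rsh d D) = (\<Sum>i<n. r i * of_bool (g i \<in> rsh d D))"
    by (intro conv_rep_eval[OF rep] rshift_DM[OF D_DM])
  also have "\<dots> = (\<Sum>i<n. r i * of_bool (lsh (g i) D \<in> q))"
  proof (rule sum.cong[OF refl])
    fix i assume "i \<in> {..<n}"
    then have "g i \<in> univ G s" using rep by (simp add: conv_rep_def)
    then show "r i * of_bool (g i \<in> rsh d D) = r i * of_bool (lsh (g i) D \<in> q)"
      using mem_rshift[OF q d] by simp
  qed
  finally show ?thesis .
qed

abbreviation "fib \<mu> \<equiv> fiber_value M s m \<mu> D"

lemma conv_fib:
  assumes q: "q \<in> N.S" and rep: "conv_rep L M G s k n r g"
  shows "fib k q = (\<Sum>i<n. r i * of_bool (lsh (g i) D \<in> q))"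
  unfolding fiber_value_def by (rule conv_rshift[OF q realized[OF q] rep])

lemma fib_lim:
  assumes \<mu>: "\<mu> \<in> FS" and q: "q \<in> N.S" and d: "realizes M s d q"
  shows "((\<lambda>k. fib k q) \<longlongrightarrow> \<mu> (rsh d D)) (near \<mu>)"
proof -
  have "d \<in> univ M s" using d by (simp add: realizes_def)
  then have "((\<lambda>k. k (rsh d D)) \<longlongrightarrow> \<mu> (rsh d D)) (near \<mu>)"
    by (intro near_tendsto \<mu> rshift_DM[OF D_DM])
  moreover have "\<forall>\<^sub>F k in near \<mu>. k (rsh d D) = fib k q"
    using near_CH
  proof eventually_elim
    case (elim k)
    then obtain n r g where rep: "conv_rep L M G s k n r g" unfolding conv_hull_def by blast
    show ?case unfolding conv_fib[OF q rep] conv_rshift[OF q d rep] ..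
  qed
  ultimately show ?thesis by (rule Lim_transform_eventually)
qed

text \<open>
  The limit along \<open>conv(G)\<close> is the same for all realizations of a type.
\<close>
lemma fib_eq:
  assumes \<mu>: "\<mu> \<in> FS" and q: "q \<in> N.S" and d: "realizes M s d q"
  shows "\<mu> (rsh d D) = fib \<mu> q"
proof -
  have "((\<lambda>k. fib k q) \<longlongrightarrow> fib \<mu> q) (near \<mu>)"
    unfolding fiber_value_def[of M s m \<mu>] by (rule fib_lim[OF \<mu> q realized[OF q]])
  with near_ne[OF \<mu>] fib_lim[OF assms] show ?thesis by (rule tendsto_unique)
qed

lemma fib_tendsto: "\<mu> \<in> FS \<Longrightarrow> q \<in> N.S \<Longrightarrow> ((\<lambda>k. fib k q) \<longlongrightarrow> fib \<mu> q) (near \<mu>)"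
  unfolding fiber_value_def[of M s m \<mu>] by (rule fib_lim[OF _ _ realized])

lemma continuous_mem: assumes E: "E \<in> N.DA" shows "continuous_map N.X euclideanreal (\<lambda>q. of_bool (E \<in> q))"
proof -
  have "openin N.X {q \<in> topspace N.X. of_bool (E \<in> q) \<in> V}" for V :: "real set"
  proof -
    have "{q \<in> topspace N.X. of_bool (E \<in> q) \<in> V} = (if 1 \<in> V then N.cl E else {}) \<union> (if 0 \<in> V then N.cl (univ M s - E) else {})"
      unfolding N.cl_compl[OF E] by (auto simp: N.topspace_X N.cl_def)
    also have "openin N.X \<dots>" using N.openin_cl[OF E] N.openin_cl[OF defsets_compl[OF E]] by auto
    finally show ?thesis .
  qed
  then show ?thesis by (simp add: continuous_map)
qed

text \<open>
  Patterns among types over \<open>N\<close> are realized by elements of the monster model, so the NIP bound for the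
  relation \<open>g \<cdot> d \<in> D\<close> applies to the sets given by elements of \<open>G\<close>, and then to convex combinations.
\<close>
lemma nip_fib: "nip_family N.X CH fib"
proof
  fix k assume k: "k \<in> CH"
  then obtain n r g where rep: "conv_rep L M G s k n r g" unfolding conv_hull_def by blast
  have g: "g i \<in> univ G s" if "i < n" for i using rep that by (simp add: conv_rep_def)
  have "continuous_map N.X euclideanreal (\<lambda>q. \<Sum>i<n. r i * of_bool (lsh (g i) D \<in> q))"
    by (intro continuous_map_sum continuous_map_real_mult_left continuous_mem lshift_N) (auto intro: g)
  then show "continuous_map N.X euclideanreal (fib k)"
    by (rule continuous_map_eq) (simp add: conv_fib[OF _ rep] N.topspace_X)
  fix q assume "q \<in> topspace N.X"
  then have q: "q \<in> N.S" by (simp add: N.topspace_X)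
  have kFS: "k \<in> FS" using k CH_FS by blast
  have "(SOME d. realizes M s d q) \<in> univ M s" using realized[OF q] by (simp add: realizes_def)
  then have "rsh (SOME d. realizes M s d q) D \<in> DM" by (rule rshift_DM[OF D_DM])
  then show "0 \<le> fib k q \<and> fib k q \<le> 1" unfolding fiber_value_def using FS_nonneg[OF kFS] FS_le_1[OF kFS] by blast
next
  fix a b :: real assume ab: "a < b" "b \<le> a + 1"
  have noIP: "\<not> has_IP M \<phi> X" if "wf_fm L \<phi>" for \<phi> X
    using NIP mod that unfolding NIP_theory_def by blast
  from NIP_products[OF ar mu_closed noIP D]
  obtain n :: nat where n: "\<not> (\<exists>g. (\<forall>i<n. g i \<in> univ M s) \<and> (\<forall>I\<subseteq>{..<n}. \<exists>d\<in>univ M s. \<forall>i<n. mul M m (g i) d \<in> D \<longleftrightarrow> i \<in> I))"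
    by blast
  have "\<not> (\<exists>g. (\<forall>i<n. g i \<in> univ G s) \<and> (\<forall>I\<subseteq>{..<n}. \<exists>q\<in>N.S. \<forall>i<n. lsh (g i) D \<in> q \<longleftrightarrow> i \<in> I))"
  proof
    assume "\<exists>g. (\<forall>i<n. g i \<in> univ G s) \<and> (\<forall>I\<subseteq>{..<n}. \<exists>q\<in>N.S. \<forall>i<n. lsh (g i) D \<in> q \<longleftrightarrow> i \<in> I)"
    then obtain g where g: "\<forall>i<n. g i \<in> univ G s"
      and sh: "\<forall>I\<subseteq>{..<n}. \<exists>q\<in>N.S. \<forall>i<n. lsh (g i) D \<in> q \<longleftrightarrow> i \<in> I" by blast
    have "\<exists>d\<in>univ M s. \<forall>i<n. mul M m (g i) d \<in> D \<longleftrightarrow> i \<in> I" if I: "I \<subseteq> {..<n}" for I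
    proof -
      from sh I obtain q where q: "q \<in> N.S" "\<forall>i<n. lsh (g i) D \<in> q \<longleftrightarrow> i \<in> I" by blast
      define d where "d = (SOME d. realizes M s d q)"
      have d: "realizes M s d q" unfolding d_def by (rule realized[OF q(1)])
      have dM: "d \<in> univ M s" using d by (simp add: realizes_def)
      have "mul M m (g i) d \<in> D \<longleftrightarrow> i \<in> I" if i: "i < n" for i
      proof -
        have gi: "g i \<in> univ G s" using g i by blast
        have "mul M m (g i) d \<in> D \<longleftrightarrow> g i \<in> rsh d D" using G_in[OF gi] by (simp add: rshift_def)
        then show ?thesis using mem_rshift[OF q(1) d gi] q(2) i by simp
      qed
      with dM show ?thesis by blast
    qed
    moreover have "\<forall>i<n. g i \<in> univ M s" using g G_in by blast
    ultimately show False using n by blast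
  qed
  from convex_combinations_not_shattered[OF this ab] obtain l :: nat where l: "\<forall>f :: nat \<Rightarrow> 'm set set \<Rightarrow> real.
     (\<forall>i<l. \<exists>N' r g. (\<forall>j<N'. 0 \<le> r j \<and> g j \<in> univ G s) \<and> (\<Sum>j<N'. r j) = 1 \<and>
        (\<forall>q\<in>N.S. f i q = (\<Sum>j<(N'::nat). r j * of_bool (lsh (g j) D \<in> q)))) \<longrightarrow>
     \<not> (\<forall>I\<subseteq>{..<l}. \<exists>q\<in>N.S. \<forall>i<l. if i \<in> I then f i q > b else f i q < a)" ..
  have "\<not> (\<forall>I\<subseteq>{..<l}. \<exists>q\<in>N.S. \<forall>i<l. if i \<in> I then fib (e i) q > b else fib (e i) q < a)"
    if e: "\<forall>i<l. e i \<in> CH" for e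
  proof (rule l[rule_format, of "\<lambda>i. fib (e i)"])
    fix i assume "i < l"
    then obtain n r g where rep: "conv_rep L M G s (e i) n r g" using e unfolding conv_hull_def by blast
    then show "\<exists>N' r g. (\<forall>j<N'. 0 \<le> r j \<and> g j \<in> univ G s) \<and> (\<Sum>j<N'. r j) = 1 \<and>
        (\<forall>q\<in>N.S. fib (e i) q = (\<Sum>j<(N'::nat). r j * of_bool (lsh (g j) D \<in> q)))"
      using conv_fib[OF _ rep] by (intro exI[of _ n] exI[of _ r] exI[of _ g]) (simp add: conv_rep_def)
  qed
  then show "\<exists>n. \<forall>e :: nat \<Rightarrow> 'm set \<Rightarrow> real. (\<forall>i<n. e i \<in> CH) \<longrightarrow>
      \<not> (\<forall>I\<subseteq>{..<n}. \<exists>x\<in>topspace N.X. \<forall>i<n. if i \<in> I then fib (e i) x > b else fib (e i) x < a)"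
    unfolding N.topspace_X by blast
qed

lemma fib_borel: assumes \<mu>: "\<mu> \<in> FS" shows "fib \<mu> \<in> borel_measurable (borel_of_top N.X)"
  by (rule nip_family.limit_borel[OF nip_fib near_ne[OF \<mu>] near_CH])
    (simp add: N.topspace_X fib_tendsto[OF \<mu>])

text \<open>
  The Borel measure of \<open>\<nu>\<close> on the types over \<open>N\<close>.
\<close>
definition PN :: "('m set \<Rightarrow> real) \<Rightarrow> 'm set set measure" where
  "PN \<nu> = type_measure L M s (univ N) (restrict \<nu> N.DA)"

lemma rest: "\<nu> \<in> FS \<Longrightarrow> restrict \<nu> N.DA \<in> keisler L M s (univ N)"
  by (rule keisler_restrict[OF FS_keisler NM struct])

lemma regular_PN: "\<nu> \<in> FS \<Longrightarrow> regular_Borel_prob N.X (PN \<nu>)"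
  unfolding PN_def by (rule N.type_measure(1)[OF rest])

lemma fib_PN: "\<mu> \<in> FS \<Longrightarrow> \<nu> \<in> FS \<Longrightarrow> fib \<mu> \<in> borel_measurable (PN \<nu>)"
  using fib_borel by (simp add: measurable_cong_sets[OF regular_Borel_probD(2)[OF regular_PN] refl])

lemma supp_eq: "supp_measure L M s \<nu> N = restrict_space (PN \<nu>) (support L M s (univ N) (restrict \<nu> N.DA))"
  by (simp add: supp_measure_def PN_def Let_def)

lemma conv_base_N:
  assumes \<mu>: "\<mu> \<in> FS" and \<nu>: "\<nu> \<in> FS"
  shows "conv_base L \<kappa> M s m \<mu> \<nu> D N"
  unfolding conv_base_def
proof (intro conjI ballI allI impI subN smallN D)
  fix q d d' assume q: "q \<in> support L M s (univ N) (restrict \<nu> N.DA)"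
    and d: "realizes M s d q \<and> realizes M s d' q"
  have q: "q \<in> N.S" using q by (simp add: support_def)
  show "\<mu> (rsh d D) = \<mu> (rsh d' D)"
    using fib_eq[OF \<mu> q, of d] fib_eq[OF \<mu> q, of d'] d by simp
next
  show "fib \<mu> \<in> borel_measurable (supp_measure L M s \<nu> N)"
    unfolding supp_eq by (rule measurable_restrict_space1[OF fib_PN[OF assms]])
qed

lemma integral_lim:
  assumes \<mu>: "\<mu> \<in> FS" and \<nu>: "\<nu> \<in> FS"
  shows "((\<lambda>k. integral\<^sup>L (PN \<nu>) (fib k)) \<longlongrightarrow> integral\<^sup>L (PN \<nu>) (fib \<mu>)) (near \<mu>)"
  by (rule nip_family.limit_integral[OF nip_fib near_CH _ regular_PN[OF \<nu>] N.Hausdorff_X])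
    (simp add: N.topspace_X fib_tendsto[OF \<mu>])

text \<open>
  The fibre function of a combination of point masses is a combination of indicators of clopen sets.
\<close>
lemma integral_conv:
  assumes \<nu>: "\<nu> \<in> FS" and rep: "conv_rep L M G s k n r g"
  shows "integral\<^sup>L (PN \<nu>) (fib k) = (\<Sum>i<n. r i * \<nu> (lsh (g i) D))"
proof -
  interpret prob_space "PN \<nu>" using regular_PN[OF \<nu>] by (rule regular_Borel_probD)
  have sp: "space (PN \<nu>) = N.S" using regular_Borel_probD(3)[OF regular_PN[OF \<nu>]] by (simp add: N.topspace_X)
  have g: "g i \<in> univ G s" if "i < n" for i using rep that by (simp add: conv_rep_def)
  have clm: "N.cl E \<in> sets (PN \<nu>)" if "E \<in> N.DA" for E
    using openin_borel[OF N.openin_cl[OF that]] regular_Borel_probD(2)[OF regular_PN[OF \<nu>]] by simp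
  have int: "integrable (PN \<nu>) (indicator (N.cl (lsh (g i) D)) :: _ \<Rightarrow> real)" if "i < n" for i
    using clm[OF lshift_N[OF g[OF that]]] by (simp add: integrable_indicator_iff less_top[symmetric])
  have "integral\<^sup>L (PN \<nu>) (fib k) = (\<integral>q. (\<Sum>i<n. r i * indicator (N.cl (lsh (g i) D)) q) \<partial>PN \<nu>)"
  proof (rule Bochner_Integration.integral_cong[OF refl])
    fix q assume "q \<in> space (PN \<nu>)"
    then have q: "q \<in> N.S" by (simp add: sp)
    show "fib k q = (\<Sum>i<n. r i * indicator (N.cl (lsh (g i) D)) q)"
      unfolding conv_fib[OF q rep] by (rule sum.cong) (simp_all add: indicator_def N.cl_def q)
  qed
  also have "\<dots> = (\<Sum>i<n. \<integral>q. r i * indicator (N.cl (lsh (g i) D)) q \<partial>PN \<nu>)"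
    by (rule Bochner_Integration.integral_sum) (use int in simp)
  also have "\<dots> = (\<Sum>i<n. r i * \<nu> (lsh (g i) D))"
  proof (rule sum.cong[OF refl])
    fix i assume "i \<in> {..<n}"
    then have E: "lsh (g i) D \<in> N.DA" using lshift_N g by simp
    have "(\<integral>q. r i * indicator (N.cl (lsh (g i) D)) q \<partial>PN \<nu>) = r i * measure (PN \<nu>) (N.cl (lsh (g i) D))"
      using clm[OF E] by simp
    also have "measure (PN \<nu>) (N.cl (lsh (g i) D)) = \<nu> (lsh (g i) D)"
      unfolding PN_def using N.type_measure(2)[OF rest[OF \<nu>] E] E by simp
    finally show "(\<integral>q. r i * indicator (N.cl (lsh (g i) D)) q \<partial>PN \<nu>) = r i * \<nu> (lsh (g i) D)" .
  qed
  finally show ?thesis .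
qed

text \<open>
  Restriction of types from \<open>N\<close> to \<open>N'\<close> transports the measure and carries the support into the support, where the
  fibre functions agree because a realization of a type also realizes its restriction.  Only
  measurability on the support is known over \<open>N'\<close>, so the fibre function is cut off there.
\<close>
lemma integral_independent:
  assumes \<mu>: "\<mu> \<in> FS" and \<nu>: "\<nu> \<in> FS" and base: "conv_base L \<kappa> M s m \<mu> \<nu> D N'"
    and sub: "\<And>t. univ N' t \<subseteq> univ N t"
  shows "integral\<^sup>L (supp_measure L M s \<nu> N') (fib \<mu>) = integral\<^sup>L (PN \<nu>) (fib \<mu>)"
proof -
  interpret R: type_restriction L M s "univ N'" "univ N"
    by unfold_locales (use struct sub in blast)+
  have N'M: "univ N' t \<subseteq> univ M t" for t using base by (simp add: conv_base_def elem_sub_def)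
  have satur: "\<exists>d. realizes M s d q" if "q \<in> R.A.S" for q
    using mon base N'M that unfolding monster_def saturated_def conv_base_def by blast
  define \<nu>N' where "\<nu>N' = restrict \<nu> R.A.DA"
  define Z where "Z = support L M s (univ N') \<nu>N'"
  define Z2 where "Z2 = support L M s (univ N) (restrict \<nu> N.DA)"
  define P where "P = type_measure L M s (univ N') \<nu>N'"
  have K: "\<nu>N' \<in> keisler L M s (univ N')"
    unfolding \<nu>N'_def by (rule keisler_restrict[OF FS_keisler[OF \<nu>] N'M struct])
  have P: "regular_Borel_prob R.A.X P" unfolding P_def by (rule R.A.type_measure(1)[OF K])
  have rr: "restrict (restrict \<nu> N.DA) R.A.DA = \<nu>N'"
    unfolding \<nu>N'_def restrict_restrict using R.DA_sub by (simp add: Int_absorb1)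
  have distr: "P = distr (PN \<nu>) (borel_of_top R.A.X) R.r"
    unfolding P_def PN_def using R.type_measure_restrict[OF rest[OF \<nu>]] unfolding rr .
  have supp: "supp_measure L M s \<nu> N' = restrict_space P Z"
    by (simp add: supp_measure_def P_def Z_def \<nu>N'_def Let_def)
  have Zm: "Z \<in> sets P" unfolding Z_def P_def by (rule R.A.support_null(1)[OF K])
  then have Zm': "Z \<inter> space P \<in> sets P" by (simp add: sets.Int_space_eq2)
  have fm: "fib \<mu> \<in> borel_measurable (restrict_space P Z)"
    using base unfolding conv_base_def supp[symmetric] by blast
  let ?g = "\<lambda>q. indicator Z q *\<^sub>R fib \<mu> q"
  have gm: "?g \<in> borel_measurable P" using fm borel_measurable_restrict_space_iff[OF Zm'] by blast
  have gm': "?g \<in> borel_measurable (borel_of_top R.A.X)"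
    using gm by (simp add: measurable_cong_sets[OF regular_Borel_probD(2)[OF P] refl])
  have rm: "R.r \<in> measurable (PN \<nu>) (borel_of_top R.A.X)"
    using continuous_map_borel[OF R.continuous_r] by (simp add: measurable_cong_sets[OF regular_Borel_probD(2)[OF regular_PN[OF \<nu>]] refl])
  have "integral\<^sup>L (supp_measure L M s \<nu> N') (fib \<mu>) = integral\<^sup>L P ?g"
    unfolding supp by (rule integral_restrict_space[OF Zm'])
  also have "\<dots> = (\<integral>p. ?g (R.r p) \<partial>PN \<nu>)" unfolding distr by (rule integral_distr[OF rm gm'])
  also have "\<dots> = integral\<^sup>L (PN \<nu>) (fib \<mu>)"
  proof (rule integral_cong_AE)
    show "(\<lambda>p. ?g (R.r p)) \<in> borel_measurable (PN \<nu>)" by (rule measurable_compose[OF rm gm'])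
    show "fib \<mu> \<in> borel_measurable (PN \<nu>)" by (rule fib_PN[OF \<mu> \<nu>])
    have "AE p in PN \<nu>. p \<in> Z2" unfolding PN_def Z2_def by (rule N.support_null(2)[OF rest[OF \<nu>]])
    then show "AE p in PN \<nu>. ?g (R.r p) = fib \<mu> p"
    proof (rule AE_mp[OF _ AE_I2[OF impI]])
      fix p assume p: "p \<in> Z2"
      then have pS: "p \<in> N.S" by (simp add: Z2_def support_def)
      have rZ: "R.r p \<in> Z" using R.r_support[of p "restrict \<nu> N.DA"] p unfolding rr Z_def Z2_def by blast
      then have rS: "R.r p \<in> R.A.S" by (simp add: Z_def support_def)
      define d where "d = (SOME d. realizes M s d p)"
      define d' where "d' = (SOME d. realizes M s d (R.r p))"
      have d: "realizes M s d (R.r p)" unfolding d_def by (rule R.realizes_r[OF realized[OF pS]])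
      have d': "realizes M s d' (R.r p)" unfolding d'_def by (rule someI_ex[OF satur[OF rS]])
      have "\<forall>q \<in> support L M s (univ N') (restrict \<nu> R.A.DA). \<forall>d d'. realizes M s d q \<and> realizes M s d' q \<longrightarrow>
          \<mu> (rsh d D) = \<mu> (rsh d' D)" using base unfolding conv_base_def by blast
      then have "\<mu> (rsh d' D) = \<mu> (rsh d D)"
        using rZ d d' unfolding Z_def \<nu>N'_def by blast
      then have "fib \<mu> (R.r p) = fib \<mu> p" unfolding fiber_value_def d_def d'_def .
      then show "?g (R.r p) = fib \<mu> p" using rZ by simp
    qed
  qed
  finally show ?thesis .
qed

end

section \<open>Convolution and the Ellis semigroup\<close>

context monster_group
begin

abbreviation "cv \<equiv> convolution L \<kappa> M s m"

lemma base_exists: assumes D: "D \<in> DM" shows "\<exists>N. monster_base L T \<kappa> M G s m N D"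
proof -
  from D obtain B where B: "\<And>t. B t \<subseteq> univ M t" "finite (Sigma UNIV B)" "D \<in> defsets L M s B"
    by (rule defsets_finite_params) (rule that)
  obtain N where N: "elem_sub L N M" "small \<kappa> (univ N)" "\<forall>t. univ G t \<subseteq> univ N t" "\<forall>t. B t \<subseteq> univ N t"
    using small_model[OF B(1) small_finite[OF B(2)]] by blast
  have "defsets L M s B \<subseteq> defsets L M s (univ N)" by (rule defsets_mono) (use N(4) in blast)
  then have "D \<in> defsets L M s (univ N)" using B(3) by blast
  then have "monster_base L T \<kappa> M G s m N D"
    by unfold_locales (use N in blast)+
  then show ?thesis ..
qed

lemma star: assumes "\<mu> \<in> FS" "\<nu> \<in> FS" shows "star_Borel L \<kappa> M s m \<mu> \<nu>"
  unfolding star_Borel_def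
proof
  fix D assume "D \<in> DM"
  then obtain N where "monster_base L T \<kappa> M G s m N D" using base_exists by blast
  then interpret monster_base L T \<kappa> M G s m N D .
  show "\<exists>N. conv_base L \<kappa> M s m \<mu> \<nu> D N" using conv_base_N[OF assms] by blast
qed

text \<open>
  The model chosen in the definition of the convolution and the given model \<open>N\<close> lie in a common small model.
\<close>
lemma cv_integral:
  assumes \<mu>: "\<mu> \<in> FS" and \<nu>: "\<nu> \<in> FS" and base: "monster_base L T \<kappa> M G s m N D"
  shows "cv \<mu> \<nu> D = integral\<^sup>L (monster_base.PN L M s N \<nu>) (fiber_value M s m \<mu> D)"
proof -
  interpret N: monster_base L T \<kappa> M G s m N D by (rule base)
  \<comment> \<open>The model picked by the choice operator in the definition of the convolution.\<close>
  define N0 where "N0 = (SOME N. conv_base L \<kappa> M s m \<mu> \<nu> D N)"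
  have N0: "conv_base L \<kappa> M s m \<mu> \<nu> D N0" unfolding N0_def 
    by (rule someI[of "conv_base L \<kappa> M s m \<mu> \<nu> D", OF N.conv_base_N[OF \<mu> \<nu>]])
  then have N0': "elem_sub L N0 M" "small \<kappa> (univ N0)" by (simp_all add: conv_base_def)
  then have N0M: "univ N0 t \<subseteq> univ M t" for t by (simp add: elem_sub_def)
  obtain N1 where N1: "elem_sub L N1 M" "small \<kappa> (univ N1)" "\<forall>t. univ G t \<subseteq> univ N1 t"
    "\<forall>t. univ N0 t \<union> univ N t \<subseteq> univ N1 t"
    using small_model[OF Un_least[OF N0M N.NM] small_Un[OF N0'(2) N.smallN]] by blast
  have sub: "univ N0 t \<subseteq> univ N1 t" "univ N t \<subseteq> univ N1 t" for t using N1(4) by blast+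
  have "defsets L M s (univ N) \<subseteq> defsets L M s (univ N1)" by (rule defsets_mono) (rule sub(2))
  then have "D \<in> defsets L M s (univ N1)" using N.D by blast
  then interpret N1: monster_base L T \<kappa> M G s m N1 D
    by unfold_locales (use N1 in blast)+
  have "cv \<mu> \<nu> D = integral\<^sup>L (supp_measure L M s \<nu> N0) (fiber_value M s m \<mu> D)"
    using star[OF \<mu> \<nu>] N.D_DM by (simp add: convolution_def N0_def Let_def)
  also have "\<dots> = integral\<^sup>L (N1.PN \<nu>) (fiber_value M s m \<mu> D)"
    by (rule N1.integral_independent[OF \<mu> \<nu> N0 sub(1)])
  also have "\<dots> = integral\<^sup>L (supp_measure L M s \<nu> N) (fiber_value M s m \<mu> D)"
    by (rule N1.integral_independent[OF \<mu> \<nu> N.conv_base_N[OF \<mu> \<nu>] sub(2), symmetric])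
  also have "\<dots> = integral\<^sup>L (N.PN \<nu>) (fiber_value M s m \<mu> D)"
    by (rule N.integral_independent[OF \<mu> \<nu> N.conv_base_N[OF \<mu> \<nu>] subset_refl])
  finally show ?thesis .
qed

lemma cv_ext: "\<mu> \<in> FS \<Longrightarrow> \<nu> \<in> FS \<Longrightarrow> cv \<mu> \<nu> \<in> extensional DM"
  using star by (simp add: convolution_def)

lemma cv_conv:
  assumes \<nu>: "\<nu> \<in> FS" and D: "D \<in> DM" and rep: "conv_rep L M G s k n r g"
  shows "cv k \<nu> D = (\<Sum>i<n. r i * \<nu> (lsh (g i) D))"
proof -
  obtain N where base: "monster_base L T \<kappa> M G s m N D" using base_exists[OF D] ..
  then interpret N: monster_base L T \<kappa> M G s m N D .
  show ?thesis unfolding cv_integral[OF conv_rep_FS[OF rep] \<nu> base] by (rule N.integral_conv[OF \<nu> rep])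
qed

text \<open>
  This is where NIP enters, through convergence of the integrals of the fibre functions.
\<close>
lemma cv_lim:
  assumes \<mu>: "\<mu> \<in> FS" and \<nu>: "\<nu> \<in> FS" and D: "D \<in> DM"
  shows "((\<lambda>k. cv k \<nu> D) \<longlongrightarrow> cv \<mu> \<nu> D) (near \<mu>)"
proof -
  obtain N where base: "monster_base L T \<kappa> M G s m N D" using base_exists[OF D] ..
  then interpret N: monster_base L T \<kappa> M G s m N D .
  have "\<forall>\<^sub>F k in near \<mu>. integral\<^sup>L (N.PN \<nu>) (fiber_value M s m k D) = cv k \<nu> D"
    using near_CH
  proof eventually_elim
    case (elim k)
    then have "k \<in> FS" using CH_FS by blast
    then show ?case by (rule cv_integral[OF _ \<nu> base, symmetric])
  qed
  with N.integral_lim[OF \<mu> \<nu>] have "((\<lambda>k. cv k \<nu> D) \<longlongrightarrow> integral\<^sup>L (N.PN \<nu>) (fiber_value M s m \<mu> D)) (near \<mu>)"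
    by (rule Lim_transform_eventually)
  then show ?thesis unfolding cv_integral[OF \<mu> \<nu> base] .
qed

lemma CH_E: assumes "k \<in> CH" obtains n r g where "conv_rep L M G s k n r g"
  using assms unfolding conv_hull_def by blast

lemma lshift_rules:
  "g \<in> univ M s \<Longrightarrow> lsh g (univ M s) = univ M s"
  "lsh g (D \<union> E) = lsh g D \<union> lsh g E"
  "D \<inter> E = {} \<Longrightarrow> lsh g D \<inter> lsh g E = {}"
  "g \<in> univ M s \<Longrightarrow> h \<in> univ M s \<Longrightarrow> lsh h (lsh g D) = lsh (mu g h) D"
  using mu_closed mu_assoc by (auto simp: lshift_def)

lemma cv_CH_FS: assumes k: "k \<in> CH" and \<nu>: "\<nu> \<in> FS" shows "cv k \<nu> \<in> FS"
proof -
  obtain n r g where rep: "conv_rep L M G s k n r g" using k by (rule CH_E)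
  note ev = cv_conv[OF \<nu> _ rep]
  have r: "\<And>i. i < n \<Longrightarrow> 0 \<le> r i" "\<And>i. i < n \<Longrightarrow> g i \<in> univ G s" "(\<Sum>i<n. r i) = 1"
    using rep by (auto simp: conv_rep_def)
  have gM: "\<And>i. i < n \<Longrightarrow> g i \<in> univ M s" using r(2) G_in by blast
  have kF: "k \<in> FS" using k CH_FS by blast
  have "cv k \<nu> \<in> extensional DM" by (rule cv_ext[OF kF \<nu>])
  moreover have "0 \<le> cv k \<nu> D" if D: "D \<in> DM" for D
    unfolding ev[OF D] by (intro sum_nonneg mult_nonneg_nonneg r(1) FS_nonneg[OF \<nu>] lshift_DM[OF D] gM) simp_all
  moreover have "cv k \<nu> (univ M s) = 1"
  proof -
    have "cv k \<nu> (univ M s) = (\<Sum>i<n. r i)"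
      unfolding ev[OF univ_DM] by (rule sum.cong) (simp_all add: lshift_rules(1) gM FS_univ[OF \<nu>])
    then show ?thesis using r(3) by simp
  qed
  moreover have "cv k \<nu> (D \<union> E) = cv k \<nu> D + cv k \<nu> E" if D: "D \<in> DM" "E \<in> DM" "D \<inter> E = {}" for D E
  proof -
    have "cv k \<nu> (D \<union> E) = (\<Sum>i<n. r i * \<nu> (lsh (g i) D) + r i * \<nu> (lsh (g i) E))"
      unfolding ev[OF defsets_Un[OF D(1,2)]]
    proof (rule sum.cong[OF refl])
      fix i assume "i \<in> {..<n}"
      then have gi: "g i \<in> univ M s" using gM by simp
      have "\<nu> (lsh (g i) D \<union> lsh (g i) E) = \<nu> (lsh (g i) D) + \<nu> (lsh (g i) E)"
        by (rule FS_add[OF \<nu> lshift_DM[OF D(1) gi] lshift_DM[OF D(2) gi] lshift_rules(3)[OF D(3)]])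
      then show "r i * \<nu> (lsh (g i) (D \<union> E)) = r i * \<nu> (lsh (g i) D) + r i * \<nu> (lsh (g i) E)"
        by (simp add: lshift_rules(2) distrib_left)
    qed
    then show ?thesis unfolding ev[OF D(1)] ev[OF D(2)] by (simp only: sum.distrib)
  qed
  moreover have "\<exists>a\<in>univ G s. a \<in> D" if D: "D \<in> DM" "cv k \<nu> D > 0" for D
  proof -
    have "\<exists>i<n. \<nu> (lsh (g i) D) > 0"
    proof (rule ccontr)
      assume no: "\<not> ?thesis"
      have "\<nu> (lsh (g i) D) \<le> 0" if "i < n" for i using no that by (meson not_less)
      then have "cv k \<nu> D \<le> 0" unfolding ev[OF D(1)] using r(1) by (intro sum_nonpos mult_nonneg_nonpos) auto
      with D(2) show False by simp
    qed
    then obtain i where i: "i < n" "\<nu> (lsh (g i) D) > 0" by blast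
    from FS_fs[OF \<nu> lshift_DM[OF D(1) gM[OF i(1)]] i(2)] obtain a where a: "a \<in> univ G s" "a \<in> lsh (g i) D" by blast
    then have "mu (g i) a \<in> D" by (simp add: lshift_def)
    moreover have "mu (g i) a \<in> univ G s" by (rule mu_G[OF r(2)[OF i(1)] a(1)])
    ultimately show ?thesis by blast
  qed
  ultimately show ?thesis by (simp add: keisler_fs_def keisler_def)
qed

text \<open>
  All defining properties of the space of measures pass from \<open>conv(G)\<close> to limits.
\<close>
lemma cv_FS: assumes \<mu>: "\<mu> \<in> FS" and \<nu>: "\<nu> \<in> FS" shows "cv \<mu> \<nu> \<in> FS"
proof -
  note lim = cv_lim[OF \<mu> \<nu>]
  have ev: "\<forall>\<^sub>F k in near \<mu>. cv k \<nu> \<in> FS"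
    using near_CH by (rule eventually_mono) (rule cv_CH_FS[OF _ \<nu>])
  have "cv \<mu> \<nu> \<in> extensional DM" by (rule cv_ext[OF \<mu> \<nu>])
  moreover have "0 \<le> cv \<mu> \<nu> D" if D: "D \<in> DM" for D
  proof (rule tendsto_lowerbound[OF lim[OF D] _ near_ne[OF \<mu>]])
    show "\<forall>\<^sub>F k in near \<mu>. 0 \<le> cv k \<nu> D" using ev by (rule eventually_mono) (rule FS_nonneg[OF _ D])
  qed
  moreover have "cv \<mu> \<nu> (univ M s) = 1"
  proof (rule tendsto_unique[OF near_ne[OF \<mu>] lim[OF univ_DM]])
    have "\<forall>\<^sub>F k in near \<mu>. 1 = cv k \<nu> (univ M s)" using ev by (rule eventually_mono) (simp add: FS_univ)
    with tendsto_const show "((\<lambda>k. cv k \<nu> (univ M s)) \<longlongrightarrow> 1) (near \<mu>)" by (rule Lim_transform_eventually)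
  qed
  moreover have "cv \<mu> \<nu> (D \<union> E) = cv \<mu> \<nu> D + cv \<mu> \<nu> E" if D: "D \<in> DM" "E \<in> DM" "D \<inter> E = {}" for D E
  proof (rule tendsto_unique[OF near_ne[OF \<mu>] lim[OF defsets_Un[OF D(1,2)]]])
    have "\<forall>\<^sub>F k in near \<mu>. cv k \<nu> D + cv k \<nu> E = cv k \<nu> (D \<union> E)"
      using ev by (rule eventually_mono) (simp add: FS_add[OF _ D])
    with tendsto_add[OF lim[OF D(1)] lim[OF D(2)]]
    show "((\<lambda>k. cv k \<nu> (D \<union> E)) \<longlongrightarrow> cv \<mu> \<nu> D + cv \<mu> \<nu> E) (near \<mu>)" by (rule Lim_transform_eventually)
  qed
  moreover have "\<exists>a\<in>univ G s. a \<in> D" if D: "D \<in> DM" "cv \<mu> \<nu> D > 0" for D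
  proof -
    have "\<forall>\<^sub>F k in near \<mu>. 0 < cv k \<nu> D" by (rule order_tendstoD(1)[OF lim[OF D(1)] D(2)])
    with ev have "\<forall>\<^sub>F k in near \<mu>. cv k \<nu> \<in> FS \<and> 0 < cv k \<nu> D" by eventually_elim simp
    then obtain k where "cv k \<nu> \<in> FS" "0 < cv k \<nu> D" using eventually_happens'[OF near_ne[OF \<mu>]] by blast
    then show ?thesis using FS_fs[OF _ D(1)] by blast
  qed
  ultimately show ?thesis by (simp add: keisler_fs_def keisler_def)
qed

lemma cv_continuous_left: assumes \<nu>: "\<nu> \<in> FS" shows "continuous_map KT KT (\<lambda>\<mu>. cv \<mu> \<nu>)"
proof (rule continuous_map_KT)
  show "cv \<mu> \<nu> \<in> FS" if "\<mu> \<in> topspace KT" for \<mu> using that \<nu> topspace_KT cv_FS by simp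
  show "continuous_map KT euclideanreal (\<lambda>\<mu>. cv \<mu> \<nu> D)" if D: "D \<in> DM" for D
    by (rule continuous_from_dense) (rule cv_lim[OF _ \<nu> D])
qed

lemma cv_continuous_right: assumes k: "k \<in> CH" shows "continuous_map KT KT (\<lambda>\<nu>. cv k \<nu>)"
proof (rule continuous_map_KT)
  have kF: "k \<in> FS" using k CH_FS by blast
  show "cv k \<nu> \<in> FS" if "\<nu> \<in> topspace KT" for \<nu> using that kF topspace_KT cv_FS by simp
  fix D assume D: "D \<in> DM"
  obtain n r g where rep: "conv_rep L M G s k n r g" using k by (rule CH_E)
  have g: "g i \<in> univ M s" if "i < n" for i using rep that G_in by (simp add: conv_rep_def)
  have "continuous_map KT euclideanreal (\<lambda>\<nu>. \<Sum>i<n. r i * \<nu> (lsh (g i) D))"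
    by (intro continuous_map_sum continuous_map_real_mult_left KT_eval lshift_DM[OF D]) (auto intro: g)
  then show "continuous_map KT euclideanreal (\<lambda>\<nu>. cv k \<nu> D)"
    by (rule continuous_map_eq) (simp add: topspace_KT cv_conv[OF _ D rep])
qed

text \<open>
  Combinations indexed by an arbitrary finite set; below the index set is a product.
\<close>
lemma conv_rep_finite:
  assumes fin: "finite I" and r: "\<And>i. i \<in> I \<Longrightarrow> 0 \<le> r i" "(\<Sum>i\<in>I. r i) = 1"
    and g: "\<And>i. i \<in> I \<Longrightarrow> g i \<in> univ G s"
    and k: "k \<in> extensional DM" "\<And>D. D \<in> DM \<Longrightarrow> k D = (\<Sum>i\<in>I. r i * of_bool (g i \<in> D))"
  shows "\<exists>n r' g'. conv_rep L M G s k n r' g' \<and> (\<forall>\<phi>. (\<Sum>i<n. r' i * \<phi> (g' i)) = (\<Sum>i\<in>I. r i * \<phi> (g i :: 'm) :: real))"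
proof -
  obtain h where h: "bij_betw h {..<card I} I" using bij_betw_from_nat_into_finite[OF fin] by blast
  then have hI: "h i \<in> I" if "i < card I" for i using that by (auto simp: bij_betw_def)
  have sum: "(\<Sum>i<card I. r (h i) * \<phi> (g (h i))) = (\<Sum>i\<in>I. r i * \<phi> (g i))" for \<phi> :: "'m \<Rightarrow> real"
    by (rule sum.reindex_bij_betw[OF h, of "\<lambda>i. r i * \<phi> (g i)"])
  have "conv_rep L M G s k (card I) (\<lambda>i. r (h i)) (\<lambda>i. g (h i))"
    unfolding conv_rep_def
  proof (intro conjI allI impI)
    show "0 \<le> r (h i)" if "i < card I" for i by (rule r(1)[OF hI[OF that]])
    show "g (h i) \<in> univ G s" if "i < card I" for i by (rule g[OF hI[OF that]])
    show "(\<Sum>i<card I. r (h i)) = 1" using r(2) sum[of "\<lambda>_. 1"] by simp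
    show "k = (\<lambda>D\<in>DM. \<Sum>i<card I. r (h i) * dirac L M s (g (h i)) D)"
    proof (rule extensionalityI[OF k(1)])
      fix D assume D: "D \<in> DM"
      have "k D = (\<Sum>i<card I. r (h i) * of_bool (g (h i) \<in> D))" 
        unfolding k(2)[OF D] by (rule sum[of "\<lambda>a. of_bool (a \<in> D)", symmetric])
      also have "\<dots> = (\<Sum>i<card I. r (h i) * dirac L M s (g (h i)) D)"
        using D by (simp add: dirac_def indicator_def of_bool_def)
      finally show "k D = (\<lambda>D\<in>DM. \<Sum>i<card I. r (h i) * dirac L M s (g (h i)) D) D" using D by simp
    qed simp
  qed
  with sum show ?thesis by blast
qed

text \<open>
  Both sides are the combination of the shifts by the products \<open>g i \<cdot> h j\<close> with the weights \<open>r i * t j\<close>.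
\<close>
lemma cv_assoc_CH:
  assumes k: "k \<in> CH" and l: "l \<in> CH" and \<nu>: "\<nu> \<in> FS"
  shows "cv (cv k l) \<nu> = cv k (cv l \<nu>)"
proof -
  have kF: "k \<in> FS" and lF: "l \<in> FS" using k l CH_FS by blast+
  obtain n r g where rep: "conv_rep L M G s k n r g" using k by (rule CH_E)
  obtain n' t h where rep': "conv_rep L M G s l n' t h" using l by (rule CH_E)
  have r: "\<And>i. i < n \<Longrightarrow> 0 \<le> r i" "\<And>i. i < n \<Longrightarrow> g i \<in> univ G s" "(\<Sum>i<n. r i) = 1"
    using rep by (auto simp: conv_rep_def)
  have t: "\<And>i. i < n' \<Longrightarrow> 0 \<le> t i" "\<And>i. i < n' \<Longrightarrow> h i \<in> univ G s" "(\<Sum>i<n'. t i) = 1"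
    using rep' by (auto simp: conv_rep_def)
  let ?I = "{..<n} \<times> {..<n'}"
  let ?w = "\<lambda>(i, j). r i * t j" and ?p = "\<lambda>(i, j). mu (g i) (h j)"
  have dbl: "(\<Sum>x\<in>?I. ?w x * \<phi> (?p x)) = (\<Sum>i<n. r i * (\<Sum>j<n'. t j * \<phi> (mu (g i) (h j))))" for \<phi> :: "'m \<Rightarrow> real"
    unfolding sum.cartesian_product[symmetric]
    by (simp add: sum.cartesian_product' sum_distrib_left mult.assoc)
  have "\<exists>N r' g'. conv_rep L M G s (cv k l) N r' g' \<and>
      (\<forall>\<phi>. (\<Sum>i<N. r' i * \<phi> (g' i)) = (\<Sum>x\<in>?I. ?w x * \<phi> (?p x) :: real))"
  proof (rule conv_rep_finite)
    show "finite ?I" by simp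
    show "0 \<le> ?w x" if "x \<in> ?I" for x using that r(1) t(1) by auto
    show "?p x \<in> univ G s" if "x \<in> ?I" for x using that r(2) t(2) mu_G by auto
    show "(\<Sum>x\<in>?I. ?w x) = 1" using dbl[of "\<lambda>_. 1"] r(3) t(3) by simp
    show "cv k l \<in> extensional DM" by (rule cv_ext[OF kF lF])
    fix D assume D: "D \<in> DM"
    have "cv k l D = (\<Sum>i<n. r i * l (lsh (g i) D))" by (rule cv_conv[OF lF D rep])
    also have "\<dots> = (\<Sum>i<n. r i * (\<Sum>j<n'. t j * of_bool (mu (g i) (h j) \<in> D)))"
    proof (rule sum.cong[OF refl])
      fix i assume "i \<in> {..<n}"
      then have gi: "g i \<in> univ M s" using r(2) G_in by simp
      have "l (lsh (g i) D) = (\<Sum>j<n'. t j * of_bool (h j \<in> lsh (g i) D))"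
        by (rule conv_rep_eval[OF rep' lshift_DM[OF D gi]])
      also have "\<dots> = (\<Sum>j<n'. t j * of_bool (mu (g i) (h j) \<in> D))"
        by (rule sum.cong) (use t(2) G_in in \<open>simp_all add: lshift_def\<close>)
      finally show "r i * l (lsh (g i) D) = r i * (\<Sum>j<n'. t j * of_bool (mu (g i) (h j) \<in> D))" by simp
    qed
    also have "\<dots> = (\<Sum>x\<in>?I. ?w x * of_bool (?p x \<in> D))" by (rule dbl[symmetric])
    finally show "cv k l D = (\<Sum>x\<in>?I. ?w x * of_bool (?p x \<in> D))" .
  qed
  then obtain N r' g' where rep2: "conv_rep L M G s (cv k l) N r' g'"
    and sum2: "\<And>\<phi> :: 'm \<Rightarrow> real. (\<Sum>i<N. r' i * \<phi> (g' i)) = (\<Sum>x\<in>?I. ?w x * \<phi> (?p x))" by blast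
  have klF: "cv k l \<in> FS" by (rule cv_FS[OF kF lF])
  have lvF: "cv l \<nu> \<in> FS" by (rule cv_FS[OF lF \<nu>])
  show ?thesis
  proof (rule extensionalityI[OF cv_ext[OF klF \<nu>] cv_ext[OF kF lvF]])
    fix D assume D: "D \<in> DM"
    have "cv (cv k l) \<nu> D = (\<Sum>i<N. r' i * \<nu> (lsh (g' i) D))" by (rule cv_conv[OF \<nu> D rep2])
    also have "\<dots> = (\<Sum>i<n. r i * (\<Sum>j<n'. t j * \<nu> (lsh (mu (g i) (h j)) D)))"
      unfolding sum2[of "\<lambda>a. \<nu> (lsh a D)"] by (rule dbl)
    also have "\<dots> = (\<Sum>i<n. r i * cv l \<nu> (lsh (g i) D))"
    proof (rule sum.cong[OF refl])
      fix i assume "i \<in> {..<n}"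
      then have gi: "g i \<in> univ M s" using r(2) G_in by simp
      have "cv l \<nu> (lsh (g i) D) = (\<Sum>j<n'. t j * \<nu> (lsh (h j) (lsh (g i) D)))"
        by (rule cv_conv[OF \<nu> lshift_DM[OF D gi] rep'])
      also have "\<dots> = (\<Sum>j<n'. t j * \<nu> (lsh (mu (g i) (h j)) D))"
        by (rule sum.cong) (use t(2) G_in gi in \<open>simp_all add: lshift_rules(4)\<close>)
      finally show "r i * (\<Sum>j<n'. t j * \<nu> (lsh (mu (g i) (h j)) D)) = r i * cv l \<nu> (lsh (g i) D)" by simp
    qed
    also have "\<dots> = cv k (cv l \<nu>) D" by (rule cv_conv[OF lvF D rep, symmetric])
    finally show "cv (cv k l) \<nu> D = cv k (cv l \<nu>) D" .
  qed
qed

text \<open>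
  For \<open>\<mu>\<close> in \<open>conv(G)\<close> both sides are continuous in \<open>\<nu>\<close>; for arbitrary \<open>\<mu>\<close> they are continuous in \<open>\<mu>\<close>.
  Each time it is enough to compare them on the dense set \<open>conv(G)\<close>.
\<close>
lemma cv_assoc:
  assumes \<mu>: "\<mu> \<in> FS" and \<nu>: "\<nu> \<in> FS" and \<xi>: "\<xi> \<in> FS"
  shows "cv (cv \<mu> \<nu>) \<xi> = cv \<mu> (cv \<nu> \<xi>)"
proof -
  have 1: "cv (cv k \<nu>) \<xi> = cv k (cv \<nu> \<xi>)" if k: "k \<in> CH" for k
  proof (rule forall_in_closure_of_eq[where X = KT and S = CH and Y = KT and f = "\<lambda>\<nu>. cv (cv k \<nu>) \<xi>" and g = "\<lambda>\<nu>. cv k (cv \<nu> \<xi>)"])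
    show "\<nu> \<in> KT closure_of CH" using \<nu> dense_CH by simp
    show "Hausdorff_space KT" by (rule Hausdorff_KT)
    show "continuous_map KT KT (\<lambda>\<nu>. cv (cv k \<nu>) \<xi>)"
      using continuous_map_compose[OF cv_continuous_right[OF k] cv_continuous_left[OF \<xi>]] by (simp add: o_def)
    show "continuous_map KT KT (\<lambda>\<nu>. cv k (cv \<nu> \<xi>))"
      using continuous_map_compose[OF cv_continuous_left[OF \<xi>] cv_continuous_right[OF k]] by (simp add: o_def)
    show "cv (cv k l) \<xi> = cv k (cv l \<xi>)" if "l \<in> CH" for l by (rule cv_assoc_CH[OF k that \<xi>])
  qed
  show ?thesis
  proof (rule forall_in_closure_of_eq[where X = KT and S = CH and Y = KT and f = "\<lambda>\<mu>. cv (cv \<mu> \<nu>) \<xi>" and g = "\<lambda>\<mu>. cv \<mu> (cv \<nu> \<xi>)"])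
    show "\<mu> \<in> KT closure_of CH" using \<mu> dense_CH by simp
    show "Hausdorff_space KT" by (rule Hausdorff_KT)
    show "continuous_map KT KT (\<lambda>\<mu>. cv (cv \<mu> \<nu>) \<xi>)"
      using continuous_map_compose[OF cv_continuous_left[OF \<nu>] cv_continuous_left[OF \<xi>]] by (simp add: o_def)
    show "continuous_map KT KT (\<lambda>\<mu>. cv \<mu> (cv \<nu> \<xi>))" by (rule cv_continuous_left[OF cv_FS[OF \<nu> \<xi>]])
    show "cv (cv k \<nu>) \<xi> = cv k (cv \<nu> \<xi>)" if "k \<in> CH" for k by (rule 1[OF that])
  qed
qed

abbreviation "\<rho> \<equiv> rho L \<kappa> M G s m"
abbreviation "ST \<equiv> selfmap_topology L M G s"

lemma rho_apply: "\<mu> \<in> FS \<Longrightarrow> \<rho> \<nu> \<mu> = cv \<nu> \<mu>" by (simp add: rho_def)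

lemma rho_continuous: "continuous_map KT ST \<rho>"
  unfolding selfmap_topology_def continuous_map_componentwise
proof (intro conjI ballI)
  show "\<rho> ` topspace KT \<subseteq> extensional FS" by (auto simp: rho_def)
  fix \<mu> assume \<mu>: "\<mu> \<in> FS"
  show "continuous_map KT KT (\<lambda>\<nu>. \<rho> \<nu> \<mu>)" unfolding rho_apply[OF \<mu>] by (rule cv_continuous_left[OF \<mu>])
qed

lemma Hausdorff_ST: "Hausdorff_space ST"
  by (simp add: selfmap_topology_def Hausdorff_space_product_topology Hausdorff_KT)

text \<open>
  For \<open>\<nu>\<close> in \<open>conv(G)\<close> this is immediate, and both sides are limits of their values there.
\<close>
lemma cv_dirac:
  assumes \<nu>: "\<nu> \<in> FS" and g: "g \<in> univ G s" and D: "D \<in> DM"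
  shows "cv \<nu> (dirac L M s g) D = \<nu> (rsh g D)"
proof (rule tendsto_unique[OF near_ne[OF \<nu>]])
  have gM: "g \<in> univ M s" by (rule G_in[OF g])
  have dF: "dirac L M s g \<in> FS" using dirac_CH[OF g] CH_FS by blast
  have sD: "rsh g D \<in> DM" by (rule rshift_DM[OF D gM])
  show "((\<lambda>k. cv k (dirac L M s g) D) \<longlongrightarrow> cv \<nu> (dirac L M s g) D) (near \<nu>)" by (rule cv_lim[OF \<nu> dF D])
  have "\<forall>\<^sub>F k in near \<nu>. k (rsh g D) = cv k (dirac L M s g) D"
    using near_CH
  proof eventually_elim
    case (elim k)
    then obtain n r h where rep: "conv_rep L M G s k n r h" by (rule CH_E)
    have h: "h i \<in> univ M s" if "i < n" for i using rep that G_in by (simp add: conv_rep_def)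
    have "cv k (dirac L M s g) D = (\<Sum>i<n. r i * dirac L M s g (lsh (h i) D))" by (rule cv_conv[OF dF D rep])
    also have "\<dots> = (\<Sum>i<n. r i * of_bool (h i \<in> rsh g D))"
    proof (rule sum.cong[OF refl])
      fix i assume "i \<in> {..<n}"
      then have hi: "h i \<in> univ M s" using h by simp
      show "r i * dirac L M s g (lsh (h i) D) = r i * of_bool (h i \<in> rsh g D)"
        using lshift_DM[OF D hi] hi gM by (simp add: dirac_def lshift_def rshift_def indicator_def)
    qed
    also have "\<dots> = k (rsh g D)" by (rule conv_rep_eval[OF rep sD, symmetric])
    finally show ?case by simp
  qed
  with near_tendsto[OF \<nu> sD]
  show "((\<lambda>k. cv k (dirac L M s g) D) \<longlongrightarrow> \<nu> (rsh g D)) (near \<nu>)" by (rule Lim_transform_eventually)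
qed

text \<open>
  Every definable set is a right shift by \<open>g\<close>, namely of its shift by the inverse of \<open>g\<close>.
\<close>
lemma rho_inj: "inj_on \<rho> FS"
proof (rule inj_onI)
  fix \<mu> \<nu> assume \<mu>: "\<mu> \<in> FS" and \<nu>: "\<nu> \<in> FS" and eq: "\<rho> \<mu> = \<rho> \<nu>"
  obtain g where g: "g \<in> univ G s" using G_nonempty by blast
  have gM: "g \<in> univ M s" by (rule G_in[OF g])
  obtain h where h: "h \<in> univ M s" "\<And>a. a \<in> univ M s \<Longrightarrow> mu (mu a g) h = a" using mu_cancel[OF gM] by blast
  have dF: "dirac L M s g \<in> FS" using dirac_CH[OF g] CH_FS by blast
  have cveq: "cv \<mu> (dirac L M s g) = cv \<nu> (dirac L M s g)"
    using fun_cong[OF eq, of "dirac L M s g"] by (simp add: rho_apply[OF dF])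
  show "\<mu> = \<nu>"
  proof (rule extensionalityI[OF FS_ext[OF \<mu>] FS_ext[OF \<nu>]])
    fix D assume D: "D \<in> DM"
    let ?E = "rsh h D"
    have E: "?E \<in> DM" by (rule rshift_DM[OF D h(1)])
    have "rsh g ?E = D" using h gM mu_closed defsets_sub[OF D] by (auto simp: rshift_def)
    then show "\<mu> D = \<nu> D" using cv_dirac[OF \<mu> g E] cv_dirac[OF \<nu> g E] cveq by simp
  qed
qed

text \<open>
  The convolution formula shows in particular that the action does not depend on the chosen representation
  of \<open>k\<close>.
\<close>
lemma action_map_eq: assumes k: "k \<in> CH" shows "action_map L M G s m k = \<rho> k"
proof -
  have kF: "k \<in> FS" using k CH_FS by blast
  have any: "(\<lambda>\<mu>\<in>FS. \<lambda>D\<in>DM. \<Sum>i<n. r i * \<mu> (lsh (g i) D)) = \<rho> k"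
    if rep: "conv_rep L M G s k n r g" for n r g
    unfolding rho_def
  proof (rule restrict_ext)
    fix \<mu> assume \<mu>: "\<mu> \<in> FS"
    show "(\<lambda>D\<in>DM. \<Sum>i<n. r i * \<mu> (lsh (g i) D)) = cv k \<mu>"
      by (rule extensionalityI[OF restrict_extensional cv_ext[OF kF \<mu>]]) (simp add: cv_conv[OF \<mu> _ rep])
  qed
  obtain n r g where rep: "conv_rep L M G s k n r g" using k by (rule CH_E)
  show ?thesis
    unfolding action_map_def
  proof (rule the_equality)
    show "\<exists>n r g. conv_rep L M G s k n r g \<and> \<rho> k = (\<lambda>\<mu>\<in>FS. \<lambda>D\<in>DM. \<Sum>i<n. r i * \<mu> (lsh (g i) D))"
      using rep any[OF rep, symmetric] by (intro exI conjI)
    fix \<pi> assume "\<exists>n r g. conv_rep L M G s k n r g \<and> \<pi> = (\<lambda>\<mu>\<in>FS. \<lambda>D\<in>DM. \<Sum>i<n. r i * \<mu> (lsh (g i) D))"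
    then obtain n r g where "conv_rep L M G s k n r g" "\<pi> = (\<lambda>\<mu>\<in>FS. \<lambda>D\<in>DM. \<Sum>i<n. r i * \<mu> (lsh (g i) D))"
      by (elim exE conjE)
    then show "\<pi> = \<rho> k" using any by simp
  qed
qed

text \<open>
  The image is closed by compactness, and \<open>\<rho>\<close> maps the closure of \<open>conv(G)\<close> into the closure of its image.
\<close>
lemma ellis_eq: "ellis L M G s m = \<rho> ` FS"
proof -
  have im: "action_map L M G s m ` CH = \<rho> ` CH" by (rule image_cong[OF refl]) (rule action_map_eq)
  have "compactin KT FS" using compact_KT by (simp add: compact_space_def topspace_KT)
  then have "closedin ST (\<rho> ` FS)"
    by (intro compactin_imp_closedin[OF Hausdorff_ST] image_compactin[OF _ rho_continuous])
  then have 1: "ST closure_of (\<rho> ` CH) \<subseteq> \<rho> ` FS" by (intro closure_of_minimal image_mono CH_FS)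
  have "\<rho> ` (KT closure_of CH) \<subseteq> ST closure_of (\<rho> ` CH)"
    by (rule continuous_map_image_closure_subset[OF rho_continuous])
  then have 2: "\<rho> ` FS \<subseteq> ST closure_of (\<rho> ` CH)" unfolding dense_CH .
  show ?thesis unfolding ellis_def im using 1 2 by (rule equalityI)
qed

lemma rho_homeomorphic: "homeomorphic_map KT (ellis_topology L M G s m) \<rho>"
proof (rule continuous_imp_homeomorphic_map)
  have topST: "\<rho> ` FS \<subseteq> topspace ST" using continuous_map_image_subset_topspace[OF rho_continuous] by (simp add: topspace_KT)
  show "continuous_map KT (ellis_topology L M G s m) \<rho>"
    unfolding ellis_topology_def ellis_eq continuous_map_in_subtopology
    using rho_continuous by (simp add: topspace_KT)
  show "compact_space KT" by (rule compact_KT)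
  show "Hausdorff_space (ellis_topology L M G s m)"
    unfolding ellis_topology_def by (rule Hausdorff_space_subtopology[OF Hausdorff_ST])
  show "\<rho> ` topspace KT = topspace (ellis_topology L M G s m)"
    unfolding ellis_topology_def ellis_eq topspace_subtopology topspace_KT using topST by blast
  show "inj_on \<rho> (topspace KT)" unfolding topspace_KT by (rule rho_inj)
qed

lemma rho_hom: assumes \<mu>: "\<mu> \<in> FS" and \<nu>: "\<nu> \<in> FS" shows "\<rho> (cv \<mu> \<nu>) = compose FS (\<rho> \<mu>) (\<rho> \<nu>)"
  unfolding compose_def rho_def
proof (rule restrict_ext)
  fix \<xi> assume \<xi>: "\<xi> \<in> FS"
  then show "cv (cv \<mu> \<nu>) \<xi> = restrict (cv \<mu>) FS (restrict (cv \<nu>) FS \<xi>)"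
    using cv_assoc[OF \<mu> \<nu> \<xi>] cv_FS[OF \<nu> \<xi>] by simp
qed

lemma rho_iso: "semigroup_iso FS cv (ellis L M G s m) (compose FS) \<rho>"
proof -
  have S1: "semigroup_on FS cv" unfolding semigroup_on_def using cv_FS cv_assoc by simp
  have S2: "semigroup_on (ellis L M G s m) (compose FS)"
    unfolding semigroup_on_def ellis_eq
  proof (intro conjI ballI)
    show "compose FS x y \<in> \<rho> ` FS" if "x \<in> \<rho> ` FS" "y \<in> \<rho> ` FS" for x y
    proof -
      from that obtain \<mu> \<nu> where mn: "\<mu> \<in> FS" "x = \<rho> \<mu>" "\<nu> \<in> FS" "y = \<rho> \<nu>" by blast
      then have "compose FS x y = \<rho> (cv \<mu> \<nu>)" by (simp add: rho_hom)
      then show ?thesis using cv_FS[OF mn(1,3)] by (rule image_eqI)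
    qed
    show "compose FS (compose FS x y) z = compose FS x (compose FS y z)"
      if "x \<in> \<rho> ` FS" "y \<in> \<rho> ` FS" "z \<in> \<rho> ` FS" for x y z
    proof -
      from that obtain \<mu> \<nu> \<xi> where mn: "\<mu> \<in> FS" "x = \<rho> \<mu>" "\<nu> \<in> FS" "y = \<rho> \<nu>" "\<xi> \<in> FS" "z = \<rho> \<xi>" by blast
      then show ?thesis by (simp add: rho_hom[symmetric] cv_FS cv_assoc)
    qed
  qed
  have "bij_betw \<rho> FS (ellis L M G s m)" unfolding ellis_eq by (rule inj_on_imp_bij_betw[OF rho_inj])
  with S1 S2 show ?thesis unfolding semigroup_iso_def using rho_hom by blast
qed

end

theorem theorem6p10:
  fixes L :: "('s, 'f, 'r) language"
    and T :: "('s, 'f, 'r) fm set"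
    and \<kappa> :: "'k rel"
    and M G :: "('s, 'f, 'r, 'm) struct"
    and s :: 's
    and m :: 'f
  assumes "is_theory L T"
    and "expands_group L T s m TYPE('m)"
    and "NIP_theory L T TYPE('m)"
    and "models L T M"
    and "monster L \<kappa> M"
    and "elem_sub L G M"
    and "small \<kappa> (univ G)"
  shows "homeomorphic_map (keisler_fs_topology L M G s) (ellis_topology L M G s m) (rho L \<kappa> M G s m)
    \<and> semigroup_iso (keisler_fs L M G s) (convolution L \<kappa> M s m)
        (ellis L M G s m) (compose (keisler_fs L M G s)) (rho L \<kappa> M G s m)"
proof -
  interpret monster_group L T \<kappa> M G s m by unfold_locales (rule assms)+
  from rho_homeomorphic rho_iso show ?thesis by (rule conjI)
qed

end
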